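(* For every $p_0 > 0$, there exists an analytic self-map $\phi \colon \mathbb{D} \to \mathbb{D}$ such that the composition operator $C_\phi \colon H^2 \to H^2$ is in the Schatten class $S_{p_0}$, but not in $S_p$ for any $p$ with $0 < p < p_0$.
   Context: $\mathbb{D}$ is the open unit disc of $\mathbb{C}$ and $H^2$ the Hardy space on $\mathbb{D}$. For an analytic self-map $\phi\colon\mathbb{D}\to\mathbb{D}$, $C_\phi(f) = f\circ\phi$ is the (bounded) composition operator on $H^2$. For $p>0$, $S_p$ is the Schatten class of operators on $H^2$, i.e. the compact operators whose sequence of singular numbers is in $\ell^p$. *)

theory Defs
  imports "HOL-Complex_Analysis.Complex_Analysis" "HOL-Library.Function_Algebras"
begin

definition fun_scale :: "complex \<Rightarrow> (complex \<Rightarrow> complex) \<Rightarrow> complex \<Rightarrow> complex" where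
  "fun_scale c f = (\<lambda>z. c * f z)"

global_interpretation cfun: vector_space fun_scale
  by unfold_locales (auto simp: fun_scale_def fun_eq_iff algebra_simps)

definition taylor_coeff :: "(complex \<Rightarrow> complex) \<Rightarrow> nat \<Rightarrow> complex" where
  "taylor_coeff f n = (deriv ^^ n) f 0 / fact n"

text \<open>An element of \<open>H\<^sup>2\<close> is an analytic function on the unit disc with square-summable Taylor
  coefficients at the origin. It is represented by its extension by \<open>0\<close> to the whole plane, so that
  equality in \<open>H\<^sup>2\<close> is equality of HOL functions.\<close>

definition hardy2 :: "(complex \<Rightarrow> complex) set" where
  "hardy2 = {f. f holomorphic_on ball 0 1 \<and> (\<forall>z. z \<notin> ball 0 1 \<longrightarrow> f z = 0) \<and>
                summable (\<lambda>n. (cmod (taylor_coeff f n))\<^sup>2)}"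

definition hardy_inner :: "(complex \<Rightarrow> complex) \<Rightarrow> (complex \<Rightarrow> complex) \<Rightarrow> complex" where
  "hardy_inner f g = (\<Sum>n. taylor_coeff f n * cnj (taylor_coeff g n))"

definition hardy_norm :: "(complex \<Rightarrow> complex) \<Rightarrow> real" where
  "hardy_norm f = sqrt (\<Sum>n. (cmod (taylor_coeff f n))\<^sup>2)"

definition hardy_linear :: "((complex \<Rightarrow> complex) \<Rightarrow> complex \<Rightarrow> complex) \<Rightarrow> bool" where
  "hardy_linear T \<longleftrightarrow>
     T ` hardy2 \<subseteq> hardy2 \<and>
     (\<forall>f\<in>hardy2. \<forall>g\<in>hardy2. T (f + g) = T f + T g) \<and>
     (\<forall>c. \<forall>f\<in>hardy2. T (fun_scale c f) = fun_scale c (T f))"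

text \<open>Relative compactness of the image of the closed unit ball, in sequential form. Boundedness
  of \<open>T\<close> is a consequence.\<close>

definition hardy_compact :: "((complex \<Rightarrow> complex) \<Rightarrow> complex \<Rightarrow> complex) \<Rightarrow> bool" where
  "hardy_compact T \<longleftrightarrow>
     hardy_linear T \<and>
     (\<forall>u :: nat \<Rightarrow> complex \<Rightarrow> complex. (\<forall>n. u n \<in> hardy2 \<and> hardy_norm (u n) \<le> 1) \<longrightarrow>
        (\<exists>g\<in>hardy2. \<exists>r :: nat \<Rightarrow> nat. strict_mono r \<and>
           (\<lambda>n. hardy_norm (T (u (r n)) - g)) \<longlonglongrightarrow> 0))"

text \<open>\<open>adjoint_at T g h\<close> says that \<open>T\<^sup>* g = h\<close>, where \<open>T\<^sup>*\<close> is the Hilbert space adjoint of \<open>T\<close>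
  on \<open>H\<^sup>2\<close>; such an \<open>h\<close> is unique.\<close>

definition adjoint_at ::
  "((complex \<Rightarrow> complex) \<Rightarrow> complex \<Rightarrow> complex) \<Rightarrow> (complex \<Rightarrow> complex) \<Rightarrow> (complex \<Rightarrow> complex) \<Rightarrow> bool" where
  "adjoint_at T g h \<longleftrightarrow> h \<in> hardy2 \<and> (\<forall>f\<in>hardy2. hardy_inner (T f) g = hardy_inner f h)"

text \<open>The eigenspace of \<open>T\<^sup>* T\<close> for the eigenvalue \<open>t\<^sup>2\<close>, i.e. for \<open>t \<ge> 0\<close> the eigenspace of
  \<open>(T\<^sup>* T)\<^bsup>1/2\<^esup>\<close> for the eigenvalue \<open>t\<close>.\<close>

definition singular_space ::
  "((complex \<Rightarrow> complex) \<Rightarrow> complex \<Rightarrow> complex) \<Rightarrow> real \<Rightarrow> (complex \<Rightarrow> complex) set" where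
  "singular_space T t = {f \<in> hardy2. adjoint_at T (T f) (fun_scale (of_real (t\<^sup>2)) f)}"

text \<open>The singular numbers of a compact \<open>T\<close>: the positive eigenvalues of \<open>(T\<^sup>* T)\<^bsup>1/2\<^esup>\<close> in
  nonincreasing order, each repeated according to its (complex, finite) multiplicity, followed by
  zeros if there are only finitely many of them. The finiteness clause is needed because
  \<^const>\<open>card\<close> and \<^const>\<open>cfun.dim\<close> return \<open>0\<close> in the infinite case. For compact \<open>T\<close> there is
  exactly one such sequence.\<close>

definition singular_numbers ::
  "((complex \<Rightarrow> complex) \<Rightarrow> complex \<Rightarrow> complex) \<Rightarrow> (nat \<Rightarrow> real) \<Rightarrow> bool" where
  "singular_numbers T s \<longleftrightarrow>
     decseq s \<and> (\<forall>n. s n \<ge> 0) \<and>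
     (\<forall>t>0. finite {n. s n = t} \<and> card {n. s n = t} = cfun.dim (singular_space T t))"

definition schatten :: "real \<Rightarrow> ((complex \<Rightarrow> complex) \<Rightarrow> complex \<Rightarrow> complex) set" where
  "schatten p = {T. hardy_compact T \<and>
                    (\<exists>s. singular_numbers T s \<and> summable (\<lambda>n. s n powr p))}"

definition comp_op :: "(complex \<Rightarrow> complex) \<Rightarrow> (complex \<Rightarrow> complex) \<Rightarrow> complex \<Rightarrow> complex" where
  "comp_op \<phi> f = (\<lambda>z. if z \<in> ball 0 1 then f (\<phi> z) else 0)"

end

theory Submission
  imports Defs "HOL-Real_Asymp.Real_Asymp"
begin

text \<open>Let \<open>\<eta>\<close> map the disc conformally onto the strip \<open>- \<pi>/2 < Im < 0\<close> so that the upper semicircle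
  goes to the real line by \<open>\<theta> \<mapsto> y = ln (cot (\<theta>/2)) / 2\<close>, and put \<open>\<phi> = exp (- \<i> R \<eta> - q (\<eta>))\<close> where
  \<open>q y = exp (- p\<^sub>0 s) (4/p\<^sub>0 + s)\<^sup>2\<close>, \<open>s = ln (1 + exp y)\<close>. On the upper semicircle \<open>\<phi>\<close> has modulus
  \<open>exp (- q)\<close> and winds infinitely often around the origin with phase \<open>R y\<close>; on the lower one its modulus is
  at most \<open>\<delta> < 1\<close>. Integrating by parts twice shows that for large \<open>R\<close> the powers of \<open>\<phi>\<close> are so
  close to orthogonal that, by Schur's test, \<open>\<parallel>f \<circ> \<phi>\<parallel>\<^sup>2\<close> is comparable to \<open>\<Sum>n. \<bar>a\<^sub>n\<bar>\<^sup>2 D n\<close> for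
  \<open>f = \<Sum>n. a\<^sub>n z\<^sup>n\<close>, where \<open>D n\<close> is the mean of \<open>exp (- 2 n q)\<close> over the upper semicircle. By
  the min-max principle the singular numbers of \<open>C\<^sub>\<phi>\<close> are comparable to \<open>sqrt (D n)\<close>. The factor
  \<open>exp (- p\<^sub>0 s)\<close> makes \<open>D n\<close> decay like \<open>n powr (- 2 / p\<^sub>0)\<close>, and the factor \<open>(4/p\<^sub>0 + s)\<^sup>2\<close> improves this
  by just enough logarithms for \<open>\<Sum>n. D n powr (p\<^sub>0 / 2)\<close> to converge.\<close>

section \<open>The Hardy space as a Hilbert space\<close>

text \<open>The diagonal weights tend to 0, so the off-diagonal inner products of powers of
  \<open>\<phi>\<close> must be small relative to them; an absolute bound on oscillating integrals
  would not do. Every estimate therefore compares an integral with the integral of the same weight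
  \<open>exp (- N q)\<close>, uniformly in \<open>N\<close>. This asks for a function
  \<open>q\<close> whose derivative \<open>- P\<close> satisfies
  \<open>\<bar>P'\<bar> \<le> C P\<close>, and the shift \<open>4/p\<^sub>0\<close> in
  \<open>q\<close> yields exactly this. The exponents come from geometry: close to the point 1 the
  angle is comparable to \<open>exp (- 2 y)\<close>, so \<open>n q\<close> stays bounded on an arc
  of length about \<open>n powr (- 2 / p\<^sub>0)\<close>, up to logarithms. On the lower semicircle
  no orthogonality is available. It is pushed so deep into the disc that its share of the norm is
  absorbed by the diagonal part of the upper one.\<close>

lemma taylor_coeff_sums:
  assumes "f holomorphic_on ball 0 1" "cmod z < 1"
  shows "(\<lambda>n. taylor_coeff f n * z ^ n) sums f z"
  using holomorphic_power_series[OF assms(1), of z] assms(2)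
  by (simp add: taylor_coeff_def)

lemma taylor_coeff_unique:
  assumes "\<And>z. cmod z < 1 \<Longrightarrow> (\<lambda>n. a n * z ^ n) sums f z"
  shows "taylor_coeff f n = a n"
proof -
  have "f has_fps_expansion Abs_fps a"
    by (rule has_fps_expansionI, rule eventually_nhds_in_open[THEN eventually_mono, of "ball 0 1"])
      (use assms in auto)
  from fps_nth_fps_expansion[OF this, of n] show ?thesis
    by (simp add: taylor_coeff_def)
qed

lemma hardy2_holomorphic: "f \<in> hardy2 \<Longrightarrow> f holomorphic_on ball 0 1"
  and hardy2_outside: "f \<in> hardy2 \<Longrightarrow> \<not> cmod z < 1 \<Longrightarrow> f z = 0"
  and hardy2_summable: "f \<in> hardy2 \<Longrightarrow> summable (\<lambda>n. (cmod (taylor_coeff f n))\<^sup>2)"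
  by (auto simp: hardy2_def)

lemma hardy2_sums: "f \<in> hardy2 \<Longrightarrow> cmod z < 1 \<Longrightarrow> (\<lambda>n. taylor_coeff f n * z ^ n) sums f z"
  using taylor_coeff_sums hardy2_holomorphic by blast

lemma hardy2_eqI:
  assumes "f \<in> hardy2" "g \<in> hardy2" "\<And>n. taylor_coeff f n = taylor_coeff g n"
  shows "f = g"
proof
  fix z show "f z = g z"
    using hardy2_sums[OF assms(1), of z] hardy2_sums[OF assms(2), of z] assms(3)
      hardy2_outside[OF assms(1), of z] hardy2_outside[OF assms(2), of z]
    by (cases "cmod z < 1") (auto intro: sums_unique2)
qed

section \<open>Square-summable sequences as functions, and the vector space operations\<close>

definition hardy_series :: "(nat \<Rightarrow> complex) \<Rightarrow> complex \<Rightarrow> complex" where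
  "hardy_series a z = (if z \<in> ball 0 1 then \<Sum>n. a n * z ^ n else 0)"

text \<open>Square summability bounds the coefficients, so a geometric series dominates.\<close>

lemma square_summable_power_series:
  assumes "summable (\<lambda>n. (cmod (a n))\<^sup>2)" "cmod z < 1"
  shows "summable (\<lambda>n. norm (a n * z ^ n))"
proof -
  have "(\<lambda>n. (cmod (a n))\<^sup>2) \<longlonglongrightarrow> 0" using assms(1) by (rule summable_LIMSEQ_zero)
  then have "Bseq (\<lambda>n. (cmod (a n))\<^sup>2)" by (rule convergentI[THEN convergent_imp_Bseq])
  then obtain K where K: "\<And>n. (cmod (a n))\<^sup>2 \<le> K" by (auto simp: Bseq_def)
  show ?thesis
  proof (rule summable_comparison_test')
    show "summable (\<lambda>n. sqrt K * cmod z ^ n)"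
      using assms(2) by (intro summable_mult summable_geometric) auto
    fix n show "norm (norm (a n * z ^ n)) \<le> sqrt K * cmod z ^ n"
      using K[of n] by (simp add: norm_mult norm_power mult_right_mono real_le_rsqrt)
  qed
qed

lemma hardy_series_sums:
  assumes "summable (\<lambda>n. (cmod (a n))\<^sup>2)" "cmod z < 1"
  shows "(\<lambda>n. a n * z ^ n) sums hardy_series a z"
  using summable_norm_cancel[OF square_summable_power_series[OF assms]] assms(2)
  by (simp add: hardy_series_def summable_sums)

lemma taylor_coeff_hardy_series:
  assumes "summable (\<lambda>n. (cmod (a n))\<^sup>2)"
  shows "taylor_coeff (hardy_series a) n = a n"
  by (rule taylor_coeff_unique, rule hardy_series_sums[OF assms])

lemma hardy_series_mem:
  assumes "summable (\<lambda>n. (cmod (a n))\<^sup>2)"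
  shows "hardy_series a \<in> hardy2"
proof -
  have "hardy_series a holomorphic_on ball 0 1"
    by (rule power_series_holomorphic[where a = a])
       (use hardy_series_sums[OF assms] in auto)
  then show ?thesis
    using assms taylor_coeff_hardy_series[OF assms] by (auto simp: hardy2_def hardy_series_def)
qed

lemma summable_cmod_add_square:
  assumes "summable (\<lambda>n. (cmod (a n))\<^sup>2)" "summable (\<lambda>n. (cmod (b n))\<^sup>2)"
  shows "summable (\<lambda>n. (cmod (a n + b n))\<^sup>2)"
proof (rule summable_comparison_test')
  show "summable (\<lambda>n. 2 * ((cmod (a n))\<^sup>2 + (cmod (b n))\<^sup>2))"
    using assms by (intro summable_mult summable_add)
  fix n
  have "(cmod (a n + b n))\<^sup>2 \<le> (cmod (a n) + cmod (b n))\<^sup>2"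
    by (intro power_mono norm_triangle_ineq) auto
  also have "\<dots> \<le> 2 * ((cmod (a n))\<^sup>2 + (cmod (b n))\<^sup>2)"
    using sum_squares_ge_zero[of "cmod (a n) - cmod (b n)" 0] by (simp add: power2_eq_square algebra_simps)
  finally show "norm ((cmod (a n + b n))\<^sup>2) \<le> 2 * ((cmod (a n))\<^sup>2 + (cmod (b n))\<^sup>2)" by simp
qed

lemma summable_cmod_mult_cnj:
  assumes "summable (\<lambda>n. (cmod (a n))\<^sup>2)" "summable (\<lambda>n. (cmod (b n))\<^sup>2)"
  shows "summable (\<lambda>n. a n * cnj (b n))"
proof (rule summable_comparison_test')
  show "summable (\<lambda>n. (cmod (a n))\<^sup>2 + (cmod (b n))\<^sup>2)"
    using assms by (intro summable_add)
  fix n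
  have "0 \<le> (cmod (a n) - cmod (b n))\<^sup>2" "0 \<le> cmod (a n) * cmod (b n)" by auto
  then show "norm (a n * cnj (b n)) \<le> (cmod (a n))\<^sup>2 + (cmod (b n))\<^sup>2"
    unfolding norm_mult complex_mod_cnj power2_diff by linarith
qed

lemma taylor_coeff_add:
  assumes "f \<in> hardy2" "g \<in> hardy2"
  shows "taylor_coeff (f + g) n = taylor_coeff f n + taylor_coeff g n"
  by (rule taylor_coeff_unique)
     (use assms in \<open>auto simp: ring_distribs intro!: sums_add hardy2_sums\<close>)

lemma taylor_coeff_diff:
  assumes "f \<in> hardy2" "g \<in> hardy2"
  shows "taylor_coeff (f - g) n = taylor_coeff f n - taylor_coeff g n"
  by (rule taylor_coeff_unique)
     (use assms in \<open>auto simp: ring_distribs intro!: sums_diff hardy2_sums\<close>)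

lemma taylor_coeff_scale:
  assumes "f \<in> hardy2"
  shows "taylor_coeff (fun_scale c f) n = c * taylor_coeff f n"
  by (rule taylor_coeff_unique)
     (use assms in \<open>auto simp: fun_scale_def mult.assoc intro!: sums_mult hardy2_sums\<close>)

lemma hardy2_add [intro]:
  assumes "f \<in> hardy2" "g \<in> hardy2"
  shows "f + g \<in> hardy2"
proof -
  have "(f + g) holomorphic_on ball 0 1"
    using assms unfolding plus_fun_def by (intro holomorphic_on_add hardy2_holomorphic)
  moreover have "summable (\<lambda>n. (cmod (taylor_coeff (f + g) n))\<^sup>2)"
    unfolding taylor_coeff_add[OF assms] using assms
    by (intro summable_cmod_add_square hardy2_summable)
  ultimately show ?thesis using assms unfolding hardy2_def by simp
qed

lemma hardy2_scale [intro]: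
  assumes "f \<in> hardy2"
  shows "fun_scale c f \<in> hardy2"
proof -
  have "(fun_scale c f) holomorphic_on ball 0 1"
    using assms unfolding fun_scale_def
    by (intro holomorphic_on_mult holomorphic_on_const hardy2_holomorphic)
  moreover have "summable (\<lambda>n. (cmod (taylor_coeff (fun_scale c f) n))\<^sup>2)"
    unfolding taylor_coeff_scale[OF assms] norm_mult power_mult_distrib
    using assms by (intro summable_mult hardy2_summable)
  ultimately show ?thesis using assms by (auto simp: hardy2_def fun_scale_def)
qed

lemma fun_diff_eq_add_scale: "f - g = f + fun_scale (-1) g"
  by simp

lemma hardy2_diff [intro]: "f \<in> hardy2 \<Longrightarrow> g \<in> hardy2 \<Longrightarrow> f - g \<in> hardy2"
  unfolding fun_diff_eq_add_scale by (intro hardy2_add hardy2_scale)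

lemma hardy2_zero [simp, intro]: "0 \<in> hardy2"
proof -
  have "hardy_series (\<lambda>n. 0) \<in> hardy2" by (rule hardy_series_mem) auto
  moreover have "hardy_series (\<lambda>n. 0) = 0" by (auto simp: hardy_series_def)
  ultimately show ?thesis by simp
qed

lemma hardy2_sum: "(\<And>i. i \<in> I \<Longrightarrow> f i \<in> hardy2) \<Longrightarrow> sum f I \<in> hardy2"
  by (induction I rule: infinite_finite_induct) auto

lemma taylor_coeff_zero [simp]: "taylor_coeff 0 n = 0"
  using taylor_coeff_scale[of 0 0 n] by simp

lemma taylor_coeff_sum:
  "(\<And>i. i \<in> I \<Longrightarrow> f i \<in> hardy2) \<Longrightarrow> taylor_coeff (sum f I) n = (\<Sum>i\<in>I. taylor_coeff (f i) n)"
  by (induction I rule: infinite_finite_induct) (auto simp: taylor_coeff_add hardy2_sum)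

section \<open>Inner product, norm and completeness\<close>

lemma hardy_inner_sums:
  assumes "f \<in> hardy2" "g \<in> hardy2"
  shows "(\<lambda>n. taylor_coeff f n * cnj (taylor_coeff g n)) sums hardy_inner f g"
  unfolding hardy_inner_def
  by (intro summable_sums summable_cmod_mult_cnj hardy2_summable assms)

lemma hardy_inner_add_left:
  assumes "f \<in> hardy2" "g \<in> hardy2" "h \<in> hardy2"
  shows "hardy_inner (f + g) h = hardy_inner f h + hardy_inner g h"
proof (rule sums_unique2)
  show "(\<lambda>n. taylor_coeff (f + g) n * cnj (taylor_coeff h n)) sums hardy_inner (f + g) h"
    using assms by (intro hardy_inner_sums) auto
  show "(\<lambda>n. taylor_coeff (f + g) n * cnj (taylor_coeff h n)) sums (hardy_inner f h + hardy_inner g h)"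
    using assms by (auto simp: taylor_coeff_add ring_distribs intro!: sums_add hardy_inner_sums)
qed

lemma hardy_inner_scale_left:
  assumes "f \<in> hardy2" "h \<in> hardy2"
  shows "hardy_inner (fun_scale c f) h = c * hardy_inner f h"
proof (rule sums_unique2)
  show "(\<lambda>n. taylor_coeff (fun_scale c f) n * cnj (taylor_coeff h n)) sums hardy_inner (fun_scale c f) h"
    using assms by (intro hardy_inner_sums) auto
  show "(\<lambda>n. taylor_coeff (fun_scale c f) n * cnj (taylor_coeff h n)) sums (c * hardy_inner f h)"
    using assms by (auto simp: taylor_coeff_scale mult.assoc intro!: sums_mult hardy_inner_sums)
qed

lemma hardy_inner_commute:
  assumes "f \<in> hardy2" "g \<in> hardy2"
  shows "hardy_inner g f = cnj (hardy_inner f g)"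
proof (rule sums_unique2)
  show "(\<lambda>n. taylor_coeff g n * cnj (taylor_coeff f n)) sums hardy_inner g f"
    using assms by (intro hardy_inner_sums) auto
  show "(\<lambda>n. taylor_coeff g n * cnj (taylor_coeff f n)) sums cnj (hardy_inner f g)"
    using hardy_inner_sums[OF assms] by (subst sums_cnj[symmetric]) (simp add: mult.commute)
qed

lemma hardy_inner_add_right:
  assumes "f \<in> hardy2" "g \<in> hardy2" "h \<in> hardy2"
  shows "hardy_inner h (f + g) = hardy_inner h f + hardy_inner h g"
  using assms hardy_inner_commute[of h] hardy_inner_commute[of _ h]
  by (metis complex_cnj_add hardy2_add hardy_inner_add_left)

lemma hardy_inner_scale_right:
  assumes "f \<in> hardy2" "h \<in> hardy2"
  shows "hardy_inner h (fun_scale c f) = cnj c * hardy_inner h f"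
  using assms by (metis complex_cnj_mult hardy2_scale hardy_inner_commute hardy_inner_scale_left)

lemma hardy_inner_diff_left:
  assumes "f \<in> hardy2" "g \<in> hardy2" "h \<in> hardy2"
  shows "hardy_inner (f - g) h = hardy_inner f h - hardy_inner g h"
  unfolding fun_diff_eq_add_scale
  using hardy_inner_add_left[OF assms(1) hardy2_scale[OF assms(2), of "-1"] assms(3)]
    hardy_inner_scale_left[OF assms(2,3), of "-1"] by simp

lemma hardy_inner_zero [simp]: "hardy_inner 0 f = 0" "hardy_inner f 0 = 0"
  by (simp_all add: hardy_inner_def)

lemma hardy_inner_sum_left:
  "(\<And>i. i \<in> I \<Longrightarrow> f i \<in> hardy2) \<Longrightarrow> h \<in> hardy2 \<Longrightarrow>
    hardy_inner (sum f I) h = (\<Sum>i\<in>I. hardy_inner (f i) h)"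
  by (induction I rule: infinite_finite_induct) (auto simp: hardy_inner_add_left hardy2_sum)

lemma hardy_inner_sum_right:
  "(\<And>i. i \<in> I \<Longrightarrow> f i \<in> hardy2) \<Longrightarrow> h \<in> hardy2 \<Longrightarrow>
    hardy_inner h (sum f I) = (\<Sum>i\<in>I. hardy_inner h (f i))"
  by (induction I rule: infinite_finite_induct) (auto simp: hardy_inner_add_right hardy2_sum)

lemma hardy_norm_nonneg [simp]: "hardy_norm f \<ge> 0"
  if "f \<in> hardy2"
  using hardy2_summable[OF that] by (auto simp: hardy_norm_def intro!: suminf_nonneg)

lemma hardy_norm_sums:
  assumes "f \<in> hardy2"
  shows "(\<lambda>n. (cmod (taylor_coeff f n))\<^sup>2) sums (hardy_norm f)\<^sup>2"
  using hardy2_summable[OF assms] by (simp add: hardy_norm_def suminf_nonneg summable_sums)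

lemma hardy_inner_self:
  assumes "f \<in> hardy2"
  shows "hardy_inner f f = of_real ((hardy_norm f)\<^sup>2)"
proof (rule sums_unique2[OF hardy_inner_sums[OF assms assms]])
  show "(\<lambda>n. taylor_coeff f n * cnj (taylor_coeff f n)) sums of_real ((hardy_norm f)\<^sup>2)"
    using sums_of_real[OF hardy_norm_sums[OF assms], where 'a = complex]
    by (simp only: complex_norm_square[symmetric] of_real_power)
qed

lemma taylor_coeff_le_hardy_norm:
  assumes "f \<in> hardy2"
  shows "cmod (taylor_coeff f n) \<le> hardy_norm f"
proof (rule power2_le_imp_le)
  show "(cmod (taylor_coeff f n))\<^sup>2 \<le> (hardy_norm f)\<^sup>2"
    using sum_le_suminf[OF hardy2_summable[OF assms], of "{n}"] hardy_norm_sums[OF assms]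
    by (simp add: sums_iff)
qed (use assms in simp)

lemma hardy_norm_zero [simp]: "hardy_norm 0 = 0"
  by (simp add: hardy_norm_def)

lemma hardy_norm_eq_0_iff:
  assumes "f \<in> hardy2"
  shows "hardy_norm f = 0 \<longleftrightarrow> f = 0"
proof
  assume "hardy_norm f = 0"
  then have "taylor_coeff f n = taylor_coeff 0 n" for n
    using taylor_coeff_le_hardy_norm[OF assms, of n] by simp
  then show "f = 0" using assms by (intro hardy2_eqI) auto
qed simp

lemma hardy_norm_scale:
  assumes "f \<in> hardy2"
  shows "hardy_norm (fun_scale c f) = cmod c * hardy_norm f"
proof -
  have "(\<lambda>n. (cmod (taylor_coeff (fun_scale c f) n))\<^sup>2) sums ((cmod c)\<^sup>2 * (hardy_norm f)\<^sup>2)"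
    using assms by (simp add: taylor_coeff_scale norm_mult power_mult_distrib hardy_norm_sums sums_mult)
  with hardy_norm_sums[of "fun_scale c f"] assms
  have "(hardy_norm (fun_scale c f))\<^sup>2 = (cmod c * hardy_norm f)\<^sup>2"
    by (metis hardy2_scale power_mult_distrib sums_unique2)
  then show ?thesis using assms by (simp add: hardy2_scale)
qed

lemma hardy_norm_add_square:
  assumes "f \<in> hardy2" "g \<in> hardy2"
  shows "(hardy_norm (f + g))\<^sup>2 = (hardy_norm f)\<^sup>2 + (hardy_norm g)\<^sup>2 + 2 * Re (hardy_inner f g)"
proof -
  have "complex_of_real ((hardy_norm (f + g))\<^sup>2) =
      of_real ((hardy_norm f)\<^sup>2) + of_real ((hardy_norm g)\<^sup>2) + (hardy_inner f g + cnj (hardy_inner f g))"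
    using assms hardy_inner_commute[OF assms]
    by (simp add: hardy_inner_self[symmetric] hardy2_add hardy_inner_add_left hardy_inner_add_right
        del: of_real_power)
  then have "Re (complex_of_real ((hardy_norm (f + g))\<^sup>2)) =
    Re (of_real ((hardy_norm f)\<^sup>2) + of_real ((hardy_norm g)\<^sup>2) + (hardy_inner f g + cnj (hardy_inner f g)))"
    by (rule arg_cong)
  then show ?thesis by (simp del: of_real_power)
qed

lemma hardy_parallelogram:
  assumes "f \<in> hardy2" "g \<in> hardy2"
  shows "(hardy_norm (f + g))\<^sup>2 + (hardy_norm (f - g))\<^sup>2 = 2 * (hardy_norm f)\<^sup>2 + 2 * (hardy_norm g)\<^sup>2"
  using hardy_norm_add_square[OF assms] hardy_norm_add_square[OF assms(1) hardy2_scale[OF assms(2), of "-1"]]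
    hardy_norm_scale[OF assms(2), of "-1"] hardy_inner_scale_right[OF assms(2,1), of "-1"]
  by simp

lemma hardy_Cauchy_Schwarz:
  assumes "f \<in> hardy2" "g \<in> hardy2"
  shows "cmod (hardy_inner f g) \<le> hardy_norm f * hardy_norm g"
proof (cases "g = 0")
  case False
  \<comment> \<open>This choice minimizes the norm of \<open>f + c g\<close>: the sum is
    \<open>f\<close> minus its projection onto \<open>g\<close>.\<close>
  define c where "c = - hardy_inner f g / of_real ((hardy_norm g)\<^sup>2)"
  have g: "hardy_norm g > 0" using False assms hardy_norm_eq_0_iff[of g] hardy_norm_nonneg[of g] by linarith
  have "0 \<le> (hardy_norm (f + fun_scale c g))\<^sup>2" by simp
  also have "\<dots> = (hardy_norm f)\<^sup>2 + (cmod c * hardy_norm g)\<^sup>2 + 2 * Re (cnj c * hardy_inner f g)"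
    using assms by (simp add: hardy_norm_add_square hardy2_scale hardy_norm_scale hardy_inner_scale_right)
  also have "cnj c * hardy_inner f g = - of_real ((cmod (hardy_inner f g))\<^sup>2 / (hardy_norm g)\<^sup>2)"
    by (simp add: c_def complex_norm_square mult.commute flip: of_real_power)
  also have "cmod c * hardy_norm g = cmod (hardy_inner f g) / hardy_norm g"
    using g by (simp add: c_def norm_divide power2_eq_square norm_mult)
  finally have "(cmod (hardy_inner f g))\<^sup>2 / (hardy_norm g)\<^sup>2 \<le> (hardy_norm f)\<^sup>2"
    by (simp add: power_divide)
  then have "(cmod (hardy_inner f g))\<^sup>2 \<le> (hardy_norm f * hardy_norm g)\<^sup>2"
    using g by (simp add: field_simps power_mult_distrib)
  then show ?thesis
    by (rule power2_le_imp_le) (intro mult_nonneg_nonneg hardy_norm_nonneg assms)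
qed simp

lemma hardy_norm_triangle:
  assumes "f \<in> hardy2" "g \<in> hardy2"
  shows "hardy_norm (f + g) \<le> hardy_norm f + hardy_norm g"
proof (rule power2_le_imp_le)
  have "Re (hardy_inner f g) \<le> hardy_norm f * hardy_norm g"
    using hardy_Cauchy_Schwarz[OF assms] complex_Re_le_cmod order_trans by blast
  then show "(hardy_norm (f + g))\<^sup>2 \<le> (hardy_norm f + hardy_norm g)\<^sup>2"
    using hardy_norm_add_square[OF assms] by (simp add: power2_sum)
qed (use assms in auto)

lemma hardy_norm_minus_commute:
  assumes "f \<in> hardy2" "g \<in> hardy2"
  shows "hardy_norm (f - g) = hardy_norm (g - f)"
  using hardy_norm_scale[of "f - g" "-1"] assms by (simp add: hardy2_diff)

lemma hardy_norm_triangle_diff: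
  assumes "f \<in> hardy2" "g \<in> hardy2"
  shows "\<bar>hardy_norm f - hardy_norm g\<bar> \<le> hardy_norm (f - g)"
  using hardy_norm_triangle[of "f - g" g] hardy_norm_triangle[of "g - f" f] assms
    hardy_norm_minus_commute[OF assms] by (simp add: hardy2_diff)

lemma hardy_norm_triangle3:
  assumes "f \<in> hardy2" "g \<in> hardy2" "h \<in> hardy2"
  shows "hardy_norm (f - h) \<le> hardy_norm (f - g) + hardy_norm (g - h)"
  using hardy_norm_triangle[of "f - g" "g - h"] assms by (simp add: hardy2_diff)

text \<open>Coefficientwise limits give the candidate. The Cauchy bound is carried over to the limit
  in finite sums of coefficients and only then in the series, so no limit is exchanged with an
  infinite sum.\<close>

lemma hardy2_complete:
  assumes u: "\<And>n. u n \<in> hardy2"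
    and Cauchy: "\<And>\<epsilon>. \<epsilon> > 0 \<Longrightarrow> \<exists>N. \<forall>m\<ge>N. \<forall>n\<ge>N. hardy_norm (u m - u n) < \<epsilon>"
  obtains f where "f \<in> hardy2" "(\<lambda>n. hardy_norm (u n - f)) \<longlonglongrightarrow> 0"
proof -
  have "Cauchy (\<lambda>n. taylor_coeff (u n) j)" for j
  proof (rule metric_CauchyI)
    fix e :: real assume "e > 0"
    then obtain N where "\<forall>m\<ge>N. \<forall>n\<ge>N. hardy_norm (u m - u n) < e" using Cauchy by blast
    moreover have "dist (taylor_coeff (u m) j) (taylor_coeff (u n) j) \<le> hardy_norm (u m - u n)" for m n
      using taylor_coeff_le_hardy_norm[OF hardy2_diff[OF u u], of m n j] u
      by (simp add: dist_norm taylor_coeff_diff)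
    ultimately show "\<exists>M. \<forall>m\<ge>M. \<forall>n\<ge>M. dist (taylor_coeff (u m) j) (taylor_coeff (u n) j) < e"
      by (meson order_le_less_trans)
  qed
  then have "\<exists>l. (\<lambda>n. taylor_coeff (u n) j) \<longlonglongrightarrow> l" for j
    using Cauchy_convergent convergent_def by blast
  then obtain a where a: "\<And>j. (\<lambda>n. taylor_coeff (u n) j) \<longlonglongrightarrow> a j" by metis
  have fin: "(\<Sum>j<J. (cmod (taylor_coeff (u n) j - a j))\<^sup>2) \<le> \<epsilon>\<^sup>2"
    if N: "\<forall>m\<ge>N. \<forall>n\<ge>N. hardy_norm (u m - u n) < \<epsilon>" and "n \<ge> N" for N J n \<epsilon>
  proof (rule tendsto_upperbound)
    show "(\<lambda>m. \<Sum>j<J. (cmod (taylor_coeff (u n) j - taylor_coeff (u m) j))\<^sup>2)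
        \<longlonglongrightarrow> (\<Sum>j<J. (cmod (taylor_coeff (u n) j - a j))\<^sup>2)"
      by (intro tendsto_intros a)
    show "\<forall>\<^sub>F m in sequentially. (\<Sum>j<J. (cmod (taylor_coeff (u n) j - taylor_coeff (u m) j))\<^sup>2) \<le> \<epsilon>\<^sup>2"
    proof (rule eventually_sequentiallyI[of N])
      fix m assume "m \<ge> N"
      have "(\<Sum>j<J. (cmod (taylor_coeff (u n) j - taylor_coeff (u m) j))\<^sup>2)
          = (\<Sum>j<J. (cmod (taylor_coeff (u n - u m) j))\<^sup>2)"
        using u by (simp add: taylor_coeff_diff)
      also have "\<dots> \<le> (hardy_norm (u n - u m))\<^sup>2"
        using hardy_norm_sums[OF hardy2_diff[OF u u], of n m]
          sum_le_suminf[of "\<lambda>j. (cmod (taylor_coeff (u n - u m) j))\<^sup>2" "{..<J}"]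
        by (simp add: sums_iff)
      also have "\<dots> \<le> \<epsilon>\<^sup>2"
        using N \<open>m \<ge> N\<close> \<open>n \<ge> N\<close> by (intro power_mono less_imp_le hardy_norm_nonneg hardy2_diff u) auto
      finally show "(\<Sum>j<J. (cmod (taylor_coeff (u n) j - taylor_coeff (u m) j))\<^sup>2) \<le> \<epsilon>\<^sup>2" .
    qed
  qed simp
  have summ: "summable (\<lambda>j. (cmod (taylor_coeff (u n) j - a j))\<^sup>2)"
    and le: "(\<Sum>j. (cmod (taylor_coeff (u n) j - a j))\<^sup>2) \<le> \<epsilon>\<^sup>2"
    if N: "\<forall>m\<ge>N. \<forall>n\<ge>N. hardy_norm (u m - u n) < \<epsilon>" and "n \<ge> N" for N n \<epsilon>
  proof -
    show "summable (\<lambda>j. (cmod (taylor_coeff (u n) j - a j))\<^sup>2)"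
      using fin[OF that] by (intro summableI_nonneg_bounded[where x = "\<epsilon>\<^sup>2"]) auto
    then show "(\<Sum>j. (cmod (taylor_coeff (u n) j - a j))\<^sup>2) \<le> \<epsilon>\<^sup>2"
      using fin[OF that] by (intro suminf_le_const)
  qed
  \<comment> \<open>One fixed tolerance suffices to see that the limit is square-summable: it
    differs from \<open>u N1\<close> by a square-summable sequence.\<close>
  obtain N1 where N1: "\<forall>m\<ge>N1. \<forall>n\<ge>N1. hardy_norm (u m - u n) < 1" using Cauchy[of 1] by auto
  have d: "summable (\<lambda>j. (cmod (a j - taylor_coeff (u N1) j))\<^sup>2)"
    using summ[OF N1 order_refl] by (simp add: norm_minus_commute)
  from summable_cmod_add_square[OF d hardy2_summable[OF u[of N1]]]
  have "summable (\<lambda>j. (cmod (a j))\<^sup>2)" by simp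
  note S = hardy_series_mem[OF this] taylor_coeff_hardy_series[OF this]
  have "(\<lambda>n. hardy_norm (u n - hardy_series a)) \<longlonglongrightarrow> 0"
  proof (rule LIMSEQ_I)
    fix r :: real assume "r > 0"
    then obtain N where N: "\<forall>m\<ge>N. \<forall>n\<ge>N. hardy_norm (u m - u n) < r / 2" using Cauchy[of "r/2"] by auto
    have "norm (hardy_norm (u n - hardy_series a) - 0) < r" if "n \<ge> N" for n
    proof -
      have "(hardy_norm (u n - hardy_series a))\<^sup>2 \<le> (r / 2)\<^sup>2"
        using le[OF N that] hardy_norm_sums[OF hardy2_diff[OF u[of n] S(1)]] S u
        by (simp add: sums_iff taylor_coeff_diff)
      then have "hardy_norm (u n - hardy_series a) \<le> r / 2"
        by (rule power2_le_imp_le) (use \<open>r > 0\<close> in simp)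
      then show ?thesis using hardy_norm_nonneg[OF hardy2_diff[OF u[of n] S(1)]] \<open>r > 0\<close> by simp
    qed
    then show "\<exists>no. \<forall>n\<ge>no. norm (hardy_norm (u n - hardy_series a) - 0) < r"
      by blast
  qed
  with S(1) show ?thesis by (rule that)
qed

section \<open>Singular numbers of compact injective operators\<close>

lemma hardy_norm_pos: "f \<in> hardy2 \<Longrightarrow> f \<noteq> 0 \<Longrightarrow> hardy_norm f > 0"
  using hardy_norm_eq_0_iff[of f] hardy_norm_nonneg[of f] by linarith

text \<open>Gaussian elimination for \<open>n\<close> equations in \<open>n + 1\<close> unknowns: an
  equation in which the last unknown occurs eliminates it from the others; if there is none, the
  last unit vector is a solution.\<close>

lemma homogeneous_system_solution:
  fixes M :: "nat \<Rightarrow> nat \<Rightarrow> 'a::field"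
  shows "\<exists>c. (\<exists>j\<le>n. c j \<noteq> 0) \<and> (\<forall>i<n. (\<Sum>j\<le>n. M i j * c j) = 0)"
proof (induction n arbitrary: M)
  case 0
  show ?case by (intro exI[of _ "\<lambda>_. 1"]) auto
next
  case (Suc n)
  show ?case
  proof (cases "\<forall>i\<le>n. M i (Suc n) = 0")
    case True
    then show ?thesis by (intro exI[of _ "\<lambda>j. if j = Suc n then 1 else 0"]) auto
  next
    case False
    then obtain k where k: "k \<le> n" "M k (Suc n) \<noteq> 0" by auto
    \<comment> \<open>\<open>\<rho>\<close> enumerates the equations other than number
      \<open>k\<close>.\<close>
    define \<rho> where "\<rho> i = (if i < k then i else Suc i)" for i
    from Suc[of "\<lambda>i j. M (\<rho> i) j - M (\<rho> i) (Suc n) * M k j / M k (Suc n)"]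
    obtain c where c: "\<exists>j\<le>n. c j \<noteq> 0"
      "\<And>i. i < n \<Longrightarrow> (\<Sum>j\<le>n. (M (\<rho> i) j - M (\<rho> i) (Suc n) * M k j / M k (Suc n)) * c j) = 0"
      by blast
    define a where "a = - (\<Sum>j\<le>n. M k j * c j) / M k (Suc n)"
    define d where "d = c(Suc n := a)"
    have d: "(\<Sum>j\<le>Suc n. M i j * d j) = (\<Sum>j\<le>n. M i j * c j) + M i (Suc n) * a" for i
    proof -
      have "(\<Sum>j\<le>n. M i j * d j) = (\<Sum>j\<le>n. M i j * c j)"
        by (intro sum.cong) (auto simp: d_def)
      then show ?thesis by (simp add: d_def)
    qed
    have "(\<Sum>j\<le>Suc n. M i j * d j) = 0" if "i < Suc n" for i
    proof (cases "i = k")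
      case True
      then show ?thesis using k unfolding d by (simp add: a_def)
    next
      case False
      then obtain i' where i': "i' < n" "i = \<rho> i'"
      proof (cases "i < k")
        case True
        then show ?thesis using k that[of i] by (simp add: \<rho>_def)
      next
        case f: False
        then show ?thesis using k \<open>i < Suc n\<close> False by (intro that[of "i - 1"]) (auto simp: \<rho>_def)
      qed
      have "(\<Sum>j\<le>n. (M i j - M i (Suc n) * M k j / M k (Suc n)) * c j)
          = (\<Sum>j\<le>n. M i j * c j - (M i (Suc n) / M k (Suc n)) * (M k j * c j))"
        by (intro sum.cong) (auto simp: algebra_simps)
      also have "\<dots> = (\<Sum>j\<le>n. M i j * c j) + M i (Suc n) * a"
        by (simp only: sum_subtractf sum_distrib_left[symmetric]) (simp add: a_def)
      finally have "(\<Sum>j\<le>n. (M i j - M i (Suc n) * M k j / M k (Suc n)) * c j)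
          = (\<Sum>j\<le>n. M i j * c j) + M i (Suc n) * a" .
      then show ?thesis using c(2)[OF i'(1)] unfolding d i'(2) by simp
    qed
    moreover have "\<exists>j\<le>Suc n. d j \<noteq> 0"
    proof -
      obtain j where "j \<le> n" "c j \<noteq> 0" using c(1) by blast
      then show ?thesis by (intro exI[of _ j]) (auto simp: d_def)
    qed
    ultimately show ?thesis by blast
  qed
qed

lemma hardy_inner_finite:
  assumes "\<And>k. k > n \<Longrightarrow> taylor_coeff f k = 0"
  shows "hardy_inner f g = (\<Sum>k\<le>n. taylor_coeff f k * cnj (taylor_coeff g k))"
  unfolding hardy_inner_def by (rule suminf_finite) (use assms in \<open>auto simp: not_le\<close>)

text \<open>Polynomials of degree at most \<open>n\<close> form a space of dimension
  \<open>n + 1\<close>, so \<open>n\<close> linear conditions leave a nonzero one. It supplies test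
  functions both for the maximization and for the lower bound on singular numbers.\<close>

lemma exists_polynomial_orthogonal:
  "\<exists>f\<in>hardy2. f \<noteq> 0 \<and> (\<forall>k>n. taylor_coeff f k = 0) \<and> (\<forall>i<n. hardy_inner f (e i) = 0)"
proof -
  obtain c where c: "\<exists>j\<le>n. c j \<noteq> 0"
    "\<And>i. i < n \<Longrightarrow> (\<Sum>j\<le>n. cnj (taylor_coeff (e i) j) * c j) = 0"
    using homogeneous_system_solution[of n "\<lambda>i j. cnj (taylor_coeff (e i) j)"] by blast
  define a where "a j = (if j \<le> n then c j else 0)" for j
  have "summable (\<lambda>j. (cmod (a j))\<^sup>2)"
    by (rule summable_finite[of "{..n}"]) (auto simp: a_def)
  note S = hardy_series_mem[OF this] taylor_coeff_hardy_series[OF this]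
  have "hardy_series a \<noteq> 0" using c(1) S(2) by (metis a_def taylor_coeff_zero)
  moreover have "hardy_inner (hardy_series a) (e i) = 0" if "i < n" for i
  proof -
    have "hardy_inner (hardy_series a) (e i) = (\<Sum>j\<le>n. a j * cnj (taylor_coeff (e i) j))"
      by (subst hardy_inner_finite[of n]) (auto simp: S(2), simp add: a_def)
    also have "\<dots> = (\<Sum>j\<le>n. cnj (taylor_coeff (e i) j) * c j)"
      by (intro sum.cong) (auto simp: a_def)
    finally show ?thesis using c(2)[OF that] by simp
  qed
  moreover have "\<forall>k>n. taylor_coeff (hardy_series a) k = 0" by (simp add: S(2)) (simp add: a_def)
  ultimately show ?thesis using S(1) by blast
qed

lemma hardy_inner_orthonormal_sum:
  assumes "\<And>i. i \<in> I \<Longrightarrow> e i \<in> hardy2"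
    and "\<And>i j. i \<in> I \<Longrightarrow> j \<in> I \<Longrightarrow> hardy_inner (e i) (e j) = (if i = j then 1 else 0)" and "j \<in> I" "finite I"
  shows "hardy_inner (\<Sum>i\<in>I. fun_scale (c i) (e i)) (e j) = c j"
proof -
  have "hardy_inner (\<Sum>i\<in>I. fun_scale (c i) (e i)) (e j) = (\<Sum>i\<in>I. c i * (if i = j then 1 else 0))"
    using assms by (subst hardy_inner_sum_left)
      (auto simp: hardy2_scale hardy_inner_scale_left intro!: sum.cong)
  then show ?thesis using assms by (simp add: if_distrib cong: if_cong)
qed

text \<open>A nonnegative expression without constant term has a minimum at \<open>c = 0\<close>, so
  its linear part vanishes: a short step against \<open>\<beta>\<close> would otherwise make it
  negative.\<close>

lemma first_variation_zero:
  fixes \<alpha> :: real and \<beta> :: complex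
  assumes "\<And>c. 0 \<le> (cmod c)\<^sup>2 * \<alpha> + 2 * Re (cnj c * \<beta>)" "\<alpha> \<ge> 0"
  shows "\<beta> = 0"
proof (rule ccontr)
  assume "\<beta> \<noteq> 0"
  \<comment> \<open>Small enough for the quadratic term to be at most half of the linear
    one.\<close>
  define t where "t = 1 / (1 + \<alpha>)"
  have t: "t > 0" "t * \<alpha> \<le> 1" using assms(2) by (auto simp: t_def)
  have "Re (cnj (- of_real t * \<beta>) * \<beta>) = - (t * (cmod \<beta>)\<^sup>2)"
    by (simp add: cmod_power2[unfolded power2_eq_square] power2_eq_square algebra_simps)
  with assms(1)[of "- of_real t * \<beta>"]
  have "0 \<le> t * (cmod \<beta>)\<^sup>2 * (t * \<alpha> - 2)"
    using t by (simp add: norm_mult power2_eq_square algebra_simps)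
  moreover have "t * (cmod \<beta>)\<^sup>2 > 0" using t \<open>\<beta> \<noteq> 0\<close> by simp
  ultimately show False using t by (simp add: zero_le_mult_iff)
qed

text \<open>Injectivity keeps every maximum of the image norm positive, so that the successive
  maximization never stops; it also shows that nothing is left over outside the span of the
  maximizers.\<close>

locale compact_injective =
  fixes T :: "(complex \<Rightarrow> complex) \<Rightarrow> complex \<Rightarrow> complex"
  assumes compact: "hardy_compact T"
    and inj: "\<And>f. f \<in> hardy2 \<Longrightarrow> T f = 0 \<Longrightarrow> f = 0"
begin

section \<open>Existence of successive maximizers\<close>

lemma T_mem [simp]: "f \<in> hardy2 \<Longrightarrow> T f \<in> hardy2"
  and T_add: "f \<in> hardy2 \<Longrightarrow> g \<in> hardy2 \<Longrightarrow> T (f + g) = T f + T g"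
  and T_scale: "f \<in> hardy2 \<Longrightarrow> T (fun_scale c f) = fun_scale c (T f)"
  using compact by (auto simp: hardy_compact_def hardy_linear_def)

lemma T_diff: "f \<in> hardy2 \<Longrightarrow> g \<in> hardy2 \<Longrightarrow> T (f - g) = T f - T g"
  using T_add[of f "fun_scale (-1) g"] T_scale[of g "-1"] hardy2_scale[of g "-1"] by simp

lemma T_zero [simp]: "T 0 = 0"
  using T_scale[of 0 0] by simp

lemma T_sum: "(\<And>i. i \<in> I \<Longrightarrow> f i \<in> hardy2) \<Longrightarrow> T (sum f I) = (\<Sum>i\<in>I. T (f i))"
  by (induction I rule: infinite_finite_induct) (auto simp: T_add hardy2_sum)

lemma compactE:
  assumes "\<And>n. u n \<in> hardy2" "\<And>n. hardy_norm (u n) \<le> 1"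
  obtains g r where "g \<in> hardy2" "strict_mono (r :: nat \<Rightarrow> nat)"
    "(\<lambda>n. hardy_norm (T (u (r n)) - g)) \<longlonglongrightarrow> 0"
  using compact assms unfolding hardy_compact_def by blast

lemma normalize:
  assumes "f \<in> hardy2" "f \<noteq> 0"
  shows "hardy_norm (fun_scale (1 / of_real (hardy_norm f)) f) = 1"
  using assms hardy_norm_eq_0_iff[of f] hardy_norm_nonneg[of f] by (simp add: hardy_norm_scale norm_divide)

text \<open>Unit vectors whose images have norms above \<open>n\<close> admit no convergent
  subsequence of images.\<close>

lemma bounded: "\<exists>K\<ge>0. \<forall>f\<in>hardy2. hardy_norm (T f) \<le> K * hardy_norm f"
proof (rule ccontr)
  assume "\<not> ?thesis"
  then have "\<forall>n. \<exists>f\<in>hardy2. real n * hardy_norm f < hardy_norm (T f)"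
    by (meson not_le of_nat_0_le_iff)
  then obtain f where f: "\<And>n. f n \<in> hardy2" "\<And>n. real n * hardy_norm (f n) < hardy_norm (T (f n))"
    by metis
  have nz: "f n \<noteq> 0" for n using f(2)[of n] by auto
  have pos: "hardy_norm (f n) > 0" for n
    using nz[of n] f(1)[of n] hardy_norm_eq_0_iff[of "f n"] hardy_norm_nonneg[of "f n"] by linarith
  define u where "u n = fun_scale (1 / of_real (hardy_norm (f n))) (f n)" for n
  have u: "u n \<in> hardy2" "hardy_norm (u n) = 1" for n
    using f nz by (simp_all add: u_def hardy2_scale normalize)
  have big: "hardy_norm (T (u n)) > real n" for n
    using f(1)[of n] f(2)[of n] pos[of n] by (simp add: u_def T_scale hardy_norm_scale norm_divide field_simps)
  obtain g r where g: "g \<in> hardy2" "strict_mono (r :: nat \<Rightarrow> nat)"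
    "(\<lambda>n. hardy_norm (T (u (r n)) - g)) \<longlonglongrightarrow> 0"
    using compactE[of u] u by auto
  have "\<forall>\<^sub>F n in sequentially. hardy_norm (T (u (r n)) - g) < 1"
    using order_tendstoD(2)[OF g(3), of 1] by simp
  moreover have "\<forall>\<^sub>F n in sequentially. hardy_norm g + 1 < real n"
    using filterlim_real_sequentially by (simp add: filterlim_at_top_dense)
  ultimately have "\<forall>\<^sub>F n in sequentially. False"
  proof eventually_elim
    case (elim n)
    have "real n \<le> real (r n)" using g(2) seq_suble by auto
    also have "\<dots> < hardy_norm (T (u (r n)))" by (rule big)
    also have "\<dots> \<le> hardy_norm (T (u (r n)) - g) + hardy_norm g"
      using hardy_norm_triangle_diff[of "T (u (r n))" g] g u by simp
    finally show ?case using elim by simp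
  qed
  then show False by simp
qed

text \<open>A maximizing sequence of unit vectors is Cauchy, without weak compactness: along a subsequence
  its image converges in norm, so sums of its members have almost maximal image and hence almost
  norm \<open>2\<close>, and the parallelogram law makes their differences small.\<close>

lemma maximizer:
  fixes n :: nat
  assumes e: "\<And>i. i < n \<Longrightarrow> e i \<in> hardy2"
  shows "\<exists>v\<in>hardy2. hardy_norm v = 1 \<and> (\<forall>i<n. hardy_inner v (e i) = 0) \<and>
    (\<forall>g\<in>hardy2. (\<forall>i<n. hardy_inner g (e i) = 0) \<longrightarrow> hardy_norm (T g) \<le> hardy_norm (T v) * hardy_norm g)"
proof -
  define V where "V = {g \<in> hardy2. \<forall>i<n. hardy_inner g (e i) = 0}"
  have V: "g \<in> hardy2" "i < n \<Longrightarrow> hardy_inner g (e i) = 0" if "g \<in> V" for g i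
    using that by (auto simp: V_def)
  have V_add: "f + g \<in> V" if "f \<in> V" "g \<in> V" for f g
    using that e by (auto simp: V_def hardy_inner_add_left)
  have V_scale: "fun_scale c f \<in> V" if "f \<in> V" for f c
    using that e by (auto simp: V_def hardy_inner_scale_left)
  obtain K where K: "K \<ge> 0" "\<And>f. f \<in> hardy2 \<Longrightarrow> hardy_norm (T f) \<le> K * hardy_norm f"
    using bounded by blast
  \<comment> \<open>\<open>g0\<close> shows that the orthogonal complement is nonzero, so the
    supremum below is over a nonempty set.\<close>
  obtain g0 where g0: "g0 \<in> V" "g0 \<noteq> 0"
    using exists_polynomial_orthogonal[of n e] by (auto simp: V_def)
  define A where "A = (\<lambda>g. hardy_norm (T g)) ` {g \<in> V. hardy_norm g = 1}"
  define \<sigma> where "\<sigma> = Sup A"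
  define v0 where "v0 = fun_scale (1 / of_real (hardy_norm g0)) g0"
  have v0: "v0 \<in> V" "hardy_norm v0 = 1"
    using g0 V by (auto simp: v0_def V_scale normalize)
  have bdd: "bdd_above A"
  proof (rule bdd_aboveI[of _ K])
    fix x assume "x \<in> A"
    then obtain g where "g \<in> V" "hardy_norm g = 1" "x = hardy_norm (T g)" by (auto simp: A_def)
    then show "x \<le> K" using K(2)[of g] V(1) by simp
  qed
  have "v0 \<noteq> 0" using v0 by auto
  then have "T v0 \<noteq> 0" using inj V v0 by blast
  then have "0 < hardy_norm (T v0)"
    using V[OF v0(1)] by (intro hardy_norm_pos) auto
  also have "hardy_norm (T v0) \<le> \<sigma>" unfolding \<sigma>_def
    by (rule cSup_upper[OF _ bdd]) (use v0 in \<open>auto simp: A_def\<close>)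
  finally have \<sigma>: "\<sigma> > 0" .
  have \<sigma>_max: "hardy_norm (T g) \<le> \<sigma> * hardy_norm g" if g: "g \<in> V" for g
  proof (cases "g = 0")
    case False
    define h where "h = fun_scale (1 / of_real (hardy_norm g)) g"
    have "h \<in> V" "hardy_norm h = 1" using g V False by (auto simp: h_def V_scale normalize)
    then have "hardy_norm (T h) \<le> \<sigma>" unfolding \<sigma>_def
      by (intro cSup_upper[OF _ bdd]) (auto simp: A_def)
    then show ?thesis using g V hardy_norm_pos[OF V(1)[OF g] False]
      by (simp add: h_def T_scale hardy_norm_scale norm_divide field_simps)
  qed simp
  have "\<exists>u\<in>V. hardy_norm u = 1 \<and> \<sigma> - 1 / real (Suc k) < hardy_norm (T u)" for k
  proof -
    have "\<exists>x\<in>A. \<sigma> - 1 / real (Suc k) < x" unfolding \<sigma>_def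
      by (rule less_cSupD) (use v0 in \<open>auto simp: A_def\<close>)
    then show ?thesis by (auto simp: A_def)
  qed
  then obtain u where u: "\<And>k. u k \<in> V" "\<And>k. hardy_norm (u k) = 1"
    "\<And>k. \<sigma> - 1 / real (Suc k) < hardy_norm (T (u k))" by metis
  obtain g r where g: "g \<in> hardy2" "strict_mono (r :: nat \<Rightarrow> nat)"
    "(\<lambda>k. hardy_norm (T (u (r k)) - g)) \<longlonglongrightarrow> 0"
    using compactE[of u] u V by (metis order_refl)
  define w where "w k = u (r k)" for k
  have w: "w k \<in> V" "hardy_norm (w k) = 1" "w k \<in> hardy2" for k using u V by (auto simp: w_def)
  have Tw: "(\<lambda>k. hardy_norm (T (w k))) \<longlonglongrightarrow> \<sigma>"
  proof (rule tendsto_sandwich)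
    show "(\<lambda>k. \<sigma> - 1 / real (Suc k)) \<longlonglongrightarrow> \<sigma>" by real_asymp
    show "\<forall>\<^sub>F k in sequentially. \<sigma> - 1 / real (Suc k) \<le> hardy_norm (T (w k))"
    proof (rule always_eventually, rule allI)
      fix k
      have "k \<le> r k" using g(2) seq_suble by auto
      then have "1 / real (Suc (r k)) \<le> 1 / real (Suc k)" by (simp add: frac_le)
      then show "\<sigma> - 1 / real (Suc k) \<le> hardy_norm (T (w k))"
        using u(3)[of "r k"] by (simp add: w_def)
    qed
    show "\<forall>\<^sub>F k in sequentially. hardy_norm (T (w k)) \<le> \<sigma>"
      using \<sigma>_max[OF w(1)] w(2) by simp
  qed simp
  have "(\<lambda>k. hardy_norm (T (w k)) - hardy_norm g) \<longlonglongrightarrow> 0"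
    by (rule Lim_null_comparison[OF _ g(3)])
       (use hardy_norm_triangle_diff[OF T_mem[OF w(3)] g(1)] in \<open>auto simp: w_def\<close>)
  then have "(\<lambda>k. hardy_norm (T (w k))) \<longlonglongrightarrow> hardy_norm g" by (rule LIM_zero_cancel)
  with Tw have g\<sigma>: "hardy_norm g = \<sigma>" using LIMSEQ_unique by blast
  define \<delta> where "\<delta> k = hardy_norm (T (w k) - g) / \<sigma>" for k
  have \<delta>: "\<delta> \<longlonglongrightarrow> 0" using tendsto_divide[OF g(3) tendsto_const[of \<sigma>]] \<sigma> by (simp add: \<delta>_def[abs_def] w_def)
  have sum_ge: "2 - \<delta> k - \<delta> l \<le> hardy_norm (w k + w l)" for k l
  proof -
    have "fun_scale 2 g = (T (w k) + T (w l)) + ((g - T (w k)) + (g - T (w l)))"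
      by (auto simp: fun_scale_def)
    then have "2 * \<sigma> = hardy_norm ((T (w k) + T (w l)) + ((g - T (w k)) + (g - T (w l))))"
      using hardy_norm_scale[OF g(1), of 2] g\<sigma> by simp
    also have "\<dots> \<le> hardy_norm (T (w k) + T (w l)) + (hardy_norm (g - T (w k)) + hardy_norm (g - T (w l)))"
      using w g by (intro order_trans[OF hardy_norm_triangle] add_mono hardy_norm_triangle hardy2_add hardy2_diff T_mem order_refl)
    also have "hardy_norm (T (w k) + T (w l)) \<le> \<sigma> * hardy_norm (w k + w l)"
      using \<sigma>_max[OF V_add[OF w(1) w(1)], of k l] w by (simp add: T_add)
    finally have "2 * \<sigma> \<le> \<sigma> * hardy_norm (w k + w l) + (\<sigma> * \<delta> k + \<sigma> * \<delta> l)"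
      using \<sigma> unfolding hardy_norm_minus_commute[OF g(1) T_mem[OF w(3)]] by (simp add: \<delta>_def)
    then have "\<sigma> * 2 \<le> \<sigma> * (hardy_norm (w k + w l) + \<delta> k + \<delta> l)"
      by (simp add: algebra_simps)
    then show ?thesis using \<sigma> by (simp only: mult_le_cancel_left_pos)
  qed
  have diff_le: "(hardy_norm (w k - w l))\<^sup>2 \<le> 4 * (\<delta> k + \<delta> l)" if "\<delta> k + \<delta> l \<le> 2" for k l
  proof -
    have "(2 - \<delta> k - \<delta> l)\<^sup>2 \<le> (hardy_norm (w k + w l))\<^sup>2"
      using sum_ge that by (intro power_mono) auto
    moreover have "(2 - \<delta> k - \<delta> l)\<^sup>2 = 4 - 4 * (\<delta> k + \<delta> l) + (\<delta> k + \<delta> l)\<^sup>2"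
      by (simp add: power2_eq_square algebra_simps)
    moreover have "(\<delta> k + \<delta> l)\<^sup>2 \<ge> 0" by simp
    moreover have "(hardy_norm (w k + w l))\<^sup>2 + (hardy_norm (w k - w l))\<^sup>2 = 4"
      using hardy_parallelogram[OF w(3) w(3), of k l] w(2) by simp
    ultimately show ?thesis by linarith
  qed
  obtain v where v: "v \<in> hardy2" "(\<lambda>k. hardy_norm (w k - v)) \<longlonglongrightarrow> 0"
  proof (rule hardy2_complete[of w])
    fix \<epsilon> :: real assume \<epsilon>: "\<epsilon> > 0"
    \<comment> \<open>The parallelogram estimate turns \<open>\<delta> < \<eta>\<close> into a
      squared distance below \<open>8 \<eta> \<le> \<epsilon>\<^sup>2 / 2\<close>; the minimum with
      1 makes that estimate applicable.\<close>
    define \<eta> where "\<eta> = min 1 (\<epsilon>\<^sup>2 / 16)"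
    have \<eta>: "\<eta> > 0" "\<eta> \<le> 1" "16 * \<eta> \<le> \<epsilon>\<^sup>2" using \<epsilon> by (auto simp: \<eta>_def)
    obtain N where N: "\<And>k. k \<ge> N \<Longrightarrow> \<delta> k < \<eta>"
      using order_tendstoD(2)[OF \<delta> \<eta>(1)] by (auto simp: eventually_sequentially)
    have "hardy_norm (w k - w l) < \<epsilon>" if "k \<ge> N" "l \<ge> N" for k l
    proof (rule power2_less_imp_less)
      have "\<delta> k + \<delta> l < 2 * \<eta>" using N[OF that(1)] N[OF that(2)] by linarith
      then have "4 * (\<delta> k + \<delta> l) < \<epsilon>\<^sup>2" "\<delta> k + \<delta> l \<le> 2" using \<eta> by argo+
      with diff_le[of k l] show "(hardy_norm (w k - w l))\<^sup>2 < \<epsilon>\<^sup>2" by (meson order_le_less_trans)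
    qed (use \<epsilon> in simp)
    then show "\<exists>N. \<forall>k\<ge>N. \<forall>l\<ge>N. hardy_norm (w k - w l) < \<epsilon>" by blast
  qed (use w in auto)
  have "(\<lambda>k. hardy_norm (w k) - hardy_norm v) \<longlonglongrightarrow> 0"
    by (rule Lim_null_comparison[OF _ v(2)])
       (use hardy_norm_triangle_diff[OF w(3) v(1)] in auto)
  then have v1: "hardy_norm v = 1" using w(2) by (simp add: LIMSEQ_const_iff)
  have vV: "hardy_inner v (e i) = 0" if "i < n" for i
  proof -
    have "(\<lambda>k. hardy_inner v (e i)) \<longlonglongrightarrow> 0"
    proof (rule Lim_null_comparison)
      show "(\<lambda>k. hardy_norm (w k - v) * hardy_norm (e i)) \<longlonglongrightarrow> 0"
        using tendsto_mult_left_zero[OF v(2)] by simp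
      have "hardy_inner (w k - v) (e i) = - hardy_inner v (e i)" for k
        using hardy_inner_diff_left[OF w(3) v(1) e[OF that], of k] V(2)[OF w(1) that] by simp
      then show "\<forall>\<^sub>F k in sequentially. norm (hardy_inner v (e i)) \<le> hardy_norm (w k - v) * hardy_norm (e i)"
        using hardy_Cauchy_Schwarz[OF hardy2_diff[OF w(3) v(1)] e[OF that]] by simp
    qed
    then show ?thesis by (simp add: LIMSEQ_const_iff)
  qed
  have "(\<lambda>k. hardy_norm (T (w k)) - hardy_norm (T v)) \<longlonglongrightarrow> 0"
  proof (rule Lim_null_comparison)
    show "(\<lambda>k. K * hardy_norm (w k - v)) \<longlonglongrightarrow> 0"
      using tendsto_mult_right_zero[OF v(2)] by simp
    have "\<bar>hardy_norm (T (w k)) - hardy_norm (T v)\<bar> \<le> K * hardy_norm (w k - v)" for k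
      using hardy_norm_triangle_diff[OF T_mem[OF w(3)] T_mem[OF v(1)], of k]
        K(2)[OF hardy2_diff[OF w(3) v(1)], of k] T_diff[OF w(3) v(1), of k] by simp
    then show "\<forall>\<^sub>F k in sequentially. norm (hardy_norm (T (w k)) - hardy_norm (T v)) \<le> K * hardy_norm (w k - v)"
      by simp
  qed
  then have "(\<lambda>k. hardy_norm (T (w k))) \<longlonglongrightarrow> hardy_norm (T v)" by (rule LIM_zero_cancel)
  with Tw have "hardy_norm (T v) = \<sigma>" using LIMSEQ_unique by blast
  with \<sigma>_max v(1) v1 vV show ?thesis by (auto simp: V_def)
qed

text \<open>Vector number \<open>n\<close> maximizes the image norm among unit vectors orthogonal to
  all earlier ones. Dependent choice applies because the condition \<open>P\<close> on it reads the
  sequence only below \<open>n\<close>.\<close>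

lemma singular_vectors:
  "\<exists>e :: nat \<Rightarrow> complex \<Rightarrow> complex. \<forall>n. e n \<in> hardy2 \<and> hardy_norm (e n) = 1 \<and> (\<forall>i<n. hardy_inner (e n) (e i) = 0) \<and>
    (\<forall>g\<in>hardy2. (\<forall>i<n. hardy_inner g (e i) = 0) \<longrightarrow> hardy_norm (T g) \<le> hardy_norm (T (e n)) * hardy_norm g)"
proof -
  define P where "P e n v \<longleftrightarrow> v \<in> hardy2 \<and> hardy_norm v = 1 \<and> (\<forall>i<n. hardy_inner v (e i) = 0) \<and>
    (\<forall>g\<in>hardy2. (\<forall>i<n. hardy_inner g (e i) = 0) \<longrightarrow> hardy_norm (T g) \<le> hardy_norm (T v) * hardy_norm g)"
    for e :: "nat \<Rightarrow> complex \<Rightarrow> complex" and n :: nat and v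
  have "\<exists>e. \<forall>n. P e n (e n)"
  proof (rule dependent_wellorder_choice)
    fix f g :: "nat \<Rightarrow> complex \<Rightarrow> complex" and n :: nat and r
    assume "\<And>y. y < n \<Longrightarrow> f y = g y"
    then show "P f n r = P g n r" by (simp add: P_def cong: conj_cong imp_cong)
  next
    fix n and f :: "nat \<Rightarrow> complex \<Rightarrow> complex"
    assume "\<And>y. y < n \<Longrightarrow> P f y (f y)"
    then have "\<And>i. i < n \<Longrightarrow> f i \<in> hardy2" by (auto simp: P_def)
    from maximizer[of n f, OF this] show "\<exists>r. P f n r" by (auto simp: P_def)
  qed
  then show ?thesis by (simp only: P_def)
qed

end

section \<open>The maximizers as singular vectors\<close>

locale singular_vector_sequence = compact_injective +
  fixes e :: "nat \<Rightarrow> complex \<Rightarrow> complex"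
  assumes e_mem [simp]: "\<And>n. e n \<in> hardy2"
    and e_norm: "\<And>n. hardy_norm (e n) = 1"
    and e_orth: "\<And>i n. i < n \<Longrightarrow> hardy_inner (e n) (e i) = 0"
    and e_max: "\<And>n g. g \<in> hardy2 \<Longrightarrow> (\<And>i. i < n \<Longrightarrow> hardy_inner g (e i) = 0) \<Longrightarrow>
       hardy_norm (T g) \<le> hardy_norm (T (e n)) * hardy_norm g"
begin

definition s :: "nat \<Rightarrow> real" where "s n = hardy_norm (T (e n))"

lemma e_inner: "hardy_inner (e i) (e j) = (if i = j then 1 else 0)"
proof (cases i j rule: linorder_cases)
  case less
  then show ?thesis using e_orth[OF less] hardy_inner_commute[of "e j" "e i"] by simp
next
  case equal
  then show ?thesis by (simp add: hardy_inner_self e_norm)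
next
  case greater
  then show ?thesis using e_orth[OF greater] by simp
qed

lemma e_nonzero: "e n \<noteq> 0"
  using e_norm[of n] by auto

lemma s_pos: "s n > 0"
  unfolding s_def using inj[of "e n"] e_nonzero[of n] by (intro hardy_norm_pos) auto

lemma s_decseq: "decseq s"
proof (rule decseq_SucI)
  fix n show "s (Suc n) \<le> s n"
    using e_max[of "e (Suc n)" n] by (simp add: e_orth e_norm s_def)
qed

definition component :: "nat set \<Rightarrow> (complex \<Rightarrow> complex) \<Rightarrow> complex \<Rightarrow> complex" where
  "component I f = (\<Sum>i\<in>I. fun_scale (hardy_inner f (e i)) (e i))"

lemma component_mem [simp]: "component I f \<in> hardy2"
  unfolding component_def by (intro hardy2_sum hardy2_scale e_mem)

lemma inner_diff_component:
  assumes "f \<in> hardy2" "finite I" "j \<in> I"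
  shows "hardy_inner (f - component I f) (e j) = 0"
proof -
  have "hardy_inner (component I f) (e j) = hardy_inner f (e j)"
    unfolding component_def using assms
    by (intro hardy_inner_orthonormal_sum) (auto simp: e_inner)
  then show ?thesis using assms by (simp add: hardy_inner_diff_left)
qed

text \<open>The eigenvalue equation for the adjoint of \<open>T\<close> composed with
  \<open>T\<close>, in weak form, so that no adjoint has to be constructed. For \<open>g\<close>
  orthogonal to the earlier \<open>e i\<close> it is the first-order condition at the maximizer
  \<open>e n\<close>; for \<open>g\<close> among the earlier \<open>e i\<close> both sides vanish,
  the left one by induction.\<close>

lemma e_singular:
  assumes "g \<in> hardy2"
  shows "hardy_inner (T g) (T (e n)) = (s n)\<^sup>2 * hardy_inner g (e n)"
  using assms
proof (induction n arbitrary: g rule: less_induct)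
  case (less n g)
  have V: "hardy_inner (T h) (T (e n)) = (s n)\<^sup>2 * hardy_inner h (e n)"
    if h: "h \<in> hardy2" "\<And>i. i < n \<Longrightarrow> hardy_inner h (e i) = 0" for h
  proof -
    define \<alpha> where "\<alpha> = (s n)\<^sup>2 * (hardy_norm h)\<^sup>2 - (hardy_norm (T h))\<^sup>2"
    define \<beta> where "\<beta> = of_real ((s n)\<^sup>2) * hardy_inner (e n) h - hardy_inner (T (e n)) (T h)"
    have sq: "(hardy_norm (T k))\<^sup>2 \<le> (s n)\<^sup>2 * (hardy_norm k)\<^sup>2"
      if k: "k \<in> hardy2" "\<And>i. i < n \<Longrightarrow> hardy_inner k (e i) = 0" for k
    proof -
      have "(hardy_norm (T k))\<^sup>2 \<le> (s n * hardy_norm k)\<^sup>2"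
        using e_max[OF k] k by (intro power_mono) (auto simp: s_def)
      then show ?thesis by (simp add: power_mult_distrib)
    qed
    have "\<beta> = 0"
    proof (rule first_variation_zero)
      show "\<alpha> \<ge> 0" using sq[OF h] by (simp add: \<alpha>_def)
      fix c
      define k where "k = e n + fun_scale c h"
      have "k \<in> hardy2" "\<And>i. i < n \<Longrightarrow> hardy_inner k (e i) = 0"
        using h by (auto simp: k_def hardy2_add hardy2_scale hardy_inner_add_left hardy_inner_scale_left e_orth)
      \<comment> \<open>The inequality \<open>sq\<close> is an equality at \<open>e n\<close>, so
        only the linear and quadratic terms in \<open>c\<close> remain.\<close>
      from sq[OF this] show "0 \<le> (cmod c)\<^sup>2 * \<alpha> + 2 * Re (cnj c * \<beta>)"
        using h by (simp add: k_def T_add T_scale hardy2_scale hardy_norm_add_square hardy_norm_scale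
            hardy_inner_scale_right e_norm s_def[symmetric] \<alpha>_def \<beta>_def power_mult_distrib algebra_simps)
    qed
    then have "cnj (hardy_inner (T (e n)) (T h)) = cnj ((s n)\<^sup>2 * hardy_inner (e n) h)"
      by (simp add: \<beta>_def)
    then show ?thesis
      using h hardy_inner_commute[of "e n" h] hardy_inner_commute[of "T (e n)" "T h"] by simp
  qed
  have lower: "hardy_inner (T (e i)) (T (e n)) = 0" if "i < n" for i
    using less.IH[OF that, of "e n"] that hardy_inner_commute[of "T (e n)" "T (e i)"] by (simp add: e_orth)
  define c where "c = component {..<n} g"
  have "hardy_inner (T (g - c)) (T (e n)) = (s n)\<^sup>2 * hardy_inner (g - c) (e n)"
    using less.prems by (intro V) (auto simp: c_def inner_diff_component)
  moreover have "hardy_inner (T c) (T (e n)) = 0"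
    by (simp add: c_def component_def T_sum hardy2_scale T_scale hardy_inner_sum_left hardy_inner_scale_left lower)
  moreover have "hardy_inner c (e n) = 0"
    by (simp add: c_def component_def hardy2_scale hardy_inner_sum_left hardy_inner_scale_left e_inner)
  ultimately show ?case
    using less.prems by (simp add: T_diff hardy_inner_diff_left c_def)
qed

text \<open>The images \<open>T (e n)\<close> are orthogonal. If their norms stayed above
  \<open>\<epsilon>\<close>, so would their mutual distances, which contradicts compactness.\<close>

lemma s_tendsto_0: "s \<longlonglongrightarrow> 0"
proof -
  have "\<exists>n. s n < \<epsilon>" if \<epsilon>: "\<epsilon> > 0" for \<epsilon>
  proof (rule ccontr)
    assume "\<not> ?thesis"
    then have big: "\<epsilon> \<le> s n" for n by (simp add: not_less)
    obtain g r where g: "g \<in> hardy2" "strict_mono (r :: nat \<Rightarrow> nat)"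
      "(\<lambda>n. hardy_norm (T (e (r n)) - g)) \<longlonglongrightarrow> 0"
      using compactE[of e] e_norm by auto
    obtain n where n: "\<And>m. m \<ge> n \<Longrightarrow> hardy_norm (T (e (r m)) - g) < \<epsilon> / 2"
      using order_tendstoD(2)[OF g(3), of "\<epsilon> / 2"] \<epsilon> by (auto simp: eventually_sequentially)
    define i j where "i = r n" and "j = r (Suc n)"
    have ij: "i < j" using g(2) by (simp add: i_def j_def strict_mono_def)
    have "hardy_norm (T (e i) - T (e j)) \<le> hardy_norm (T (e i) - g) + hardy_norm (g - T (e j))"
      using g by (intro hardy_norm_triangle3) auto
    then have "hardy_norm (T (e i) - T (e j)) < \<epsilon>"
      using n[of n] n[of "Suc n"] g by (simp add: i_def j_def hardy_norm_minus_commute[of g])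
    then have "(hardy_norm (T (e i) - T (e j)))\<^sup>2 < \<epsilon>\<^sup>2"
      using \<epsilon> by (intro power_strict_mono hardy_norm_nonneg hardy2_diff T_mem) auto
    moreover have "hardy_norm (T (e i) - T (e j)) = hardy_norm (T (e i) + fun_scale (-1) (T (e j)))"
      by simp
    then have "(hardy_norm (T (e i) - T (e j)))\<^sup>2 = (s i)\<^sup>2 + (s j)\<^sup>2"
      using ij by (simp only: hardy_norm_add_square T_mem e_mem hardy2_scale hardy_norm_scale
          hardy_inner_scale_right e_singular e_inner s_def) simp
    ultimately have "(s i)\<^sup>2 + (s j)\<^sup>2 < \<epsilon>\<^sup>2" by simp
    moreover have "\<epsilon>\<^sup>2 \<le> (s i)\<^sup>2" using big[of i] \<epsilon> by (intro power_mono) auto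
    ultimately show False using zero_le_power2[of "s j"] by linarith
  qed
  then have "\<exists>N. \<forall>n\<ge>N. s n < \<epsilon>" if "\<epsilon> > 0" for \<epsilon>
    using that by (meson decseqD order_le_less_trans s_decseq)
  then show ?thesis
    using s_pos by (intro decreasing_tendsto) (auto simp: less_imp_le eventually_sequentially)
qed

lemma singular_space_iff:
  "f \<in> singular_space T t \<longleftrightarrow> f \<in> hardy2 \<and> (\<forall>g\<in>hardy2. hardy_inner (T g) (T f) = t\<^sup>2 * hardy_inner g f)"
  by (auto simp: singular_space_def adjoint_at_def hardy2_scale hardy_inner_scale_right)

lemma finite_level:
  assumes "t > 0"
  shows "finite {n. s n = t}"
proof -
  obtain N where "\<And>n. n \<ge> N \<Longrightarrow> s n < t"
    using order_tendstoD(2)[OF s_tendsto_0 assms] by (auto simp: eventually_sequentially)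
  then have "{n. s n = t} \<subseteq> {..<N}" by (force simp: not_le[symmetric])
  then show ?thesis by (rule finite_subset) simp
qed

text \<open>Eigenvectors of a self-adjoint operator for different eigenvalues are orthogonal; as
  \<open>t\<close> and \<open>s n\<close> are both positive, their squares differ too.\<close>

lemma singular_space_orth:
  assumes "f \<in> singular_space T t" "s n \<noteq> t" "t > 0"
  shows "hardy_inner f (e n) = 0"
proof -
  have f: "f \<in> hardy2" using assms by (simp add: singular_space_iff)
  have "hardy_inner (T (e n)) (T f) = t\<^sup>2 * hardy_inner (e n) f"
    using assms by (simp add: singular_space_iff)
  moreover have "hardy_inner (T f) (T (e n)) = (s n)\<^sup>2 * hardy_inner f (e n)"
    using f by (rule e_singular)
  ultimately have "t\<^sup>2 * hardy_inner f (e n) = (s n)\<^sup>2 * hardy_inner f (e n)"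
    using f hardy_inner_commute[of "T f" "T (e n)"] hardy_inner_commute[of f "e n"]
    by (metis T_mem complex_cnj_cnj complex_cnj_complex_of_real complex_cnj_mult e_mem)
  then have "(of_real (t\<^sup>2) - of_real ((s n)\<^sup>2)) * hardy_inner f (e n) = 0"
    by (simp add: algebra_simps)
  moreover have "t\<^sup>2 \<noteq> (s n)\<^sup>2" using assms s_pos[of n] by (simp add: power2_eq_iff_nonneg)
  ultimately show ?thesis by (metis eq_iff_diff_eq_0 mult_eq_0_iff of_real_eq_iff)
qed

text \<open>What is left of an eigenvector after removing its components of level \<open>t\<close>
  is orthogonal to every \<open>e n\<close>. Hence its image has norm at most \<open>s n\<close>
  times a constant for all \<open>n\<close>, so it is 0, and injectivity applies.\<close>

lemma singular_space_span:
  assumes t: "t > 0"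
  shows "singular_space T t = cfun.span (e ` {n. s n = t})"
proof
  define I where "I = {n. s n = t}"
  have I: "finite I" using finite_level[OF t] by (simp add: I_def)
  show "singular_space T t \<subseteq> cfun.span (e ` {n. s n = t})"
  proof
    fix f assume f: "f \<in> singular_space T t"
    then have fm: "f \<in> hardy2" by (simp add: singular_space_iff)
    define h where "h = f - component I f"
    have hm: "h \<in> hardy2" using fm by (auto simp: h_def)
    have horth: "hardy_inner h (e n) = 0" for n
    proof (cases "n \<in> I")
      case True then show ?thesis using inner_diff_component fm I by (simp add: h_def)
    next
      case False
      then have "hardy_inner (component I f) (e n) = 0"
        unfolding component_def by (subst hardy_inner_sum_left)
          (auto simp: hardy2_scale hardy_inner_scale_left e_inner intro!: sum.neutral)
      moreover have "hardy_inner f (e n) = 0"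
        using singular_space_orth[OF f _ t] False by (simp add: I_def)
      ultimately show ?thesis using fm by (simp add: h_def hardy_inner_diff_left)
    qed
    have "(\<lambda>n. s n * hardy_norm h) \<longlonglongrightarrow> 0"
      using tendsto_mult_left_zero[OF s_tendsto_0] by simp
    moreover have "hardy_norm (T h) \<le> s n * hardy_norm h" for n
      unfolding s_def using hm horth by (intro e_max)
    ultimately have "hardy_norm (T h) \<le> 0" by (intro LIMSEQ_le_const[of "\<lambda>n. s n * hardy_norm h"]) auto
    then have "T h = 0" using hm hardy_norm_pos[of "T h"] by force
    then have "h = 0" using inj hm by blast
    then have "f = component I f" by (simp add: h_def)
    also have "\<dots> \<in> cfun.span (e ` I)"
      unfolding component_def by (intro cfun.span_sum cfun.span_scale cfun.span_base) auto
    finally show "f \<in> cfun.span (e ` {n. s n = t})" by (simp add: I_def)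
  qed
  show "cfun.span (e ` {n. s n = t}) \<subseteq> singular_space T t"
  proof (rule cfun.span_minimal)
    show "e ` {n. s n = t} \<subseteq> singular_space T t"
      using e_singular by (auto simp: singular_space_iff)
    show "cfun.subspace (singular_space T t)"
      unfolding cfun.subspace_def
      by (auto simp: singular_space_iff T_add T_scale hardy_inner_add_right hardy_inner_scale_right
          hardy2_add hardy2_scale distrib_left mult.left_commute)
  qed
qed

lemma singular_numbers_s: "singular_numbers T s"
  unfolding singular_numbers_def
proof (intro conjI allI impI)
  fix t :: real assume t: "t > 0"
  define I where "I = {n. s n = t}"
  show "finite {n. s n = t}" by (rule finite_level[OF t])
  then have I: "finite I" by (simp add: I_def)
  have inj: "inj_on e I"
    using e_inner by (intro inj_onI) (metis zero_neq_one)
  have "cfun.independent (e ` I)"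
  proof (rule cfun.independent_if_scalars_zero)
    fix c x assume sum0: "(\<Sum>x\<in>e ` I. fun_scale (c x) x) = 0" and "x \<in> e ` I"
    then obtain j where j: "j \<in> I" "x = e j" by auto
    have "c (e j) = hardy_inner (\<Sum>i\<in>I. fun_scale (c (e i)) (e i)) (e j)"
      using I j by (subst hardy_inner_orthonormal_sum) (auto simp: e_inner)
    also have "(\<Sum>i\<in>I. fun_scale (c (e i)) (e i)) = 0"
      using sum0 inj by (simp add: sum.reindex)
    finally show "c x = 0" using j by (simp only: hardy_inner_zero)
  qed (use I in auto)
  then have "cfun.dim (cfun.span (e ` I)) = card (e ` I)"
    by (rule cfun.dim_span_eq_card_independent)
  then show "card {n. s n = t} = cfun.dim (singular_space T t)"
    using inj by (simp add: singular_space_span[OF t] I_def card_image)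
qed (use s_decseq s_pos in \<open>auto intro: less_imp_le\<close>)

text \<open>The span of \<open>e 0, ..., e n\<close> has dimension \<open>n + 1\<close> and contains
  a nonzero vector whose first \<open>n\<close> coefficients vanish. On this span \<open>T\<close>
  multiplies norms by at least \<open>s n\<close>.\<close>

lemma s_upper:
  assumes "\<And>f. f \<in> hardy2 \<Longrightarrow> (\<And>k. k < n \<Longrightarrow> taylor_coeff f k = 0) \<Longrightarrow> hardy_norm (T f) \<le> C * hardy_norm f"
  shows "s n \<le> C"
proof -
  obtain c where c: "\<exists>j\<le>n. c j \<noteq> 0" "\<And>k. k < n \<Longrightarrow> (\<Sum>j\<le>n. taylor_coeff (e j) k * c j) = 0"
    using homogeneous_system_solution[of n "\<lambda>k j. taylor_coeff (e j) k"] by blast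
  define f where "f = (\<Sum>j\<le>n. fun_scale (c j) (e j))"
  have f: "f \<in> hardy2" by (auto simp: f_def intro!: hardy2_sum)
  have fe: "hardy_inner f (e j) = c j" if "j \<le> n" for j
    using that unfolding f_def by (intro hardy_inner_orthonormal_sum) (auto simp: e_inner)
  have "f \<noteq> 0" using c(1) fe by force
  then have pos: "hardy_norm f > 0" using f by (rule hardy_norm_pos[rotated])
  have "taylor_coeff f k = 0" if "k < n" for k
    using c(2)[OF that] by (simp add: f_def taylor_coeff_sum hardy2_scale taylor_coeff_scale mult.commute)
  then have le: "hardy_norm (T f) \<le> C * hardy_norm f" using assms f by blast
  have "of_real ((hardy_norm f)\<^sup>2) = (\<Sum>j\<le>n. cnj (c j) * hardy_inner f (e j))"
    unfolding hardy_inner_self[OF f, symmetric] using f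
    by (subst f_def) (simp add: hardy_inner_sum_right hardy2_scale hardy_inner_scale_right)
  also have "\<dots> = of_real (\<Sum>j\<le>n. (cmod (c j))\<^sup>2)"
    by (simp add: fe complex_norm_square mult.commute del: of_real_power)
  finally have nf: "(hardy_norm f)\<^sup>2 = (\<Sum>j\<le>n. (cmod (c j))\<^sup>2)" by (simp only: of_real_eq_iff)
  have "of_real ((hardy_norm (T f))\<^sup>2) = (\<Sum>j\<le>n. cnj (c j) * hardy_inner (T f) (T (e j)))"
    unfolding hardy_inner_self[OF T_mem[OF f], symmetric] using f
    by (subst (2) f_def) (simp add: T_sum T_scale hardy_inner_sum_right hardy2_scale hardy_inner_scale_right)
  also have "\<dots> = of_real (\<Sum>j\<le>n. (s j)\<^sup>2 * (cmod (c j))\<^sup>2)"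
    using f by (simp add: e_singular fe complex_norm_square mult_ac del: of_real_power)
  finally have nTf: "(hardy_norm (T f))\<^sup>2 = (\<Sum>j\<le>n. (s j)\<^sup>2 * (cmod (c j))\<^sup>2)" by (simp only: of_real_eq_iff)
  have "(s n * hardy_norm f)\<^sup>2 = (\<Sum>j\<le>n. (s n)\<^sup>2 * (cmod (c j))\<^sup>2)"
    by (simp add: power_mult_distrib nf sum_distrib_left)
  also have "\<dots> \<le> (hardy_norm (T f))\<^sup>2"
    unfolding nTf using s_decseq s_pos
    by (intro sum_mono mult_right_mono power_mono) (auto simp: decseq_def intro: less_imp_le)
  finally have "s n * hardy_norm f \<le> hardy_norm (T f)"
    by (rule power2_le_imp_le) (use f in simp)
  with le have "s n * hardy_norm f \<le> C * hardy_norm f" by linarith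
  then show ?thesis using pos by simp
qed

text \<open>Dual to \<open>s_upper\<close>: a polynomial of degree at most \<open>n\<close>
  orthogonal to the first \<open>n\<close> singular vectors is subject to the maximality of
  \<open>e n\<close>.\<close>

lemma s_lower:
  assumes "\<And>f. f \<in> hardy2 \<Longrightarrow> (\<And>k. k > n \<Longrightarrow> taylor_coeff f k = 0) \<Longrightarrow> C * hardy_norm f \<le> hardy_norm (T f)"
  shows "C \<le> s n"
proof -
  obtain f where f: "f \<in> hardy2" "f \<noteq> 0" "\<forall>k>n. taylor_coeff f k = 0" "\<forall>i<n. hardy_inner f (e i) = 0"
    using exists_polynomial_orthogonal[of n e] by blast
  have "C * hardy_norm f \<le> hardy_norm (T f)" using assms f by blast
  also have "\<dots> \<le> s n * hardy_norm f" unfolding s_def using f by (intro e_max) auto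
  finally show ?thesis using hardy_norm_pos[OF f(1,2)] by simp
qed

end

lemma singular_numbers_min_max:
  assumes "hardy_compact T" "\<And>f. f \<in> hardy2 \<Longrightarrow> T f = 0 \<Longrightarrow> f = 0"
    and upper: "\<And>n f. f \<in> hardy2 \<Longrightarrow> (\<And>k. k < n \<Longrightarrow> taylor_coeff f k = 0) \<Longrightarrow> hardy_norm (T f) \<le> U n * hardy_norm f"
    and lower: "\<And>n f. f \<in> hardy2 \<Longrightarrow> (\<And>k. k > n \<Longrightarrow> taylor_coeff f k = 0) \<Longrightarrow> L n * hardy_norm f \<le> hardy_norm (T f)"
  obtains s where "singular_numbers T s" "\<And>n. L n \<le> s n" "\<And>n. s n \<le> U n"
proof -
  interpret compact_injective T by unfold_locales (fact assms(1), fact assms(2))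
  obtain e :: "nat \<Rightarrow> complex \<Rightarrow> complex" where e: "\<forall>n. e n \<in> hardy2 \<and> hardy_norm (e n) = 1 \<and> (\<forall>i<n. hardy_inner (e n) (e i) = 0) \<and>
    (\<forall>g\<in>hardy2. (\<forall>i<n. hardy_inner g (e i) = 0) \<longrightarrow> hardy_norm (T g) \<le> hardy_norm (T (e n)) * hardy_norm g)"
    using singular_vectors by blast
  interpret singular_vector_sequence T e by unfold_locales (use e in simp_all)
  show ?thesis
    by (rule that[OF singular_numbers_s s_lower[OF lower] s_upper[OF upper]])
qed

text \<open>Membership in \<open>schatten\<close> asks for some sequence of singular numbers, so
  non-membership has to exclude all of them. Two such sequences take each positive value equally
  often; a partial sum of one, grouped by values, is therefore at most the total of the
  other.\<close>

lemma singular_numbers_powr_summable: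
  assumes s: "singular_numbers T s" "\<And>n. s n > 0" and s': "singular_numbers T s'" "summable (\<lambda>n. s' n powr p)"
  shows "summable (\<lambda>n. s n powr p)"
proof (rule summableI_nonneg_bounded)
  fix n
  have fin: "finite {k. s k = t}" "finite {k. s' k = t}" "card {k. s k = t} = card {k. s' k = t}" if "t > 0" for t
    using s s' that by (auto simp: singular_numbers_def)
  define F where "F = s ` {..<n}"
  have F: "finite F" "\<And>t. t \<in> F \<Longrightarrow> t > 0" using s(2) by (auto simp: F_def)
  \<comment> \<open>The partial sum is completed to full level sets, which are finite.\<close>
  have "(\<Sum>k<n. s k powr p) \<le> (\<Sum>k\<in>(\<Union>t\<in>F. {k. s k = t}). s k powr p)"
    using F fin by (intro sum_mono2) (auto simp: F_def)
  also have "\<dots> = (\<Sum>t\<in>F. \<Sum>k\<in>{k. s k = t}. s k powr p)"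
    using F fin by (intro sum.UNION_disjoint) auto
  also have "\<dots> = (\<Sum>t\<in>F. \<Sum>k\<in>{k. s' k = t}. s' k powr p)"
  proof (rule sum.cong)
    fix t assume "t \<in> F"
    have "(\<Sum>k\<in>{k. s k = t}. s k powr p) = real (card {k. s k = t}) * t powr p" by simp
    also have "\<dots> = (\<Sum>k\<in>{k. s' k = t}. s' k powr p)" using fin(3) F \<open>t \<in> F\<close> by simp
    finally show "(\<Sum>k\<in>{k. s k = t}. s k powr p) = (\<Sum>k\<in>{k. s' k = t}. s' k powr p)" .
  qed simp
  also have "\<dots> = (\<Sum>k\<in>(\<Union>t\<in>F. {k. s' k = t}). s' k powr p)"
    using F fin by (intro sum.UNION_disjoint[symmetric]) auto
  also have "\<dots> \<le> (\<Sum>k. s' k powr p)"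
    using F fin s' by (intro sum_le_suminf) auto
  finally show "(\<Sum>k<n. s k powr p) \<le> (\<Sum>k. s' k powr p)" .
qed simp

section \<open>Composition operators comparable to diagonal operators\<close>

lemma taylor_coeff_cong:
  assumes "f holomorphic_on ball 0 1" "\<And>z. cmod z < 1 \<Longrightarrow> f z = g z"
  shows "taylor_coeff f n = taylor_coeff g n"
  by (rule taylor_coeff_unique[symmetric]) (use taylor_coeff_sums[OF assms(1)] assms(2) in auto)

text \<open>The two-sided comparison is postulated for polynomials in \<open>\<phi>\<close> only,
  where boundary integrals will give it; the locale extends it to all of
  \<open>hardy2\<close>.\<close>

locale diagonal_composition =
  fixes \<phi> :: "complex \<Rightarrow> complex" and D :: "nat \<Rightarrow> real" and c C :: real
  assumes holo: "\<phi> holomorphic_on ball 0 1"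
    and self_map: "\<And>z. cmod z < 1 \<Longrightarrow> cmod (\<phi> z) < 1"
    and D_pos: "\<And>n. D n > 0" and D_decseq: "decseq D" and D_lim: "D \<longlonglongrightarrow> 0"
    and c_pos: "c > 0" and C_pos: "C > 0"
    and poly_summable: "\<And>N a. summable (\<lambda>k. (cmod (taylor_coeff (\<lambda>z. \<Sum>n<N. a n * \<phi> z ^ n) k))\<^sup>2)"
    and poly_lower: "\<And>N a. c * (\<Sum>n<N. (cmod (a n))\<^sup>2 * D n) \<le> (\<Sum>k. (cmod (taylor_coeff (\<lambda>z. \<Sum>n<N. a n * \<phi> z ^ n) k))\<^sup>2)"
    and poly_upper: "\<And>N a. (\<Sum>k. (cmod (taylor_coeff (\<lambda>z. \<Sum>n<N. a n * \<phi> z ^ n) k))\<^sup>2) \<le> C * (\<Sum>n<N. (cmod (a n))\<^sup>2 * D n)"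
begin

lemma comp_op_holomorphic:
  assumes "f \<in> hardy2"
  shows "comp_op \<phi> f holomorphic_on ball 0 1"
proof -
  have "(f \<circ> \<phi>) holomorphic_on ball 0 1"
    by (rule holomorphic_on_compose_gen[OF holo hardy2_holomorphic[OF assms]]) (use self_map in auto)
  then show ?thesis
    by (rule holomorphic_transform) (auto simp: comp_op_def)
qed

lemma poly_holomorphic: "(\<lambda>z. \<Sum>n<N. a n * \<phi> z ^ n) holomorphic_on ball 0 1"
  by (intro holomorphic_intros holo)

text \<open>On the ball of radius 1/2 the modulus of \<open>\<phi>\<close> stays below some
  \<open>\<rho> < 1\<close>, so the series of \<open>f\<close> at \<open>\<phi> z\<close> converges
  uniformly there, and with it all derivatives at 0.\<close>

lemma poly_taylor_coeff_tendsto: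
  assumes f: "f \<in> hardy2"
  shows "(\<lambda>N. taylor_coeff (\<lambda>z. \<Sum>n<N. taylor_coeff f n * \<phi> z ^ n) k) \<longlonglongrightarrow> taylor_coeff (comp_op \<phi> f) k"
proof -
  have cpt: "compact ((\<lambda>z. cmod (\<phi> z)) ` cball 0 (1/2))"
    by (intro compact_continuous_image continuous_on_norm holomorphic_on_imp_continuous_on
        holomorphic_on_subset[OF holo]) auto
  then obtain w where w: "w \<in> cball 0 (1/2)" "\<And>z. z \<in> cball 0 (1/2) \<Longrightarrow> cmod (\<phi> z) \<le> cmod (\<phi> w)"
    using compact_attains_sup[OF cpt] by auto
  define \<rho> where "\<rho> = cmod (\<phi> w)"
  have \<rho>: "0 \<le> \<rho>" "\<rho> < 1" using self_map[of w] w by (auto simp: \<rho>_def)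
  have "uniform_limit (ball 0 (1/2)) (\<lambda>N z. \<Sum>n<N. taylor_coeff f n * \<phi> z ^ n)
      (\<lambda>z. \<Sum>n. taylor_coeff f n * \<phi> z ^ n) sequentially"
  proof (rule Weierstrass_m_test)
    show "summable (\<lambda>n. cmod (taylor_coeff f n * of_real \<rho> ^ n))"
      using \<rho> by (intro square_summable_power_series hardy2_summable f) auto
    fix n z assume "z \<in> ball (0::complex) (1/2)"
    then show "norm (taylor_coeff f n * \<phi> z ^ n) \<le> cmod (taylor_coeff f n * of_real \<rho> ^ n)"
      using w(2)[of z] \<rho> by (auto simp: norm_mult norm_power \<rho>_def intro!: mult_left_mono power_mono)
  qed
  also have "?this \<longleftrightarrow> uniform_limit (ball 0 (1/2)) (\<lambda>N z. \<Sum>n<N. taylor_coeff f n * \<phi> z ^ n)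
      (comp_op \<phi> f) sequentially"
    by (intro uniform_limit_cong') (use hardy2_sums[OF f self_map] in \<open>auto simp: comp_op_def sums_iff\<close>)
  finally have "(\<lambda>N. (deriv ^^ k) (\<lambda>z. \<Sum>n<N. taylor_coeff f n * \<phi> z ^ n) 0) \<longlonglongrightarrow> (deriv ^^ k) (comp_op \<phi> f) 0"
    by (rule higher_deriv_complex_uniform_limit)
       (auto intro!: always_eventually holomorphic_on_subset[OF poly_holomorphic])
  then show ?thesis unfolding taylor_coeff_def by (intro tendsto_divide) auto
qed

definition Q :: "(complex \<Rightarrow> complex) \<Rightarrow> real" where
  "Q f = (\<Sum>n. (cmod (taylor_coeff f n))\<^sup>2 * D n)"

lemma D_le: "D n \<le> D 0"
  using D_decseq by (simp add: decseq_def)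

lemma Q_summable: "f \<in> hardy2 \<Longrightarrow> summable (\<lambda>n. (cmod (taylor_coeff f n))\<^sup>2 * D n)"
  by (rule summable_comparison_test'[OF summable_mult2[OF hardy2_summable, of f "D 0"]])
     (use D_le D_pos in \<open>auto intro!: mult_left_mono simp: abs_mult less_imp_le\<close>)

lemma Q_sums: "f \<in> hardy2 \<Longrightarrow> (\<lambda>n. (cmod (taylor_coeff f n))\<^sup>2 * D n) sums Q f"
  unfolding Q_def by (rule summable_sums[OF Q_summable])

lemma Q_nonneg: "f \<in> hardy2 \<Longrightarrow> Q f \<ge> 0"
  unfolding Q_def by (intro suminf_nonneg Q_summable) (use D_pos in \<open>auto simp: less_imp_le\<close>)

lemma Q_partial_le: "f \<in> hardy2 \<Longrightarrow> (\<Sum>n<N. (cmod (taylor_coeff f n))\<^sup>2 * D n) \<le> Q f"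
  unfolding Q_def by (intro sum_le_suminf Q_summable) (use D_pos in \<open>auto simp: less_imp_le\<close>)

text \<open>Finitely many coefficients are compared at a time, since the convergence as
  \<open>N\<close> grows is known for each coefficient separately.\<close>

lemma comp_op_partial_le:
  assumes f: "f \<in> hardy2"
  shows "(\<Sum>k<K. (cmod (taylor_coeff (comp_op \<phi> f) k))\<^sup>2) \<le> C * Q f"
proof (rule tendsto_upperbound)
  show "(\<lambda>N. \<Sum>k<K. (cmod (taylor_coeff (\<lambda>z. \<Sum>n<N. taylor_coeff f n * \<phi> z ^ n) k))\<^sup>2)
      \<longlonglongrightarrow> (\<Sum>k<K. (cmod (taylor_coeff (comp_op \<phi> f) k))\<^sup>2)"
    by (intro tendsto_intros poly_taylor_coeff_tendsto f)
  show "\<forall>\<^sub>F N in sequentially. (\<Sum>k<K. (cmod (taylor_coeff (\<lambda>z. \<Sum>n<N. taylor_coeff f n * \<phi> z ^ n) k))\<^sup>2) \<le> C * Q f"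
  proof (rule always_eventually, rule allI)
    fix N
    have "(\<Sum>k<K. (cmod (taylor_coeff (\<lambda>z. \<Sum>n<N. taylor_coeff f n * \<phi> z ^ n) k))\<^sup>2)
        \<le> (\<Sum>k. (cmod (taylor_coeff (\<lambda>z. \<Sum>n<N. taylor_coeff f n * \<phi> z ^ n) k))\<^sup>2)"
      by (intro sum_le_suminf poly_summable) auto
    also have "\<dots> \<le> C * (\<Sum>n<N. (cmod (taylor_coeff f n))\<^sup>2 * D n)" by (rule poly_upper)
    also have "\<dots> \<le> C * Q f" using C_pos by (intro mult_left_mono Q_partial_le f) auto
    finally show "(\<Sum>k<K. (cmod (taylor_coeff (\<lambda>z. \<Sum>n<N. taylor_coeff f n * \<phi> z ^ n) k))\<^sup>2) \<le> C * Q f" .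
  qed
qed simp

lemma comp_op_mem:
  assumes f: "f \<in> hardy2"
  shows "comp_op \<phi> f \<in> hardy2"
proof -
  have "summable (\<lambda>k. (cmod (taylor_coeff (comp_op \<phi> f) k))\<^sup>2)"
    using comp_op_partial_le[OF f] by (intro summableI_nonneg_bounded[where x = "C * Q f"]) auto
  then show ?thesis
    using comp_op_holomorphic[OF f] by (simp add: hardy2_def) (simp add: comp_op_def)
qed

lemma comp_op_upper:
  assumes f: "f \<in> hardy2"
  shows "(hardy_norm (comp_op \<phi> f))\<^sup>2 \<le> C * Q f"
  using hardy_norm_sums[OF comp_op_mem[OF f]] comp_op_partial_le[OF f]
  by (simp add: sums_iff) (metis suminf_le_const)

lemma comp_op_add: "comp_op \<phi> (f + g) = comp_op \<phi> f + comp_op \<phi> g"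
  and comp_op_scale: "comp_op \<phi> (fun_scale a f) = fun_scale a (comp_op \<phi> f)"
  by (auto simp: comp_op_def fun_scale_def fun_eq_iff)

lemma comp_op_diff: "comp_op \<phi> (f - g) = comp_op \<phi> f - comp_op \<phi> g"
  by (auto simp: comp_op_def fun_eq_iff)

lemma comp_op_linear: "hardy_linear (comp_op \<phi>)"
  unfolding hardy_linear_def using comp_op_mem by (auto simp: comp_op_add comp_op_scale)

text \<open>Under coefficientwise convergence the norm is only lower semicontinuous, which passes on
  upper bounds but not lower ones. The lower bound is taken from the truncation \<open>p N\<close>
  instead, with the error controlled by the upper bound for the tail \<open>f - p N\<close>.\<close>

lemma comp_op_lower:
  assumes f: "f \<in> hardy2"
  shows "c * Q f \<le> (hardy_norm (comp_op \<phi> f))\<^sup>2"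
proof -
  define a where "a = taylor_coeff f"
  define p where "p N = hardy_series (\<lambda>n. if n < N then a n else 0)" for N
  have summ: "summable (\<lambda>n. (cmod (if n < N then a n else 0))\<^sup>2)" for N
    by (rule summable_finite[of "{..<N}"]) auto
  have p: "p N \<in> hardy2" "taylor_coeff (p N) n = (if n < N then a n else 0)" for N n
    using hardy_series_mem[OF summ] taylor_coeff_hardy_series[OF summ] by (auto simp: p_def)
  have p_eval: "p N z = (\<Sum>n<N. a n * z ^ n)" if "cmod z < 1" for N z
    using that unfolding p_def hardy_series_def
    by (simp, subst suminf_finite[of "{..<N}"]) auto
  have lower_p: "c * (\<Sum>n<N. (cmod (a n))\<^sup>2 * D n) \<le> (hardy_norm (comp_op \<phi> (p N)))\<^sup>2" for N
  proof -
    have "taylor_coeff (\<lambda>z. \<Sum>n<N. a n * \<phi> z ^ n) k = taylor_coeff (comp_op \<phi> (p N)) k" for k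
      by (rule taylor_coeff_cong[OF poly_holomorphic]) (simp add: comp_op_def p_eval self_map)
    then have "(hardy_norm (comp_op \<phi> (p N)))\<^sup>2 = (\<Sum>k. (cmod (taylor_coeff (\<lambda>z. \<Sum>n<N. a n * \<phi> z ^ n) k))\<^sup>2)"
      using hardy_norm_sums[OF comp_op_mem[OF p(1)], of N] by (simp add: sums_iff)
    then show ?thesis using poly_lower[where N = N and a = a] by simp
  qed
  have tail: "Q (f - p N) = Q f - (\<Sum>n<N. (cmod (a n))\<^sup>2 * D n)" for N
  proof -
    have "(\<lambda>n. if n \<in> {..<N} then (cmod (a n))\<^sup>2 * D n else 0) sums (\<Sum>n<N. (cmod (a n))\<^sup>2 * D n)"
      by (intro sums_If_finite_set) auto
    from sums_diff[OF Q_sums[OF f] this]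
    have "(\<lambda>n. (cmod (taylor_coeff (f - p N) n))\<^sup>2 * D n) sums (Q f - (\<Sum>n<N. (cmod (a n))\<^sup>2 * D n))"
      by (rule sums_cong[THEN iffD1, rotated]) (use f in \<open>simp add: taylor_coeff_diff p a_def\<close>)
    then show ?thesis using Q_sums[OF hardy2_diff[OF f p(1)]] sums_unique2 by blast
  qed
  have part: "(\<lambda>N. \<Sum>n<N. (cmod (a n))\<^sup>2 * D n) \<longlonglongrightarrow> Q f"
    using Q_sums[OF f] by (simp add: sums_def a_def)
  have "sqrt (c * Q f) \<le> hardy_norm (comp_op \<phi> f)"
  proof (rule tendsto_upperbound)
    show "(\<lambda>N. sqrt (c * (\<Sum>n<N. (cmod (a n))\<^sup>2 * D n)) - sqrt (C * (Q f - (\<Sum>n<N. (cmod (a n))\<^sup>2 * D n))))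
       \<longlonglongrightarrow> sqrt (c * Q f)"
      by (rule tendsto_eq_rhs[OF tendsto_diff[OF tendsto_real_sqrt[OF tendsto_mult[OF tendsto_const part]]
           tendsto_real_sqrt[OF tendsto_mult[OF tendsto_const tendsto_diff[OF tendsto_const part]]]]]) simp
    show "\<forall>\<^sub>F N in sequentially. sqrt (c * (\<Sum>n<N. (cmod (a n))\<^sup>2 * D n)) - sqrt (C * (Q f - (\<Sum>n<N. (cmod (a n))\<^sup>2 * D n)))
       \<le> hardy_norm (comp_op \<phi> f)"
    proof (rule always_eventually, rule allI)
      fix N
      have "sqrt (c * (\<Sum>n<N. (cmod (a n))\<^sup>2 * D n)) \<le> hardy_norm (comp_op \<phi> (p N))"
        using lower_p comp_op_mem[OF p(1)] by (intro real_le_lsqrt) auto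
      also have "\<dots> = hardy_norm (comp_op \<phi> f - comp_op \<phi> (f - p N))"
        by (simp add: comp_op_diff)
      also have "\<dots> \<le> hardy_norm (comp_op \<phi> f) + hardy_norm (comp_op \<phi> (f - p N))"
        using hardy_norm_triangle[of "comp_op \<phi> f" "fun_scale (-1) (comp_op \<phi> (f - p N))"]
          hardy_norm_scale[of "comp_op \<phi> (f - p N)" "-1"]
          comp_op_mem[OF f] comp_op_mem[OF hardy2_diff[OF f p(1)], of N]
          hardy2_scale[of "comp_op \<phi> (f - p N)" "-1"] by simp
      also have "hardy_norm (comp_op \<phi> (f - p N)) \<le> sqrt (C * Q (f - p N))"
        using comp_op_upper[OF hardy2_diff[OF f p(1)], of N] by (intro real_le_rsqrt) auto
      finally show "sqrt (c * (\<Sum>n<N. (cmod (a n))\<^sup>2 * D n)) - sqrt (C * (Q f - (\<Sum>n<N. (cmod (a n))\<^sup>2 * D n)))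
         \<le> hardy_norm (comp_op \<phi> f)" by (simp add: tail)
    qed
  qed simp
  then have "(sqrt (c * Q f))\<^sup>2 \<le> (hardy_norm (comp_op \<phi> f))\<^sup>2"
    using Q_nonneg[OF f] c_pos by (intro power_mono) auto
  then show ?thesis using Q_nonneg[OF f] c_pos by simp
qed

text \<open>A bounded sequence has a subsequence converging in every coefficient. For the
  differences \<open>v n\<close> from the limit, the sum weighted by \<open>D\<close> has a finite
  head that tends to 0 and a tail that is small uniformly in \<open>n\<close>, because
  \<open>D\<close> tends to 0.\<close>

lemma comp_op_compact: "hardy_compact (comp_op \<phi>)"
  unfolding hardy_compact_def
proof (intro conjI allI impI)
  show "hardy_linear (comp_op \<phi>)" by (rule comp_op_linear)
  fix u :: "nat \<Rightarrow> complex \<Rightarrow> complex"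
  assume u: "\<forall>n. u n \<in> hardy2 \<and> hardy_norm (u n) \<le> 1"
  then have um: "u n \<in> hardy2" and u1: "hardy_norm (u n) \<le> 1" for n by auto
  have coeff_le: "cmod (taylor_coeff (u n) j) \<le> 1" for n j
    using taylor_coeff_le_hardy_norm[OF um] u1 order_trans by blast
  \<comment> \<open>Diagonal extraction over the coefficient index.\<close>
  obtain r where r: "strict_mono (r :: nat \<Rightarrow> nat)" "\<And>j. \<exists>l. (\<lambda>n. taylor_coeff (u (r n)) j) \<longlonglongrightarrow> l"
    by (rule function_convergent_subsequence[of UNIV "\<lambda>n. taylor_coeff (u n)" 1])
       (use coeff_le in auto)
  then obtain a where a: "\<And>j. (\<lambda>n. taylor_coeff (u (r n)) j) \<longlonglongrightarrow> a j" by metis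
  have "(\<Sum>j<J. (cmod (a j))\<^sup>2) \<le> 1" for J
  proof (rule tendsto_upperbound)
    show "(\<lambda>n. \<Sum>j<J. (cmod (taylor_coeff (u (r n)) j))\<^sup>2) \<longlonglongrightarrow> (\<Sum>j<J. (cmod (a j))\<^sup>2)"
      by (intro tendsto_intros a)
    show "\<forall>\<^sub>F n in sequentially. (\<Sum>j<J. (cmod (taylor_coeff (u (r n)) j))\<^sup>2) \<le> 1"
    proof (rule always_eventually, rule allI)
      fix n
      have "(\<Sum>j<J. (cmod (taylor_coeff (u (r n)) j))\<^sup>2) \<le> (hardy_norm (u (r n)))\<^sup>2"
        using hardy_norm_sums[OF um, of "r n"] sum_le_suminf[OF hardy2_summable[OF um], of "{..<J}" "r n"]
        by (simp add: sums_iff)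
      also have "\<dots> \<le> 1" using u1 um by (simp add: power_le_one)
      finally show "(\<Sum>j<J. (cmod (taylor_coeff (u (r n)) j))\<^sup>2) \<le> 1" .
    qed
  qed simp
  then have "summable (\<lambda>j. (cmod (a j))\<^sup>2)"
    by (intro summableI_nonneg_bounded[where x = 1]) auto
  note S = hardy_series_mem[OF this] taylor_coeff_hardy_series[OF this]
  define g where "g = hardy_series a"
  define v where "v n = u (r n) - g" for n
  have g: "g \<in> hardy2" using S by (simp add: g_def)
  have v: "v n \<in> hardy2" for n using um g by (auto simp: v_def)
  define B where "B = (1 + hardy_norm g)\<^sup>2"
  have vB: "(hardy_norm (v n))\<^sup>2 \<le> B" for n
  proof -
    have "hardy_norm (v n) \<le> 1 + hardy_norm g"
      using hardy_norm_triangle_diff[OF v um, of n "r n"] u1[of "r n"]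
        hardy_norm_triangle[OF um hardy2_scale[OF g], of "r n" "-1"] hardy_norm_scale[OF g, of "-1"]
      by (simp add: v_def)
    then show ?thesis unfolding B_def using v by (intro power_mono) auto
  qed
  have v0: "(\<lambda>n. taylor_coeff (v n) j) \<longlonglongrightarrow> 0" for j
    using tendsto_diff[OF a[of j] tendsto_const[of "a j"]] um g S
    by (simp add: v_def taylor_coeff_diff g_def)
  have Qv: "Q (v n) \<le> (\<Sum>j<N. (cmod (taylor_coeff (v n) j))\<^sup>2 * D j) + D N * B" for n N
  proof -
    have "Q (v n) = (\<Sum>j. (cmod (taylor_coeff (v n) (j + N)))\<^sup>2 * D (j + N)) + (\<Sum>j<N. (cmod (taylor_coeff (v n) j))\<^sup>2 * D j)"
      unfolding Q_def by (rule suminf_split_initial_segment[OF Q_summable[OF v]])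
    also have "(\<Sum>j. (cmod (taylor_coeff (v n) (j + N)))\<^sup>2 * D (j + N)) \<le> (\<Sum>j. (cmod (taylor_coeff (v n) (j + N)))\<^sup>2 * D N)"
      using D_decseq by (intro suminf_le mult_left_mono summable_mult2
          summable_ignore_initial_segment[OF hardy2_summable[OF v]]
          summable_ignore_initial_segment[OF Q_summable[OF v]]) (auto simp: decseq_def)
    also have "\<dots> = (\<Sum>j. (cmod (taylor_coeff (v n) (j + N)))\<^sup>2) * D N"
      by (rule suminf_mult2[symmetric]) (rule summable_ignore_initial_segment[OF hardy2_summable[OF v]])
    also have "(\<Sum>j. (cmod (taylor_coeff (v n) (j + N)))\<^sup>2) \<le> (hardy_norm (v n))\<^sup>2"
      using suminf_split_initial_segment[OF hardy2_summable[OF v[of n]], of N] hardy_norm_sums[OF v, of n]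
        sum_nonneg[of "{..<N}" "\<lambda>j. (cmod (taylor_coeff (v n) j))\<^sup>2"]
      by (simp add: sums_iff)
    also note vB[of n]
    finally show ?thesis using D_pos[of N] by (simp add: mult.commute)
  qed
  have "(\<lambda>n. Q (v n)) \<longlonglongrightarrow> 0"
  proof (rule LIMSEQ_I)
    fix \<epsilon> :: real assume \<epsilon>: "\<epsilon> > 0"
    have "(\<lambda>N. D N * B) \<longlonglongrightarrow> 0" using tendsto_mult_left_zero[OF D_lim] by simp
    then obtain N where N: "D N * B < \<epsilon> / 2"
      using order_tendstoD(2)[of _ 0 sequentially "\<epsilon> / 2"] \<epsilon> eventually_happens' sequentially_bot
      by (metis half_gt_zero)
    have "(\<lambda>n. \<Sum>j<N. (cmod (taylor_coeff (v n) j))\<^sup>2 * D j) \<longlonglongrightarrow> (\<Sum>j<N. (cmod 0)\<^sup>2 * D j)"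
      by (intro tendsto_intros v0)
    then have "\<forall>\<^sub>F n in sequentially. (\<Sum>j<N. (cmod (taylor_coeff (v n) j))\<^sup>2 * D j) < \<epsilon> / 2"
      using \<epsilon> by (intro order_tendstoD(2)) auto
    then obtain M where M: "\<And>n. n \<ge> M \<Longrightarrow> (\<Sum>j<N. (cmod (taylor_coeff (v n) j))\<^sup>2 * D j) < \<epsilon> / 2"
      by (auto simp: eventually_sequentially)
    have "norm (Q (v n) - 0) < \<epsilon>" if "n \<ge> M" for n
      using Qv[of n N] M[OF that] N Q_nonneg[OF v, of n] by simp
    then show "\<exists>M. \<forall>n\<ge>M. norm (Q (v n) - 0) < \<epsilon>" by blast
  qed
  from tendsto_real_sqrt[OF tendsto_mult_right_zero[OF this, of C]]
  have lim: "(\<lambda>n. sqrt (C * Q (v n))) \<longlonglongrightarrow> 0" by simp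
  have "(\<lambda>n. hardy_norm (comp_op \<phi> (u (r n)) - comp_op \<phi> g)) \<longlonglongrightarrow> 0"
  proof (rule Lim_null_comparison[OF always_eventually lim], rule allI)
    fix n
    have "hardy_norm (comp_op \<phi> (v n)) \<le> sqrt (C * Q (v n))"
      using comp_op_upper[OF v, of n] by (intro real_le_rsqrt) auto
    then show "norm (hardy_norm (comp_op \<phi> (u (r n)) - comp_op \<phi> g)) \<le> sqrt (C * Q (v n))"
      using comp_op_mem[OF v, of n] by (simp add: v_def comp_op_diff)
  qed
  then show "\<exists>g\<in>hardy2. \<exists>r. strict_mono r \<and> (\<lambda>n. hardy_norm (comp_op \<phi> (u (r n)) - g)) \<longlonglongrightarrow> 0"
    using comp_op_mem[OF g] r(1) by blast
qed

text \<open>Since \<open>D\<close> decreases, \<open>Q f\<close> is at most \<open>D n\<close> times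
  the squared norm if the first \<open>n\<close> coefficients vanish, and at least that if all
  coefficients beyond \<open>n\<close> vanish: the two bounds that the min-max lemma takes. The
  lower bound also gives injectivity.\<close>

lemma comp_op_singular_numbers:
  obtains s where "singular_numbers (comp_op \<phi>) s" "\<And>n. sqrt (c * D n) \<le> s n" "\<And>n. s n \<le> sqrt (C * D n)"
proof (rule singular_numbers_min_max[OF comp_op_compact])
  fix f assume f: "f \<in> hardy2" "comp_op \<phi> f = 0"
  have "Q f \<le> 0" using comp_op_lower[OF f(1)] f(2) c_pos by (simp add: mult_le_0_iff)
  then have "(cmod (taylor_coeff f n))\<^sup>2 * D n \<le> 0" for n
    using sum_le_suminf[OF Q_summable[OF f(1)], of "{n}"] D_pos by (auto simp: Q_def less_imp_le)
  then have "taylor_coeff f n = 0" for n using D_pos[of n] by (smt (verit) mult_le_0_iff norm_eq_zero power2_less_eq_zero_iff zero_le_power2)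
  then show "f = 0" using f by (intro hardy2_eqI) auto
next
  fix n f assume f: "f \<in> hardy2" "\<And>k. k < n \<Longrightarrow> taylor_coeff f k = 0"
  have "Q f \<le> (\<Sum>k. D n * (cmod (taylor_coeff f k))\<^sup>2)" unfolding Q_def
  proof (intro suminf_le Q_summable summable_mult hardy2_summable f)
    fix k show "(cmod (taylor_coeff f k))\<^sup>2 * D k \<le> D n * (cmod (taylor_coeff f k))\<^sup>2"
      using f(2)[of k] D_decseq by (cases "k < n") (auto simp: decseq_def mult.commute intro: mult_right_mono)
  qed
  also have "\<dots> = D n * (hardy_norm f)\<^sup>2"
    using hardy_norm_sums[OF f(1)] by (metis sums_iff suminf_mult)
  finally have "Q f \<le> D n * (hardy_norm f)\<^sup>2" .
  then have "(hardy_norm (comp_op \<phi> f))\<^sup>2 \<le> C * (D n * (hardy_norm f)\<^sup>2)"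
    using comp_op_upper[OF f(1)] C_pos by (meson less_imp_le mult_left_mono order_trans)
  also have "\<dots> = (sqrt (C * D n) * hardy_norm f)\<^sup>2"
    using C_pos D_pos[of n] by (simp add: power_mult_distrib)
  finally show "hardy_norm (comp_op \<phi> f) \<le> sqrt (C * D n) * hardy_norm f"
    by (rule power2_le_imp_le) (use C_pos D_pos[of n] f in simp)
next
  fix n f assume f: "f \<in> hardy2" "\<And>k. k > n \<Longrightarrow> taylor_coeff f k = 0"
  have "D n * (hardy_norm f)\<^sup>2 = (\<Sum>k. D n * (cmod (taylor_coeff f k))\<^sup>2)"
    using hardy_norm_sums[OF f(1)] by (metis sums_iff suminf_mult)
  also have "\<dots> \<le> Q f" unfolding Q_def
  proof (intro suminf_le Q_summable summable_mult hardy2_summable f)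
    fix k show "D n * (cmod (taylor_coeff f k))\<^sup>2 \<le> (cmod (taylor_coeff f k))\<^sup>2 * D k"
      using f(2)[of k] D_decseq by (cases "n < k") (auto simp: decseq_def mult.commute intro: mult_right_mono)
  qed
  finally have le: "D n * (hardy_norm f)\<^sup>2 \<le> Q f" .
  have "(sqrt (c * D n) * hardy_norm f)\<^sup>2 = c * (D n * (hardy_norm f)\<^sup>2)"
    using c_pos D_pos[of n] by (simp add: power_mult_distrib)
  also have "\<dots> \<le> (hardy_norm (comp_op \<phi> f))\<^sup>2"
    using comp_op_lower[OF f(1)] le c_pos by (meson less_imp_le mult_left_mono order_trans)
  finally show "sqrt (c * D n) * hardy_norm f \<le> hardy_norm (comp_op \<phi> f)"
    by (rule power2_le_imp_le) (use comp_op_mem f in simp)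
qed (rule that)

lemma comp_op_schatten_iff:
  assumes p: "p > 0"
  shows "comp_op \<phi> \<in> schatten p \<longleftrightarrow> summable (\<lambda>n. D n powr (p / 2))"
proof -
  obtain s where s: "singular_numbers (comp_op \<phi>) s" "\<And>n. sqrt (c * D n) \<le> s n" "\<And>n. s n \<le> sqrt (C * D n)"
    by (rule comp_op_singular_numbers) blast
  have pos: "s n > 0" for n
    using s(2)[of n] c_pos D_pos[of n] by (smt (verit) mult_pos_pos real_sqrt_gt_zero)
  have sq: "sqrt (x * D n) powr p = x powr (p / 2) * D n powr (p / 2)" if "x > 0" for x n
    using that D_pos[of n] by (simp add: powr_half_sqrt[symmetric] powr_powr powr_mult)
  show ?thesis
  proof
    assume "comp_op \<phi> \<in> schatten p"
    then obtain s' where "singular_numbers (comp_op \<phi>) s'" "summable (\<lambda>n. s' n powr p)"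
      by (auto simp: schatten_def)
    then have "summable (\<lambda>n. s n powr p)"
      using singular_numbers_powr_summable s(1) pos by blast
    then have "summable (\<lambda>n. c powr (p / 2) * D n powr (p / 2))"
    proof (rule summable_comparison_test'[where N = 0])
      fix n
      have "c powr (p / 2) * D n powr (p / 2) \<le> s n powr p"
        unfolding sq[OF c_pos, symmetric] using s(2) p c_pos D_pos[of n] by (intro powr_mono2) auto
      then show "norm (c powr (p / 2) * D n powr (p / 2)) \<le> s n powr p" by simp
    qed
    then show "summable (\<lambda>n. D n powr (p / 2))" using c_pos by simp
  next
    assume "summable (\<lambda>n. D n powr (p / 2))"
    then have "summable (\<lambda>n. s n powr p)"
    proof (rule summable_comparison_test'[where N = 0, OF summable_mult[of _ "C powr (p / 2)"]])
      fix n
      have "s n powr p \<le> C powr (p / 2) * D n powr (p / 2)"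
        unfolding sq[OF C_pos, symmetric] using s(3) p pos[of n] by (intro powr_mono2) auto
      then show "norm (s n powr p) \<le> C powr (p / 2) * D n powr (p / 2)" by simp
    qed
    then show "comp_op \<phi> \<in> schatten p" using s(1) comp_op_compact by (auto simp: schatten_def)
  qed
qed

end

section \<open>Parseval's identity for bounded analytic functions\<close>

lemma has_integral_cis_multiple:
  "((\<lambda>\<theta>. cis (of_int m * \<theta>)) has_integral (if m = 0 then of_real (2 * pi) else 0)) {0..2 * pi}"
proof (cases "m = 0")
  case True
  then show ?thesis using has_integral_const_real[of "1::complex" 0 "2 * pi"]
    by (simp add: scaleR_conv_of_real)
next
  case False
  have "((\<lambda>\<theta>. cis (of_int m * \<theta>)) has_integral
      cis (of_int m * (2 * pi)) / (\<i> * of_int m) - cis (of_int m * 0) / (\<i> * of_int m)) {0..2 * pi}"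
  proof (rule fundamental_theorem_of_calculus)
    fix \<theta> :: real
    show "((\<lambda>\<theta>. cis (of_int m * \<theta>) / (\<i> * of_int m)) has_vector_derivative cis (of_int m * \<theta>)) (at \<theta> within {0..2 * pi})"
      unfolding has_vector_derivative_def using False
      by (auto intro!: derivative_eq_intros simp: fun_eq_iff scaleR_conv_of_real field_simps)
  qed simp
  moreover have "cis (of_int m * (2 * pi)) = 1"
    using cis_multiple_2pi[of "of_int m"] by (simp add: mult_ac)
  ultimately show ?thesis using False by simp
qed

lemma integral_circle_polynomial:
  fixes c :: "nat \<Rightarrow> complex"
  shows "((\<lambda>\<theta>. (cmod (\<Sum>k<N. c k * cis (real k * \<theta>)))\<^sup>2) has_integral 2 * pi * (\<Sum>k<N. (cmod (c k))\<^sup>2)) {0..2 * pi}"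
proof -
  have "((\<lambda>\<theta>. \<Sum>k<N. \<Sum>l<N. c k * cnj (c l) * cis (of_int (int k - int l) * \<theta>)) has_integral
      (\<Sum>k<N. \<Sum>l<N. c k * cnj (c l) * (if int k - int l = 0 then of_real (2 * pi) else 0))) {0..2 * pi}"
    by (intro has_integral_sum has_integral_mult_right has_integral_cis_multiple) auto
  also have "(\<lambda>\<theta>. \<Sum>k<N. \<Sum>l<N. c k * cnj (c l) * cis (of_int (int k - int l) * \<theta>)) =
      (\<lambda>\<theta>. of_real ((cmod (\<Sum>k<N. c k * cis (real k * \<theta>)))\<^sup>2))"
    by (simp add: fun_eq_iff complex_norm_square sum_product cis_cnj cis_mult algebra_simps del: of_real_power)
  also have "(\<Sum>k<N. \<Sum>l<N. c k * cnj (c l) * (if int k - int l = 0 then of_real (2 * pi) else 0)) =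
      of_real (2 * pi * (\<Sum>k<N. (cmod (c k))\<^sup>2))"
  proof -
    have "(\<Sum>l<N. c k * cnj (c l) * (if int k - int l = 0 then of_real (2 * pi) else 0)) = of_real (2 * pi * (cmod (c k))\<^sup>2)"
      if "k < N" for k
    proof -
      have "(\<Sum>l<N. c k * cnj (c l) * (if int k - int l = 0 then of_real (2 * pi) else 0)) =
        (\<Sum>l<N. if k = l then c k * cnj (c l) * of_real (2 * pi) else 0)"
        by (intro sum.cong) auto
      also have "\<dots> = of_real (2 * pi * (cmod (c k))\<^sup>2)"
        using that by (simp add: complex_norm_square mult_ac del: of_real_power)
      finally show ?thesis .
    qed
    then show ?thesis by (simp add: sum_distrib_left del: of_real_power)
  qed
  finally show ?thesis by (rule has_integral_Re[of "\<lambda>\<theta>. of_real (f \<theta>)" "of_real I" for f I, unfolded Re_complex_of_real])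
qed

lemma integral_circle_square:
  assumes F: "F holomorphic_on ball 0 1" and r: "0 < r" "r < 1"
  shows "summable (\<lambda>k. (cmod (taylor_coeff F k))\<^sup>2 * r ^ (2 * k))"
    and "integral {0..2 * pi} (\<lambda>\<theta>. (cmod (F (of_real r * cis \<theta>)))\<^sup>2) = 2 * pi * (\<Sum>k. (cmod (taylor_coeff F k))\<^sup>2 * r ^ (2 * k))"
proof -
  define c where "c k = taylor_coeff F k * of_real r ^ k" for k
  define G where "G N \<theta> = (\<Sum>k<N. c k * cis (real k * \<theta>))" for N \<theta>
  have monom: "taylor_coeff F k * (of_real r * cis \<theta>) ^ k = c k * cis (real k * \<theta>)" for k \<theta>
    by (simp add: c_def power_mult_distrib Complex.DeMoivre)
  have sums: "(\<lambda>k. c k * cis (real k * \<theta>)) sums F (of_real r * cis \<theta>)" for \<theta>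
    using taylor_coeff_sums[OF F, of "of_real r * cis \<theta>"] r by (simp add: monom norm_mult)
  have abs: "summable (\<lambda>k. cmod (c k))"
  proof -
    \<comment> \<open>A radius strictly between \<open>r\<close> and 1: convergence there gives
      absolute convergence at \<open>r\<close>.\<close>
    define \<rho> where "\<rho> = (r + 1) / 2"
    have \<rho>: "r < \<rho>" "\<rho> < 1" using r by (auto simp: \<rho>_def)
    have "summable (\<lambda>k. taylor_coeff F k * of_real \<rho> ^ k)"
      using taylor_coeff_sums[OF F, of "of_real \<rho>"] \<rho> r by (simp add: sums_iff)
    from powser_insidea[OF this, of "of_real r"] show ?thesis
      using \<rho> r by (simp add: c_def)
  qed
  have lim: "(\<lambda>N. integral {0..2 * pi} (\<lambda>\<theta>. (cmod (G N \<theta>))\<^sup>2)) \<longlonglongrightarrow> integral {0..2 * pi} (\<lambda>\<theta>. (cmod (F (of_real r * cis \<theta>)))\<^sup>2)"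
  proof (rule dominated_convergence(2))
    show "(\<lambda>\<theta>. (cmod (G N \<theta>))\<^sup>2) integrable_on {0..2 * pi}" for N
      using integral_circle_polynomial[where N = N and c = c] unfolding G_def by (rule has_integral_integrable)
    show "(\<lambda>\<theta>. (\<Sum>k. cmod (c k))\<^sup>2) integrable_on {0..2 * pi}"
      by (intro integrable_continuous_real continuous_on_const)
    fix N \<theta>
    have "cmod (G N \<theta>) \<le> (\<Sum>k<N. cmod (c k))"
      unfolding G_def by (rule order_trans[OF norm_sum]) (simp add: norm_mult)
    also have "\<dots> \<le> (\<Sum>k. cmod (c k))" by (intro sum_le_suminf abs) auto
    finally show "norm ((cmod (G N \<theta>))\<^sup>2) \<le> (\<Sum>k. cmod (c k))\<^sup>2" by (simp add: power_mono)
    show "(\<lambda>N. (cmod (G N \<theta>))\<^sup>2) \<longlonglongrightarrow> (cmod (F (of_real r * cis \<theta>)))\<^sup>2"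
      using sums[of \<theta>] unfolding G_def sums_def by (intro tendsto_intros)
  qed
  have "integral {0..2 * pi} (\<lambda>\<theta>. (cmod (G N \<theta>))\<^sup>2) = 2 * pi * (\<Sum>k<N. (cmod (c k))\<^sup>2)" for N
    using integral_circle_polynomial[where N = N and c = c] unfolding G_def by (rule integral_unique)
  with lim have "(\<lambda>N. 2 * pi * (\<Sum>k<N. (cmod (c k))\<^sup>2) / (2 * pi)) \<longlonglongrightarrow> integral {0..2 * pi} (\<lambda>\<theta>. (cmod (F (of_real r * cis \<theta>)))\<^sup>2) / (2 * pi)"
    by (intro tendsto_divide) auto
  then have "(\<lambda>k. (cmod (c k))\<^sup>2) sums (integral {0..2 * pi} (\<lambda>\<theta>. (cmod (F (of_real r * cis \<theta>)))\<^sup>2) / (2 * pi))"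
    by (simp add: sums_def)
  moreover have "(cmod (c k))\<^sup>2 = (cmod (taylor_coeff F k))\<^sup>2 * r ^ (2 * k)" for k
    using r by (simp add: c_def norm_mult norm_power power_mult_distrib power_mult[symmetric] mult.commute)
  ultimately show "summable (\<lambda>k. (cmod (taylor_coeff F k))\<^sup>2 * r ^ (2 * k))"
    "integral {0..2 * pi} (\<lambda>\<theta>. (cmod (F (of_real r * cis \<theta>)))\<^sup>2) = 2 * pi * (\<Sum>k. (cmod (taylor_coeff F k))\<^sup>2 * r ^ (2 * k))"
    by (auto simp: sums_iff)
qed

text \<open>The mean square over each circle is at most \<open>B\<^sup>2\<close>; the radius tends
  to 1 in finite partial sums, where this is mere continuity.\<close>

lemma bounded_holomorphic_coeff_square_summable:
  assumes F: "F holomorphic_on ball 0 1" and B: "\<And>z. cmod z < 1 \<Longrightarrow> cmod (F z) \<le> B"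
  shows "summable (\<lambda>k. (cmod (taylor_coeff F k))\<^sup>2)"
proof -
  have circ: "(\<Sum>k. (cmod (taylor_coeff F k))\<^sup>2 * r ^ (2 * k)) \<le> B\<^sup>2" if r: "0 < r" "r < 1" for r
  proof -
    have cont: "continuous_on {0..2 * pi} (\<lambda>\<theta>. F (of_real r * cis \<theta>))"
      by (rule continuous_on_compose2[OF holomorphic_on_imp_continuous_on[OF F]])
         (use r in \<open>auto intro!: continuous_intros simp: norm_mult\<close>)
    have "2 * pi * (\<Sum>k. (cmod (taylor_coeff F k))\<^sup>2 * r ^ (2 * k)) = integral {0..2 * pi} (\<lambda>\<theta>. (cmod (F (of_real r * cis \<theta>)))\<^sup>2)"
      using integral_circle_square(2)[OF F r] by simp
    also have "\<dots> \<le> integral {0..2 * pi} (\<lambda>\<theta>. B\<^sup>2)"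
      using r by (intro integral_le integrable_continuous_real continuous_intros cont power_mono B)
        (auto simp: norm_mult)
    finally show ?thesis by simp
  qed
  have "(\<Sum>k<K. (cmod (taylor_coeff F k))\<^sup>2) \<le> B\<^sup>2" for K
  proof (rule tendsto_upperbound)
    show "((\<lambda>r. \<Sum>k<K. (cmod (taylor_coeff F k))\<^sup>2 * r ^ (2 * k)) \<longlongrightarrow> (\<Sum>k<K. (cmod (taylor_coeff F k))\<^sup>2)) (at_left 1)"
      by (rule tendsto_eq_rhs[OF tendsto_sum[OF tendsto_mult[OF tendsto_const tendsto_power[OF tendsto_ident_at]]]]) simp
    have "eventually (\<lambda>r. r \<in> {0<..<1}) (at_left (1::real))"
      by (rule eventually_at_leftI[of 0]) auto
    then show "\<forall>\<^sub>F r in at_left 1. (\<Sum>k<K. (cmod (taylor_coeff F k))\<^sup>2 * r ^ (2 * k)) \<le> B\<^sup>2"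
    proof eventually_elim
      case (elim r)
      then have "(\<Sum>k<K. (cmod (taylor_coeff F k))\<^sup>2 * r ^ (2 * k)) \<le> (\<Sum>k. (cmod (taylor_coeff F k))\<^sup>2 * r ^ (2 * k))"
        by (intro sum_le_suminf integral_circle_square(1)[OF F]) auto
      then show ?case using circ[of r] elim by auto
    qed
  qed simp
  then show ?thesis by (intro summableI_nonneg_bounded[where x = "B\<^sup>2"]) auto
qed

text \<open>Boundary values are assumed off the points 1 and -1 only, where the logarithm in the
  symbol will be singular; hence the two open arcs. Dominated convergence handles the integrals and
  Tannery's theorem the series.\<close>

lemma bounded_holomorphic_Parseval:
  assumes F: "F holomorphic_on ball 0 1" and B: "\<And>z. cmod z < 1 \<Longrightarrow> cmod (F z) \<le> B"
    and lim: "\<And>\<theta>. \<theta> \<in> {0<..<pi} \<union> {pi<..<2 * pi} \<Longrightarrow> ((\<lambda>r. F (of_real r * cis \<theta>)) \<longlongrightarrow> Fb \<theta>) (at_left 1)"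
  shows "(\<lambda>\<theta>. (cmod (Fb \<theta>))\<^sup>2) integrable_on {0<..<pi}" "(\<lambda>\<theta>. (cmod (Fb \<theta>))\<^sup>2) integrable_on {pi<..<2 * pi}"
    "2 * pi * (\<Sum>k. (cmod (taylor_coeff F k))\<^sup>2) =
      integral {0<..<pi} (\<lambda>\<theta>. (cmod (Fb \<theta>))\<^sup>2) + integral {pi<..<2 * pi} (\<lambda>\<theta>. (cmod (Fb \<theta>))\<^sup>2)"
proof -
  \<comment> \<open>Adding 2 rather than 1 keeps the first radius positive.\<close>
  define r where "r n = 1 - 1 / (real n + 2)" for n :: nat
  have r: "0 < r n" "r n < 1" for n by (auto simp: r_def field_simps)
  have r_lim: "filterlim r (at_left 1) sequentially"
    unfolding filterlim_at_left_to_right r_def by real_asymp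
  define f where "f n \<theta> = (cmod (F (of_real (r n) * cis \<theta>)))\<^sup>2" for n \<theta>
  have cont: "continuous_on X (f n)" for X n
    unfolding f_def
    by (intro continuous_intros continuous_on_compose2[OF holomorphic_on_imp_continuous_on[OF F]])
       (use r in \<open>auto simp: norm_mult less_imp_le abs_of_nonneg\<close>)
  have f_int: "f n integrable_on {a<..<b}" for n a b
    using integrable_continuous_real[OF cont] by (simp add: integrable_on_Icc_iff_Ioo)
  have f_bound: "norm (f n \<theta>) \<le> B\<^sup>2" for n \<theta>
    unfolding f_def using r[of n] B[of "of_real (r n) * cis \<theta>"]
    by (auto simp: norm_mult less_imp_le intro!: power_mono)
  have f_lim: "(\<lambda>n. f n \<theta>) \<longlonglongrightarrow> (cmod (Fb \<theta>))\<^sup>2" if "\<theta> \<in> {0<..<pi} \<union> {pi<..<2 * pi}" for \<theta>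
    unfolding f_def by (intro tendsto_intros filterlim_compose[OF lim[OF that] r_lim])
  have c_int: "(\<lambda>\<theta>. B\<^sup>2) integrable_on {a<..<b}" for a b :: real
    unfolding integrable_on_Icc_iff_Ioo[symmetric] by (intro integrable_continuous_real continuous_on_const)
  note dc1 = dominated_convergence[of f "{0<..<pi}" "\<lambda>\<theta>. B\<^sup>2" "\<lambda>\<theta>. (cmod (Fb \<theta>))\<^sup>2", OF f_int c_int f_bound f_lim]
  note dc2 = dominated_convergence[of f "{pi<..<2 * pi}" "\<lambda>\<theta>. B\<^sup>2" "\<lambda>\<theta>. (cmod (Fb \<theta>))\<^sup>2", OF f_int c_int f_bound f_lim]
  show "(\<lambda>\<theta>. (cmod (Fb \<theta>))\<^sup>2) integrable_on {0<..<pi}" by (rule dc1(1)) auto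
  show "(\<lambda>\<theta>. (cmod (Fb \<theta>))\<^sup>2) integrable_on {pi<..<2 * pi}" by (rule dc2(1)) auto
  have "(\<lambda>n. integral {0<..<pi} (f n) + integral {pi<..<2 * pi} (f n)) \<longlonglongrightarrow>
      integral {0<..<pi} (\<lambda>\<theta>. (cmod (Fb \<theta>))\<^sup>2) + integral {pi<..<2 * pi} (\<lambda>\<theta>. (cmod (Fb \<theta>))\<^sup>2)"
    by (intro tendsto_add dc1(2) dc2(2)) auto
  also have "(\<lambda>n. integral {0<..<pi} (f n) + integral {pi<..<2 * pi} (f n)) =
      (\<lambda>n. 2 * pi * (\<Sum>k. (cmod (taylor_coeff F k))\<^sup>2 * r n ^ (2 * k)))"
  proof
    fix n
    have "integral {0<..<pi} (f n) + integral {pi<..<2 * pi} (f n) = integral {0..2 * pi} (f n)"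
      unfolding integral_open_interval_real[symmetric]
      by (intro Henstock_Kurzweil_Integration.integral_combine integrable_continuous_real cont) auto
    then show "integral {0<..<pi} (f n) + integral {pi<..<2 * pi} (f n) =
      2 * pi * (\<Sum>k. (cmod (taylor_coeff F k))\<^sup>2 * r n ^ (2 * k))"
      using integral_circle_square(2)[OF F r, of n] by (simp add: f_def[abs_def])
  qed
  finally have lim1: "(\<lambda>n. 2 * pi * (\<Sum>k. (cmod (taylor_coeff F k))\<^sup>2 * r n ^ (2 * k))) \<longlonglongrightarrow>
      integral {0<..<pi} (\<lambda>\<theta>. (cmod (Fb \<theta>))\<^sup>2) + integral {pi<..<2 * pi} (\<lambda>\<theta>. (cmod (Fb \<theta>))\<^sup>2)" .
  note S = bounded_holomorphic_coeff_square_summable[OF F B]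
  have "(\<lambda>n. \<Sum>k. (cmod (taylor_coeff F k))\<^sup>2 * r n ^ (2 * k)) \<longlonglongrightarrow> (\<Sum>k. (cmod (taylor_coeff F k))\<^sup>2 * 1)"
  proof (rule tannerys_theorem[THEN conjunct2, THEN conjunct2])
    show "summable (\<lambda>k. (cmod (taylor_coeff F k))\<^sup>2)" by (rule S)
    show "((\<lambda>n. (cmod (taylor_coeff F k))\<^sup>2 * r n ^ (2 * k)) \<longlonglongrightarrow> (cmod (taylor_coeff F k))\<^sup>2 * 1)" for k
    proof -
      have "r \<longlonglongrightarrow> 1" using r_lim by (simp add: filterlim_at)
      from tendsto_power[OF this, of "2 * k"] show ?thesis by (intro tendsto_mult) auto
    qed
    show "\<forall>\<^sub>F (k, n) in at_top \<times>\<^sub>F sequentially. norm ((cmod (taylor_coeff F k))\<^sup>2 * r n ^ (2 * k)) \<le> (cmod (taylor_coeff F k))\<^sup>2"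
      using r by (auto intro!: always_eventually mult_left_le power_le_one simp: abs_mult less_imp_le)
  qed simp
  from LIMSEQ_unique[OF lim1 tendsto_mult[OF tendsto_const this]]
  show "2 * pi * (\<Sum>k. (cmod (taylor_coeff F k))\<^sup>2) =
      integral {0<..<pi} (\<lambda>\<theta>. (cmod (Fb \<theta>))\<^sup>2) + integral {pi<..<2 * pi} (\<lambda>\<theta>. (cmod (Fb \<theta>))\<^sup>2)"
    by simp
qed

section \<open>Almost orthogonality of oscillating exponentials\<close>

text \<open>Serves integrands that oscillate without a limit at the end points of the arc.\<close>

lemma bounded_continuous_integrable_Ioo:
  fixes f :: "real \<Rightarrow> 'a::euclidean_space"
  assumes "continuous_on {a<..<b} f" "\<And>x. x \<in> {a<..<b} \<Longrightarrow> norm (f x) \<le> B"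
  shows "f integrable_on {a<..<b}"
proof (rule measurable_bounded_by_integrable_imp_integrable)
  show "f \<in> borel_measurable (lebesgue_on {a<..<b})"
    using assms(1) by (intro continuous_imp_measurable_on_sets_lebesgue) auto
  show "(\<lambda>_. B) integrable_on {a<..<b}"
    unfolding integrable_on_Icc_iff_Ioo[symmetric] by (intro integrable_continuous_real continuous_on_const)
qed (use assms in auto)

text \<open>The factor \<open>sin \<theta>\<close> kills the boundary terms; it is also, up to a constant, the reciprocal of
  the derivative of the phase \<open>ln (cot (\<theta>/2)) / 2\<close> below.\<close>

lemma has_integral_sin_mult_derivative:
  fixes H :: "real \<Rightarrow> 'a::euclidean_space"
  assumes deriv: "\<And>\<theta>. \<theta> \<in> {0<..<pi} \<Longrightarrow> (H has_vector_derivative H' \<theta>) (at \<theta>)"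
    and bound: "\<And>\<theta>. \<theta> \<in> {0<..<pi} \<Longrightarrow> norm (H \<theta>) \<le> B"
  shows "((\<lambda>\<theta>. sin \<theta> *\<^sub>R H' \<theta> + cos \<theta> *\<^sub>R H \<theta>) has_integral 0) {0<..<pi}"
proof -
  have "((\<lambda>\<theta>. sin \<theta> *\<^sub>R H' \<theta> + cos \<theta> *\<^sub>R H \<theta>) has_integral sin pi *\<^sub>R H pi - sin 0 *\<^sub>R H 0) {0..pi}"
  proof (rule fundamental_theorem_of_calculus_interior)
    fix \<theta> assume "\<theta> \<in> {0<..<pi}"
    then show "((\<lambda>\<theta>. sin \<theta> *\<^sub>R H \<theta>) has_vector_derivative sin \<theta> *\<^sub>R H' \<theta> + cos \<theta> *\<^sub>R H \<theta>) (at \<theta>)"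
      by (intro has_vector_derivative_scaleR deriv DERIV_sin)
  next
    have endpoint: "continuous (at x within {0..pi}) (\<lambda>\<theta>. sin \<theta> *\<^sub>R H \<theta>)" if "x = 0 \<or> x = pi" for x
    proof -
      have sx: "sin x = 0" using that by auto
      have "((\<lambda>\<theta>. sin \<theta> *\<^sub>R H \<theta>) \<longlongrightarrow> 0) (at x within {0..pi})"
      proof (rule Lim_null_comparison)
        have "((\<lambda>\<theta>. \<bar>sin \<theta>\<bar> * B) \<longlongrightarrow> \<bar>sin x\<bar> * B) (at x within {0..pi})"
          by (intro tendsto_intros)
        then show "((\<lambda>\<theta>. \<bar>sin \<theta>\<bar> * B) \<longlongrightarrow> 0) (at x within {0..pi})" using sx by simp
        have "norm (sin \<theta> *\<^sub>R H \<theta>) \<le> \<bar>sin \<theta>\<bar> * B" if "\<theta> \<in> {0..pi}" for \<theta>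
        proof (cases "\<theta> \<in> {0<..<pi}")
          case True
          then show ?thesis by (simp add: mult_left_mono[OF bound])
        next
          case False
          then have "\<theta> = 0 \<or> \<theta> = pi" using that by auto
          then show ?thesis by auto
        qed
        then show "\<forall>\<^sub>F \<theta> in at x within {0..pi}. norm (sin \<theta> *\<^sub>R H \<theta>) \<le> \<bar>sin \<theta>\<bar> * B"
          by (auto simp: eventually_at_filter)
      qed
      then show ?thesis by (simp add: continuous_within sx)
    qed
    have inner: "continuous (at x within {0..pi}) (\<lambda>\<theta>. sin \<theta> *\<^sub>R H \<theta>)" if "x \<in> {0<..<pi}" for x
    proof -
      have "isCont H x" using deriv[OF that] by (rule has_vector_derivative_continuous)
      then have "isCont (\<lambda>\<theta>. sin \<theta> *\<^sub>R H \<theta>) x" by (intro continuous_intros) auto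
      then show ?thesis by (rule continuous_at_imp_continuous_at_within)
    qed
    show "continuous_on {0..pi} (\<lambda>\<theta>. sin \<theta> *\<^sub>R H \<theta>)"
      unfolding continuous_on_eq_continuous_within
    proof
      fix x assume "x \<in> {0..pi}"
      then show "continuous (at x within {0..pi}) (\<lambda>\<theta>. sin \<theta> *\<^sub>R H \<theta>)"
        using endpoint[of x] inner[of x] by (cases "x = 0 \<or> x = pi") auto
    qed
  qed simp
  then show ?thesis by (simp add: has_integral_Icc_iff_Ioo)
qed

lemma sum_inverse_squares_le: "(\<Sum>k=1..K. 1 / (real k)\<^sup>2) \<le> 2"
proof (cases "K = 0")
  case False
  \<comment> \<open>The induction needs the remainder \<open>1 / K\<close>, which makes the bound
    telescope.\<close>
  have "(\<Sum>k=1..K. 1 / (real k)\<^sup>2) \<le> 2 - 1 / real K" if "K \<ge> 1"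
    using that
  proof (induction K rule: nat_induct_at_least)
    case (Suc K)
    have "1 / (real (Suc K))\<^sup>2 \<le> 1 / (real K * real (Suc K))"
      using Suc.hyps by (intro divide_left_mono) (auto simp: power2_eq_square)
    also have "\<dots> = 1 / real K - 1 / real (Suc K)"
      using Suc.hyps by (simp add: field_simps)
    finally show ?case using Suc.IH by simp
  qed simp
  then show ?thesis using False by (smt (verit) One_nat_def Suc_leI divide_nonneg_nonneg neq0_conv of_nat_0_le_iff)
qed simp

text \<open>A row sum for Schur's test: \<open>n - m\<close> runs through nonzero integers, each at
  most once, and either sign contributes at most 2.\<close>

lemma sum_inverse_square_differences_le:
  assumes "n < N"
  shows "(\<Sum>m\<in>{..<N} - {n}. 1 / (real n - real m)\<^sup>2) \<le> 4"
proof -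
  have "{..<N} - {n} = {..<n} \<union> {n<..<N}" "{..<n} \<inter> {n<..<N} = {}" using assms by auto
  then have "(\<Sum>m\<in>{..<N} - {n}. 1 / (real n - real m)\<^sup>2)
      = (\<Sum>m<n. 1 / (real n - real m)\<^sup>2) + (\<Sum>m\<in>{n<..<N}. 1 / (real n - real m)\<^sup>2)"
    by (simp add: sum.union_disjoint)
  also have "(\<Sum>m<n. 1 / (real n - real m)\<^sup>2) = (\<Sum>k=1..n. 1 / (real k)\<^sup>2)"
    by (rule sum.reindex_bij_witness[where i = "\<lambda>k. n - k" and j = "\<lambda>m. n - m"]) (auto simp: of_nat_diff)
  also have "(\<Sum>m\<in>{n<..<N}. 1 / (real n - real m)\<^sup>2) = (\<Sum>k=1..N - n - 1. 1 / (real k)\<^sup>2)"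
    by (rule sum.reindex_bij_witness[where i = "\<lambda>k. n + k" and j = "\<lambda>m. m - n"])
       (auto simp: of_nat_diff power2_commute)
  finally show ?thesis using sum_inverse_squares_le[of n] sum_inverse_squares_le[of "N - n - 1"] by linarith
qed

section \<open>The boundary phase and its oscillating integrals\<close>

definition log_cot :: "real \<Rightarrow> real" where "log_cot \<theta> = ln (cot (\<theta> / 2)) / 2"

lemma cot_half_pos: "\<theta> \<in> {0<..<pi} \<Longrightarrow> cot (\<theta> / 2) > 0"
  by (auto simp: cot_def intro!: divide_pos_pos sin_gt_zero cos_gt_zero_pi)

lemma log_cot_deriv:
  assumes "\<theta> \<in> {0<..<pi}"
  shows "(log_cot has_real_derivative - 1 / (2 * sin \<theta>)) (at \<theta>)"
proof -
  have s: "sin (\<theta> / 2) > 0" "cos (\<theta> / 2) > 0"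
    using assms by (auto intro!: sin_gt_zero cos_gt_zero_pi)
  have "sin \<theta> = 2 * sin (\<theta> / 2) * cos (\<theta> / 2)" using sin_double[of "\<theta> / 2"] by simp
  moreover have "((\<lambda>\<theta>. cot (\<theta> / 2)) has_real_derivative - inverse ((sin (\<theta> / 2))\<^sup>2) * (1 / 2)) (at \<theta>)"
    using s by (intro DERIV_chain2[OF DERIV_cot]) (auto intro!: derivative_eq_intros)
  then have "((\<lambda>\<theta>. ln (cot (\<theta> / 2)) / 2) has_real_derivative
      1 / cot (\<theta> / 2) * (- inverse ((sin (\<theta> / 2))\<^sup>2) * (1 / 2)) / 2) (at \<theta>)"
    using cot_half_pos[OF assms] by (auto intro!: derivative_eq_intros)
  ultimately show ?thesis
    using s unfolding log_cot_def by (simp add: cot_def field_simps power2_eq_square)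
qed

text \<open>Bounding \<open>P'\<close> by a multiple of \<open>P\<close> lets the second integration
  by parts be estimated through the first moment. \<open>B\<close> serves integrability and the
  boundary terms, while the estimates themselves involve \<open>C\<close> alone. The condition on
  \<open>R\<close> is what gives \<open>J_bound\<close> its factor 1/8.\<close>

locale phase =
  fixes q P P' :: "real \<Rightarrow> real" and C R B :: real
  assumes q_deriv: "\<And>y. (q has_real_derivative - P y) (at y)"
    and P_deriv: "\<And>y. (P has_real_derivative P' y) (at y)"
    and P'_cont: "continuous_on UNIV P'"
    and q_nonneg: "\<And>y. q y \<ge> 0" and P_nonneg: "\<And>y. P y \<ge> 0" and P_bound: "\<And>y. P y \<le> B"
    and P'_bound: "\<And>y. \<bar>P' y\<bar> \<le> C * P y"
    and R: "R > 0" "R\<^sup>2 \<ge> 32 * (C + 5)" and C: "C \<ge> 0"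
begin

definition E :: "nat \<Rightarrow> real \<Rightarrow> real" where "E N \<theta> = exp (- real N * q (log_cot \<theta>))"

definition e :: "real \<Rightarrow> real \<Rightarrow> complex" where "e k \<theta> = cis (- k * R * log_cot \<theta>)"

definition I :: "nat \<Rightarrow> real" where "I N = integral {0<..<pi} (E N)"

text \<open>Entries of a Gram matrix: the inner product of the powers \<open>n\<close> and
  \<open>m\<close> of the symbol over the upper semicircle is \<open>J (n + m) (n - m)\<close>.
  Moduli add their exponents while phases subtract theirs, whence two separate arguments and a real
  \<open>k\<close>.\<close>

definition J :: "nat \<Rightarrow> real \<Rightarrow> complex" where
  "J N k = integral {0<..<pi} (\<lambda>\<theta>. of_real (E N \<theta>) * e k \<theta>)"

lemma E_pos: "E N \<theta> > 0" and E_le_1: "E N \<theta> \<le> 1"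
  using q_nonneg[of "log_cot \<theta>"] by (auto simp: E_def)

lemma E_add: "E (m + n) \<theta> = E m \<theta> * E n \<theta>"
  by (simp add: E_def ring_distribs exp_add[symmetric])

lemma e_norm [simp]: "cmod (e k \<theta>) = 1"
  by (simp add: e_def)

lemma log_cot_cont: "continuous_on {0<..<pi} log_cot"
  using DERIV_continuous[OF log_cot_deriv] by (auto simp: continuous_on_eq_continuous_at)

lemma comp_log_cot_cont: "continuous_on UNIV f \<Longrightarrow> continuous_on {0<..<pi} (\<lambda>\<theta>. f (log_cot \<theta>))"
  by (rule continuous_on_compose2[OF _ log_cot_cont]) auto

lemma q_cont: "continuous_on UNIV q" and P_cont: "continuous_on UNIV P"
  using DERIV_continuous[OF q_deriv] DERIV_continuous[OF P_deriv]
  by (auto simp: continuous_on_eq_continuous_at)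

lemma E_cont: "continuous_on {0<..<pi} (E N)"
  unfolding E_def by (intro continuous_intros comp_log_cot_cont q_cont)

lemma e_cont: "continuous_on {0<..<pi} (e k)"
  unfolding e_def by (intro continuous_intros log_cot_cont)

lemmas conts = E_cont e_cont comp_log_cot_cont[OF P_cont] comp_log_cot_cont[OF P'_cont]

lemma P_abs: "\<bar>P y\<bar> \<le> B" "\<bar>P' y\<bar> \<le> C * B"
  using P_bound[of y] P_nonneg[of y] P'_bound[of y] C mult_left_mono[OF P_bound[of y] C] by auto

lemma B_nonneg: "B \<ge> 0"
  using P_bound[of 0] P_nonneg[of 0] by linarith

lemma E_integrable: "E N integrable_on {0<..<pi}"
  by (rule bounded_continuous_integrable_Ioo[where B = 1, OF E_cont]) (use E_pos E_le_1 in \<open>auto simp: less_imp_le\<close>)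

lemma weighted_integrable:
  fixes f :: "real \<Rightarrow> 'a::euclidean_space"
  assumes "continuous_on {0<..<pi} f" "\<And>\<theta>. norm (f \<theta>) \<le> K"
  shows "(\<lambda>\<theta>. E N \<theta> *\<^sub>R f \<theta>) integrable_on {0<..<pi}"
proof (rule bounded_continuous_integrable_Ioo)
  show "continuous_on {0<..<pi} (\<lambda>\<theta>. E N \<theta> *\<^sub>R f \<theta>)" by (intro continuous_intros E_cont assms)
  show "norm (E N \<theta> *\<^sub>R f \<theta>) \<le> 1 * K" if "\<theta> \<in> {0<..<pi}" for \<theta>
    using E_pos[of N \<theta>] E_le_1[of N \<theta>] assms(2)[of \<theta>] unfolding norm_scaleR
    by (intro mult_mono) (auto simp: less_imp_le)
qed

lemma E_deriv:
  assumes "\<theta> \<in> {0<..<pi}"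
  shows "(E N has_real_derivative - (real N * P (log_cot \<theta>) / (2 * sin \<theta>)) * E N \<theta>) (at \<theta>)"
proof -
  have "((\<lambda>\<theta>. q (log_cot \<theta>)) has_real_derivative - P (log_cot \<theta>) * (- 1 / (2 * sin \<theta>))) (at \<theta>)"
    by (rule DERIV_chain2[OF q_deriv log_cot_deriv[OF assms]])
  then have "((\<lambda>\<theta>. exp (- real N * q (log_cot \<theta>))) has_real_derivative
      exp (- real N * q (log_cot \<theta>)) * (- real N * (- P (log_cot \<theta>) * (- 1 / (2 * sin \<theta>))))) (at \<theta>)"
    by (auto intro!: derivative_eq_intros)
  then show ?thesis unfolding E_def by (simp add: mult_ac)
qed

lemma e_deriv:
  assumes "\<theta> \<in> {0<..<pi}"
  shows "(e k has_vector_derivative (\<i> * of_real (k * R / (2 * sin \<theta>))) * e k \<theta>) (at \<theta>)"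
proof -
  have "((\<lambda>\<theta>. - k * R * log_cot \<theta>) has_real_derivative (- k * R * (- 1 / (2 * sin \<theta>)))) (at \<theta>)"
    by (intro DERIV_cmult log_cot_deriv assms)
  then have "((\<lambda>\<theta>. cis (- k * R * log_cot \<theta>)) has_derivative
      (\<lambda>t. (- k * R * (- 1 / (2 * sin \<theta>)) * t) *\<^sub>R (\<i> * cis (- k * R * log_cot \<theta>)))) (at \<theta>)"
    unfolding has_field_derivative_def by (rule has_derivative_cis)
  then show ?thesis
    unfolding has_vector_derivative_def e_def
    by (rule has_derivative_eq_rhs) (auto simp: fun_eq_iff scaleR_conv_of_real)
qed

lemma comp_log_cot_deriv:
  assumes "\<And>y. (f has_real_derivative f' y) (at y)" "\<theta> \<in> {0<..<pi}"
  shows "((\<lambda>\<theta>. f (log_cot \<theta>)) has_real_derivative - f' (log_cot \<theta>) / (2 * sin \<theta>)) (at \<theta>)"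
  using DERIV_chain2[OF assms(1) log_cot_deriv[OF assms(2)]] by simp

text \<open>The integrand is the derivative of \<open>sin \<theta>\<close> times \<open>f\<close>,
  the weight and the oscillating factor. The sine cancels the \<open>1 / sin \<theta>\<close> in the
  derivative of \<open>log_cot\<close>, so neither weight nor phase contributes a singular
  coefficient.\<close>

lemma integral_weighted_by_parts:
  assumes f: "\<And>\<theta>. \<theta> \<in> {0<..<pi} \<Longrightarrow> (f has_real_derivative f' \<theta>) (at \<theta>)"
    and bound: "\<And>\<theta>. \<bar>f \<theta>\<bar> \<le> K"
  shows "((\<lambda>\<theta>. E N \<theta> *\<^sub>R (of_real (sin \<theta> * f' \<theta> + f \<theta> * (cos \<theta> - real N * P (log_cot \<theta>) / 2)) * e k \<theta>
      + \<i> * of_real (k * R / 2) * of_real (f \<theta>) * e k \<theta>)) has_integral 0) {0<..<pi}"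
proof -
  define H where "H \<theta> = (f \<theta> * E N \<theta>) *\<^sub>R e k \<theta>" for \<theta>
  define H' where "H' \<theta> = (f \<theta> * E N \<theta>) *\<^sub>R ((\<i> * of_real (k * R / (2 * sin \<theta>))) * e k \<theta>)
     + (f' \<theta> * E N \<theta> + (- (real N * P (log_cot \<theta>) / (2 * sin \<theta>)) * E N \<theta>) * f \<theta>) *\<^sub>R e k \<theta>" for \<theta>
  have "((\<lambda>\<theta>. sin \<theta> *\<^sub>R H' \<theta> + cos \<theta> *\<^sub>R H \<theta>) has_integral 0) {0<..<pi}"
  proof (rule has_integral_sin_mult_derivative)
    fix \<theta> assume \<theta>: "\<theta> \<in> {0<..<pi}"
    show "(H has_vector_derivative H' \<theta>) (at \<theta>)"
      unfolding H_def H'_def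
      by (intro has_vector_derivative_scaleR DERIV_mult f E_deriv e_deriv \<theta>)
    have "\<bar>f \<theta>\<bar> * E N \<theta> \<le> K * 1"
      using bound[of \<theta>] E_pos[of N \<theta>] E_le_1[of N \<theta>] by (intro mult_mono) auto
    then show "norm (H \<theta>) \<le> K" using E_pos[of N \<theta>] by (simp add: H_def abs_mult less_imp_le)
  qed
  moreover have "sin \<theta> *\<^sub>R H' \<theta> + cos \<theta> *\<^sub>R H \<theta> =
      E N \<theta> *\<^sub>R (of_real (sin \<theta> * f' \<theta> + f \<theta> * (cos \<theta> - real N * P (log_cot \<theta>) / 2)) * e k \<theta>
      + \<i> * of_real (k * R / 2) * of_real (f \<theta>) * e k \<theta>)" if "\<theta> \<in> {0<..<pi}" for \<theta>
  proof -
    have "sin \<theta> > 0" using that by (auto intro: sin_gt_zero)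
    then show ?thesis
      by (simp add: H_def H'_def scaleR_conv_of_real field_simps)
  qed
  ultimately show ?thesis by (rule has_integral_eq[rotated])
qed

text \<open>The real part for \<open>k = 0\<close>, where nothing oscillates.\<close>

lemma integral_weighted_by_parts_real:
  assumes f: "\<And>\<theta>. \<theta> \<in> {0<..<pi} \<Longrightarrow> (f has_real_derivative f' \<theta>) (at \<theta>)"
    and bound: "\<And>\<theta>. \<bar>f \<theta>\<bar> \<le> K"
  shows "((\<lambda>\<theta>. E N \<theta> * (sin \<theta> * f' \<theta> + f \<theta> * (cos \<theta> - real N * P (log_cot \<theta>) / 2))) has_integral 0) {0<..<pi}"
proof -
  have "((\<lambda>\<theta>. Re (E N \<theta> *\<^sub>R (of_real (sin \<theta> * f' \<theta> + f \<theta> * (cos \<theta> - real N * P (log_cot \<theta>) / 2)) * e 0 \<theta>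
      + \<i> * of_real (0 * R / 2) * of_real (f \<theta>) * e 0 \<theta>))) has_integral Re 0) {0<..<pi}"
    using integral_weighted_by_parts[OF assms, of N 0] by (rule has_integral_Re)
  then show ?thesis by (simp add: e_def)
qed

lemma E_P_integrable: "(\<lambda>\<theta>. E N \<theta> * P (log_cot \<theta>)) integrable_on {0<..<pi}"
  and E_P_square_integrable: "(\<lambda>\<theta>. E N \<theta> * (P (log_cot \<theta>))\<^sup>2) integrable_on {0<..<pi}"
  and E_cos_integrable: "(\<lambda>\<theta>. E N \<theta> * cos \<theta>) integrable_on {0<..<pi}"
  using weighted_integrable[of "\<lambda>\<theta>. P (log_cot \<theta>)" B N] weighted_integrable[of "\<lambda>\<theta>. (P (log_cot \<theta>))\<^sup>2" "B\<^sup>2" N]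
    weighted_integrable[of cos 1 N] P_abs
    continuous_on_power[OF comp_log_cot_cont[OF P_cont], of 2] power_mono[OF P_bound P_nonneg, of _ 2]
    continuous_on_cos[OF continuous_on_id, of "{0<..<pi}"]
  by (auto simp: comp_log_cot_cont[OF P_cont])

text \<open>The moment estimates integrate \<open>N P exp (- N q)\<close> by parts, as it is the derivative of
  \<open>exp (- N q)\<close>; this makes them uniform in \<open>N\<close>.\<close>

lemma first_moment: "real N * integral {0<..<pi} (\<lambda>\<theta>. E N \<theta> * P (log_cot \<theta>)) \<le> 2 * I N"
proof -
  have "((\<lambda>\<theta>. E N \<theta> * (sin \<theta> * 0 + 1 * (cos \<theta> - real N * P (log_cot \<theta>) / 2))) has_integral 0) {0<..<pi}"
    by (rule integral_weighted_by_parts_real[where K = 1]) auto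
  then have "integral {0<..<pi} (\<lambda>\<theta>. E N \<theta> * cos \<theta> - real N / 2 * (E N \<theta> * P (log_cot \<theta>))) = 0"
    by (intro integral_unique) (simp add: algebra_simps)
  then have "integral {0<..<pi} (\<lambda>\<theta>. E N \<theta> * cos \<theta>) - real N / 2 * integral {0<..<pi} (\<lambda>\<theta>. E N \<theta> * P (log_cot \<theta>)) = 0"
    by (subst (asm) Henstock_Kurzweil_Integration.integral_diff)
       (auto intro!: E_cos_integrable integrable_on_mult_right E_P_integrable)
  moreover have "integral {0<..<pi} (\<lambda>\<theta>. E N \<theta> * cos \<theta>) \<le> I N"
    unfolding I_def using E_pos by (intro integral_le E_cos_integrable E_integrable) (auto simp: mult_le_cancel_left1 not_less less_imp_le)
  ultimately show ?thesis by simp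
qed

lemma second_moment: "(real N)\<^sup>2 * integral {0<..<pi} (\<lambda>\<theta>. E N \<theta> * (P (log_cot \<theta>))\<^sup>2) \<le> 2 * (C + 2) * I N"
proof -
  define f' where "f' \<theta> = - P' (log_cot \<theta>) / (2 * sin \<theta>)" for \<theta>
  have "((\<lambda>\<theta>. E N \<theta> * (sin \<theta> * f' \<theta> + P (log_cot \<theta>) * (cos \<theta> - real N * P (log_cot \<theta>) / 2))) has_integral 0) {0<..<pi}"
    by (rule integral_weighted_by_parts_real[where K = B])
       (auto simp only: f'_def P_abs intro!: comp_log_cot_deriv P_deriv)
  moreover have "E N \<theta> * (sin \<theta> * f' \<theta> + P (log_cot \<theta>) * (cos \<theta> - real N * P (log_cot \<theta>) / 2))
      \<le> (C / 2 + 1) * (E N \<theta> * P (log_cot \<theta>)) - real N / 2 * (E N \<theta> * (P (log_cot \<theta>))\<^sup>2)"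
    if "\<theta> \<in> {0<..<pi}" for \<theta>
  proof -
    have "sin \<theta> > 0" using that by (auto intro: sin_gt_zero)
    then have "sin \<theta> * f' \<theta> = - P' (log_cot \<theta>) / 2" by (simp add: f'_def)
    \<comment> \<open>Here \<open>P'\<close> is traded for \<open>P\<close>, which reduces the
      second moment to the first.\<close>
    also have "\<dots> \<le> C / 2 * P (log_cot \<theta>)" using P'_bound[of "log_cot \<theta>"] by simp
    finally have "sin \<theta> * f' \<theta> + P (log_cot \<theta>) * (cos \<theta> - real N * P (log_cot \<theta>) / 2)
      \<le> C / 2 * P (log_cot \<theta>) + P (log_cot \<theta>) * (1 - real N * P (log_cot \<theta>) / 2)"
      using P_nonneg by (intro add_mono mult_left_mono) auto
    from mult_left_mono[OF this less_imp_le[OF E_pos[of N \<theta>]]] show ?thesis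
      by (simp add: algebra_simps power2_eq_square)
  qed
  ultimately have "0 \<le> integral {0<..<pi} (\<lambda>\<theta>. (C / 2 + 1) * (E N \<theta> * P (log_cot \<theta>)) - real N / 2 * (E N \<theta> * (P (log_cot \<theta>))\<^sup>2))"
    by (intro has_integral_le[OF _ integrable_integral])
       (auto intro!: integrable_diff integrable_on_mult_right E_P_integrable E_P_square_integrable)
  also have "\<dots> = (C / 2 + 1) * integral {0<..<pi} (\<lambda>\<theta>. E N \<theta> * P (log_cot \<theta>)) - real N / 2 * integral {0<..<pi} (\<lambda>\<theta>. E N \<theta> * (P (log_cot \<theta>))\<^sup>2)"
    by (subst Henstock_Kurzweil_Integration.integral_diff)
       (auto intro!: integrable_on_mult_right E_P_integrable E_P_square_integrable)
  finally have "real N * integral {0<..<pi} (\<lambda>\<theta>. E N \<theta> * (P (log_cot \<theta>))\<^sup>2) \<le> (C + 2) * integral {0<..<pi} (\<lambda>\<theta>. E N \<theta> * P (log_cot \<theta>))"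
    by (simp add: field_simps)
  from mult_left_mono[OF this, of "real N"]
  have "(real N)\<^sup>2 * integral {0<..<pi} (\<lambda>\<theta>. E N \<theta> * (P (log_cot \<theta>))\<^sup>2) \<le> (C + 2) * (real N * integral {0<..<pi} (\<lambda>\<theta>. E N \<theta> * P (log_cot \<theta>)))"
    by (simp add: power2_eq_square mult_ac)
  also have "\<dots> \<le> (C + 2) * (2 * I N)" using C by (intro mult_left_mono first_moment) auto
  finally show ?thesis by (simp only: mult_ac)
qed

text \<open>Each of two integrations by parts gains a factor of order \<open>1 / (k R)\<close>. The
  remaining integrand is quadratic in \<open>N P\<close>, and the moment estimates bound its
  integral by \<open>(C + 5) I N\<close>, uniformly in \<open>N\<close>. A single integration would
  give decay like \<open>1 / \<bar>k\<bar>\<close>, whose row sums are not bounded.\<close>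

lemma J_bound:
  assumes k: "k \<noteq> 0"
  shows "cmod (J N k) \<le> 1 / (8 * k\<^sup>2) * I N"
proof -
  define b where "b \<theta> = real N * P (log_cot \<theta>) / 2 - cos \<theta>" for \<theta>
  define b' where "b' \<theta> = - real N * P' (log_cot \<theta>) / (4 * sin \<theta>) + sin \<theta>" for \<theta>
  \<comment> \<open>Set to 0 off the interval, so that the bound required for integrability holds
    for every real \<open>\<theta>\<close>.\<close>
  define M where "M \<theta> = (if \<theta> \<in> {0<..<pi} then sin \<theta> * b' \<theta> - (b \<theta>)\<^sup>2 else 0)" for \<theta>
  define c where "c = \<i> * of_real (k * R / 2)"
  have c0: "cmod c = \<bar>k\<bar> * R / 2" using R by (simp add: c_def norm_mult)
  define K where "K = integral {0<..<pi} (\<lambda>\<theta>. E N \<theta> *\<^sub>R (of_real (b \<theta>) * e k \<theta>))"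
  have M_eq: "M \<theta> = (sin \<theta>)\<^sup>2 - real N * P' (log_cot \<theta>) / 4 - (b \<theta>)\<^sup>2" if "\<theta> \<in> {0<..<pi}" for \<theta>
  proof -
    have "sin \<theta> > 0" using that by (auto intro: sin_gt_zero)
    then show ?thesis using that by (simp add: M_def b'_def field_simps power2_eq_square)
  qed
  have b_cont: "continuous_on {0<..<pi} b" unfolding b_def by (intro continuous_intros conts) simp
  have b_bound: "\<bar>b \<theta>\<bar> \<le> real N * B / 2 + 1" for \<theta>
  proof -
    have "\<bar>b \<theta>\<bar> \<le> real N * \<bar>P (log_cot \<theta>)\<bar> / 2 + \<bar>cos \<theta>\<bar>" unfolding b_def
      by (rule order_trans[OF abs_triangle_ineq4]) (simp add: abs_mult)
    also have "\<dots> \<le> real N * B / 2 + 1"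
      by (intro add_mono divide_right_mono mult_left_mono P_abs) auto
    finally show ?thesis .
  qed
  have M_bound: "\<bar>M \<theta>\<bar> \<le> 1 / 4 * ((real N)\<^sup>2 * (P (log_cot \<theta>))\<^sup>2) + (C / 4 + 1) * (real N * P (log_cot \<theta>)) + 2"
    if \<theta>: "\<theta> \<in> {0<..<pi}" for \<theta>
  proof -
    have "\<bar>M \<theta>\<bar> \<le> (sin \<theta>)\<^sup>2 + real N * \<bar>P' (log_cot \<theta>)\<bar> / 4 + \<bar>b \<theta>\<bar>\<^sup>2"
    proof -
      have "\<bar>real N * P' (log_cot \<theta>)\<bar> = real N * \<bar>P' (log_cot \<theta>)\<bar>" by (simp add: abs_mult)
      then show ?thesis
        unfolding M_eq[OF \<theta>] power2_abs using zero_le_power2[of "sin \<theta>"] zero_le_power2[of "b \<theta>"] by linarith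
    qed
    also have "\<dots> \<le> 1 + real N * (C * P (log_cot \<theta>)) / 4 + (real N * P (log_cot \<theta>) / 2 + 1)\<^sup>2"
    proof (intro add_mono divide_right_mono mult_left_mono P'_bound power_mono)
      show "(sin \<theta>)\<^sup>2 \<le> 1" by (simp add: abs_square_le_1)
      show "\<bar>b \<theta>\<bar> \<le> real N * P (log_cot \<theta>) / 2 + 1"
        unfolding b_def using P_nonneg[of "log_cot \<theta>"] abs_cos_le_one[of \<theta>]
        by (intro order_trans[OF abs_triangle_ineq4]) (simp add: abs_mult)
    qed auto
    also have "\<dots> = 1 / 4 * ((real N)\<^sup>2 * (P (log_cot \<theta>))\<^sup>2) + (C / 4 + 1) * (real N * P (log_cot \<theta>)) + 2"
      by (simp add: power2_eq_square field_simps)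
    finally show ?thesis .
  qed
  have M_cont: "continuous_on {0<..<pi} M"
    by (rule continuous_on_eq[OF _ M_eq[symmetric]], intro continuous_on_diff continuous_on_power continuous_on_sin continuous_on_id continuous_on_divide
        continuous_on_mult continuous_on_const conts b_cont) simp_all
  define MB where "MB = 1 / 4 * ((real N)\<^sup>2 * B\<^sup>2) + (C / 4 + 1) * (real N * B) + 2"
  have M_MB: "\<bar>M \<theta>\<bar> \<le> MB" for \<theta>
  proof (cases "\<theta> \<in> {0<..<pi}")
    case True
    show ?thesis
      by (rule order_trans[OF M_bound[OF True]])
         (unfold MB_def, intro add_mono mult_left_mono power_mono P_bound P_nonneg, use C in auto)
  next
    case False
    then have "M \<theta> = 0" unfolding M_def by (rule if_not_P)
    then show ?thesis using C B_nonneg by (simp add: MB_def)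
  qed
  have e1: "(\<lambda>\<theta>. E N \<theta> *\<^sub>R e k \<theta>) integrable_on {0<..<pi}"
    by (rule weighted_integrable[where K = 1, OF e_cont]) auto
  have e2: "(\<lambda>\<theta>. E N \<theta> *\<^sub>R (of_real (b \<theta>) * e k \<theta>)) integrable_on {0<..<pi}"
    by (rule weighted_integrable[where K = "real N * B / 2 + 1"])
       (auto intro!: continuous_intros e_cont b_cont simp: norm_mult b_bound)
  have e3: "(\<lambda>\<theta>. E N \<theta> *\<^sub>R (of_real (M \<theta>) * e k \<theta>)) integrable_on {0<..<pi}"
    by (rule weighted_integrable[where K = MB])
       (auto intro!: continuous_intros e_cont M_cont simp: norm_mult M_MB)
  \<comment> \<open>First integration, with \<open>f = 1\<close>: \<open>c J\<close> becomes the
    integral against \<open>b\<close>.\<close>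
  have "((\<lambda>\<theta>. E N \<theta> *\<^sub>R (of_real (sin \<theta> * 0 + 1 * (cos \<theta> - real N * P (log_cot \<theta>) / 2)) * e k \<theta>
      + \<i> * of_real (k * R / 2) * of_real 1 * e k \<theta>)) has_integral 0) {0<..<pi}"
    by (rule integral_weighted_by_parts[where K = 1]) auto
  then have "((\<lambda>\<theta>. c * (E N \<theta> *\<^sub>R e k \<theta>) - E N \<theta> *\<^sub>R (of_real (b \<theta>) * e k \<theta>)) has_integral 0) {0<..<pi}"
    by (rule has_integral_eq[rotated]) (simp add: b_def c_def scaleR_conv_of_real algebra_simps)
  then have "integral {0<..<pi} (\<lambda>\<theta>. c * (E N \<theta> *\<^sub>R e k \<theta>) - E N \<theta> *\<^sub>R (of_real (b \<theta>) * e k \<theta>)) = 0"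
    by (rule integral_unique)
  then have JK: "c * J N k = K"
    unfolding K_def J_def
    using Henstock_Kurzweil_Integration.integral_diff[OF integrable_on_mult_right[OF e1, of c] e2]
    by (simp add: scaleR_conv_of_real)
  \<comment> \<open>Second integration, with \<open>f = b\<close>: now \<open>c\<^sup>2 J\<close> is
    minus the integral against \<open>M\<close>.\<close>
  have "((\<lambda>\<theta>. E N \<theta> *\<^sub>R (of_real (sin \<theta> * b' \<theta> + b \<theta> * (cos \<theta> - real N * P (log_cot \<theta>) / 2)) * e k \<theta>
      + \<i> * of_real (k * R / 2) * of_real (b \<theta>) * e k \<theta>)) has_integral 0) {0<..<pi}"
  proof (rule integral_weighted_by_parts[where K = "real N * B / 2 + 1"])
    fix \<theta> assume "\<theta> \<in> {0<..<pi}"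
    then show "(b has_real_derivative b' \<theta>) (at \<theta>)"
      unfolding b_def b'_def
      by (auto intro!: derivative_eq_intros comp_log_cot_deriv[OF P_deriv] simp: mult.commute)
  qed (rule b_bound)
  then have "((\<lambda>\<theta>. c * (E N \<theta> *\<^sub>R (of_real (b \<theta>) * e k \<theta>)) + E N \<theta> *\<^sub>R (of_real (M \<theta>) * e k \<theta>)) has_integral 0) {0<..<pi}"
    by (rule has_integral_eq[rotated])
       (simp add: b_def c_def M_def scaleR_conv_of_real algebra_simps power2_eq_square)
  then have "integral {0<..<pi} (\<lambda>\<theta>. c * (E N \<theta> *\<^sub>R (of_real (b \<theta>) * e k \<theta>)) + E N \<theta> *\<^sub>R (of_real (M \<theta>) * e k \<theta>)) = 0"
    by (rule integral_unique)
  then have "c * K + integral {0<..<pi} (\<lambda>\<theta>. E N \<theta> *\<^sub>R (of_real (M \<theta>) * e k \<theta>)) = 0"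
    unfolding K_def
    using Henstock_Kurzweil_Integration.integral_add[OF integrable_on_mult_right[OF e2, of c] e3]
    by (simp del: mult_scaleR_right)
  then have "integral {0<..<pi} (\<lambda>\<theta>. E N \<theta> *\<^sub>R (of_real (M \<theta>) * e k \<theta>)) = - (c\<^sup>2 * J N k)"
    unfolding JK[symmetric] power2_eq_square by (simp add: add_eq_0_iff mult_ac)
  then have "(\<bar>k\<bar> * R / 2)\<^sup>2 * cmod (J N k) = norm (integral {0<..<pi} (\<lambda>\<theta>. E N \<theta> *\<^sub>R (of_real (M \<theta>) * e k \<theta>)))"
    by (simp add: norm_mult norm_power c0)
  also have "\<dots> \<le> integral {0<..<pi} (\<lambda>\<theta>. 1 / 4 * (real N)\<^sup>2 * (E N \<theta> * (P (log_cot \<theta>))\<^sup>2) + (C / 4 + 1) * real N * (E N \<theta> * P (log_cot \<theta>)) + 2 * E N \<theta>)"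
  proof (rule integral_norm_bound_integral[OF e3])
    show "(\<lambda>\<theta>. 1 / 4 * (real N)\<^sup>2 * (E N \<theta> * (P (log_cot \<theta>))\<^sup>2) + (C / 4 + 1) * real N * (E N \<theta> * P (log_cot \<theta>)) + 2 * E N \<theta>) integrable_on {0<..<pi}"
      by (intro integrable_add integrable_on_mult_right E_P_integrable E_P_square_integrable E_integrable)
    fix \<theta> assume "\<theta> \<in> {0<..<pi}"
    from mult_left_mono[OF M_bound[OF this] less_imp_le[OF E_pos[of N \<theta>]]]
    show "norm (E N \<theta> *\<^sub>R (of_real (M \<theta>) * e k \<theta>)) \<le> 1 / 4 * (real N)\<^sup>2 * (E N \<theta> * (P (log_cot \<theta>))\<^sup>2) + (C / 4 + 1) * real N * (E N \<theta> * P (log_cot \<theta>)) + 2 * E N \<theta>"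
      using E_pos[of N \<theta>] by (simp add: norm_mult algebra_simps)
  qed
  also have "\<dots> = 1 / 4 * ((real N)\<^sup>2 * integral {0<..<pi} (\<lambda>\<theta>. E N \<theta> * (P (log_cot \<theta>))\<^sup>2))
      + (C / 4 + 1) * (real N * integral {0<..<pi} (\<lambda>\<theta>. E N \<theta> * P (log_cot \<theta>))) + 2 * I N"
    unfolding I_def
    by (subst Henstock_Kurzweil_Integration.integral_add, (intro integrable_add integrable_on_mult_right E_P_integrable E_P_square_integrable E_integrable)+)+ simp
  also have "\<dots> \<le> 1 / 4 * (2 * (C + 2) * I N) + (C / 4 + 1) * (2 * I N) + 2 * I N"
    using C by (intro add_mono mult_left_mono first_moment second_moment) auto
  also have "\<dots> = (C + 5) * I N" by (simp add: algebra_simps)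
  finally have le: "(\<bar>k\<bar> * R / 2)\<^sup>2 * cmod (J N k) \<le> (C + 5) * I N" .
  have I0: "I N \<ge> 0" unfolding I_def using E_pos by (intro integral_nonneg E_integrable) (auto simp: less_imp_le)
  \<comment> \<open>The 32 in the condition on \<open>R\<close> is 4 from squaring
    \<open>R / 2\<close> times the 8 that is wanted here.\<close>
  have "8 * (C + 5) * k\<^sup>2 * cmod (J N k) \<le> (\<bar>k\<bar> * R / 2)\<^sup>2 * cmod (J N k)"
    using mult_right_mono[OF R(2), of "k\<^sup>2 / 4"] by (intro mult_right_mono) (auto simp: power_mult_distrib power_divide algebra_simps)
  also note le
  finally have "(C + 5) * (8 * k\<^sup>2 * cmod (J N k)) \<le> (C + 5) * I N" by (simp only: mult_ac)
  then have "8 * k\<^sup>2 * cmod (J N k) \<le> I N" using C by (simp add: mult_le_cancel_left_pos)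
  then show ?thesis using k by (simp add: field_simps)
qed

section \<open>The Gram matrix on the upper semicircle\<close>

lemma J_has_integral: "((\<lambda>\<theta>. of_real (E N \<theta>) * e k \<theta>) has_integral J N k) {0<..<pi}"
proof -
  have "(\<lambda>\<theta>. E N \<theta> *\<^sub>R e k \<theta>) integrable_on {0<..<pi}"
    by (rule weighted_integrable[where K = 1, OF e_cont]) auto
  then show ?thesis unfolding J_def scaleR_conv_of_real by (rule integrable_integral)
qed

lemma J_zero: "J N 0 = of_real (I N)"
proof -
  have "((\<lambda>\<theta>. of_real (E N \<theta>)) has_integral (of_real (I N) :: complex)) {0<..<pi}"
    unfolding I_def using integrable_integral[OF E_integrable] by (rule has_integral_of_real)
  then show ?thesis unfolding J_def e_def by (simp add: integral_unique)
qed

lemma I_nonneg: "I N \<ge> 0"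
  unfolding I_def using E_pos by (intro integral_nonneg E_integrable) (auto simp: less_imp_le)

lemma E_double: "E (2 * n) \<theta> = (E n \<theta>)\<^sup>2"
  by (simp only: mult_2 E_add power2_eq_square)

text \<open>The weights multiply, so the pointwise inequality between the arithmetic and the
  geometric mean replaces a mixed integral by diagonal ones.\<close>

lemma I_mixed_le:
  fixes x y :: real
  shows "x * y * I (n + m) \<le> (x\<^sup>2 * I (2 * n) + y\<^sup>2 * I (2 * m)) / 2"
proof -
  have "integral {0<..<pi} (\<lambda>\<theta>. x * y * E (n + m) \<theta>) \<le>
      integral {0<..<pi} (\<lambda>\<theta>. x\<^sup>2 / 2 * E (2 * n) \<theta> + y\<^sup>2 / 2 * E (2 * m) \<theta>)"
  proof (rule integral_le)
    fix \<theta>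
    have "0 \<le> (x * E n \<theta> - y * E m \<theta>)\<^sup>2" by simp
    then show "x * y * E (n + m) \<theta> \<le> x\<^sup>2 / 2 * E (2 * n) \<theta> + y\<^sup>2 / 2 * E (2 * m) \<theta>"
      unfolding E_double by (simp add: E_add power2_diff power_mult_distrib field_simps)
  qed (intro integrable_add integrable_on_mult_right E_integrable)+
  also have "\<dots> = x\<^sup>2 / 2 * I (2 * n) + y\<^sup>2 / 2 * I (2 * m)"
    unfolding I_def
    by (subst Henstock_Kurzweil_Integration.integral_add) (auto intro!: integrable_on_mult_right E_integrable)
  finally show ?thesis by (simp add: I_def field_simps)
qed

text \<open>Schur's test: the off-diagonal entry at \<open>n\<close>, \<open>m\<close> is at most
  \<open>1 / (16 (n - m)^2)\<close> times \<open>x n + x m\<close>. The rows of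
  \<open>1 / (n - m)^2\<close> sum to at most 4, so each of the two symmetric halves contributes at
  most 1/4 of the diagonal.\<close>

lemma upper_half_integral:
  fixes a :: "nat \<Rightarrow> complex"
  shows "\<bar>integral {0<..<pi} (\<lambda>\<theta>. (cmod (\<Sum>n<N. a n * (of_real (E n \<theta>) * e (real n) \<theta>)))\<^sup>2)
      - (\<Sum>n<N. (cmod (a n))\<^sup>2 * I (2 * n))\<bar> \<le> 1 / 2 * (\<Sum>n<N. (cmod (a n))\<^sup>2 * I (2 * n))"
proof -
  define W where "W = integral {0<..<pi} (\<lambda>\<theta>. (cmod (\<Sum>n<N. a n * (of_real (E n \<theta>) * e (real n) \<theta>)))\<^sup>2)"
  define x where "x n = (cmod (a n))\<^sup>2 * I (2 * n)" for n
  define G where "G n m = a n * cnj (a m) * J (n + m) (real n - real m)" for n m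
  have prod: "of_real (E n \<theta>) * e (real n) \<theta> * cnj (of_real (E m \<theta>) * e (real m) \<theta>)
      = of_real (E (n + m) \<theta>) * e (real n - real m) \<theta>" for n m \<theta>
    by (simp add: E_add e_def cis_cnj cis_mult algebra_simps)
  have "((\<lambda>\<theta>. \<Sum>n<N. \<Sum>m<N. a n * cnj (a m) * (of_real (E (n + m) \<theta>) * e (real n - real m) \<theta>)) has_integral
      (\<Sum>n<N. \<Sum>m<N. G n m)) {0<..<pi}"
    unfolding G_def by (intro has_integral_sum has_integral_mult_right J_has_integral) auto
  also have "(\<lambda>\<theta>. \<Sum>n<N. \<Sum>m<N. a n * cnj (a m) * (of_real (E (n + m) \<theta>) * e (real n - real m) \<theta>))
      = (\<lambda>\<theta>. of_real ((cmod (\<Sum>n<N. a n * (of_real (E n \<theta>) * e (real n) \<theta>)))\<^sup>2))"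
    unfolding prod[symmetric] complex_norm_square
    by (simp add: fun_eq_iff sum_product mult_ac)
  finally have "((\<lambda>\<theta>. Re (of_real ((cmod (\<Sum>n<N. a n * (of_real (E n \<theta>) * e (real n) \<theta>)))\<^sup>2))) has_integral
      Re (\<Sum>n<N. \<Sum>m<N. G n m)) {0<..<pi}"
    by (rule has_integral_Re)
  then have WG: "W = Re (\<Sum>n<N. \<Sum>m<N. G n m)"
    unfolding W_def Re_complex_of_real by (rule integral_unique)
  have diag: "G n n = of_real (x n)" for n
    by (simp add: G_def x_def J_zero mult_2 flip: complex_norm_square)
  have "(\<Sum>n<N. \<Sum>m<N. G n m) = (\<Sum>n<N. of_real (x n) + (\<Sum>m\<in>{..<N} - {n}. G n m))"
    by (intro sum.cong refl) (simp add: sum.remove diag)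
  then have "W - (\<Sum>n<N. x n) = Re (\<Sum>n<N. \<Sum>m\<in>{..<N} - {n}. G n m)"
    by (simp add: WG sum.distrib)
  then have "\<bar>W - (\<Sum>n<N. x n)\<bar> \<le> cmod (\<Sum>n<N. \<Sum>m\<in>{..<N} - {n}. G n m)"
    using abs_Re_le_cmod by metis
  also have "\<dots> \<le> (\<Sum>n<N. \<Sum>m\<in>{..<N} - {n}. cmod (G n m))"
    by (intro order_trans[OF norm_sum] sum_mono norm_sum)
  also have "\<dots> \<le> (\<Sum>n<N. \<Sum>m\<in>{..<N} - {n}. 1 / (16 * (real n - real m)\<^sup>2) * (x n + x m))"
  proof (intro sum_mono)
    fix n m assume "m \<in> {..<N} - {n}"
    then have "cmod (G n m) \<le> cmod (a n) * cmod (a m) * (1 / (8 * (real n - real m)\<^sup>2) * I (n + m))"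
      unfolding G_def norm_mult complex_mod_cnj by (intro mult_left_mono J_bound) auto
    also have "\<dots> = 1 / (8 * (real n - real m)\<^sup>2) * (cmod (a n) * cmod (a m) * I (n + m))" by simp
    also have "\<dots> \<le> 1 / (8 * (real n - real m)\<^sup>2) * ((x n + x m) / 2)"
      unfolding x_def by (intro mult_left_mono I_mixed_le) auto
    finally show "cmod (G n m) \<le> 1 / (16 * (real n - real m)\<^sup>2) * (x n + x m)" by simp
  qed
  also have "\<dots> = (\<Sum>n<N. \<Sum>m\<in>{..<N} - {n}. 1 / (16 * (real n - real m)\<^sup>2) * x n)
      + (\<Sum>n<N. \<Sum>m\<in>{..<N} - {n}. 1 / (16 * (real n - real m)\<^sup>2) * x m)"
    by (simp add: ring_distribs sum.distrib)
  also have "(\<Sum>n<N. \<Sum>m\<in>{..<N} - {n}. 1 / (16 * (real n - real m)\<^sup>2) * x m)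
      = (\<Sum>n<N. \<Sum>m\<in>{..<N} - {n}. 1 / (16 * (real n - real m)\<^sup>2) * x n)"
  proof -
    have set_eq: "{..<N} - {n} = {m \<in> {..<N}. m \<noteq> n}" for n by auto
    have "(\<Sum>n<N. \<Sum>m\<in>{..<N} - {n}. 1 / (16 * (real n - real m)\<^sup>2) * x m)
      = (\<Sum>m<N. \<Sum>n\<in>{n \<in> {..<N}. m \<noteq> n}. 1 / (16 * (real n - real m)\<^sup>2) * x m)"
      unfolding set_eq by (rule sum.swap_restrict) auto
    also have "\<dots> = (\<Sum>m<N. \<Sum>n\<in>{n \<in> {..<N}. n \<noteq> m}. 1 / (16 * (real m - real n)\<^sup>2) * x m)"
      by (intro sum.cong) (auto simp: power2_commute)
    finally show ?thesis by (simp only: set_eq)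
  qed
  also have "(\<Sum>n<N. \<Sum>m\<in>{..<N} - {n}. 1 / (16 * (real n - real m)\<^sup>2) * x n) \<le> (\<Sum>n<N. x n / 4)"
  proof (intro sum_mono)
    fix n assume "n \<in> {..<N}"
    have "(\<Sum>m\<in>{..<N} - {n}. 1 / (16 * (real n - real m)\<^sup>2) * x n) = x n / 16 * (\<Sum>m\<in>{..<N} - {n}. 1 / (real n - real m)\<^sup>2)"
      by (simp add: sum_distrib_left mult_ac)
    also have "\<dots> \<le> x n / 16 * 4"
      using \<open>n \<in> {..<N}\<close> I_nonneg by (intro mult_left_mono sum_inverse_square_differences_le) (auto simp: x_def)
    finally show "(\<Sum>m\<in>{..<N} - {n}. 1 / (16 * (real n - real m)\<^sup>2) * x n) \<le> x n / 4" by simp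
  qed
  finally show ?thesis by (simp add: x_def W_def sum_divide_distrib[symmetric])
qed

end

section \<open>The symbol\<close>

text \<open>Absorbs the polynomial factor of \<open>q\<close> into an exponential whose rate falls
  as the shift \<open>a\<close> grows.\<close>

lemma add_le_mult_exp:
  fixes a t :: real
  assumes "a > 0"
  shows "a + t \<le> a * exp (t / a)"
proof -
  have "a * (1 + t / a) \<le> a * exp (t / a)"
    using assms exp_ge_add_one_self by (intro mult_left_mono) auto
  moreover have "a * (1 + t / a) = a + t" using assms by (simp add: distrib_left)
  ultimately show ?thesis by simp
qed

lemma add_square_le_mult_exp:
  fixes a t :: real
  assumes "a > 0" "t \<ge> 0"
  shows "(a + t)\<^sup>2 \<le> a\<^sup>2 * exp (2 * t / a)"
proof -
  have "(a + t)\<^sup>2 \<le> (a * exp (t / a))\<^sup>2"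
    using assms by (intro power_mono add_le_mult_exp) auto
  then show ?thesis by (simp add: power_mult_distrib exp_double[symmetric])
qed

locale symbol =
  fixes g :: real
  assumes g: "g > 0"
begin

text \<open>This shift makes \<open>g (A + sp y)\<close> at least 4. That yields
  \<open>P \<ge> 0\<close>, the bound of \<open>P'\<close> by \<open>P\<close>, and a square factor
  that cannot outgrow half of the exponential decay.\<close>

definition A :: real where "A = 4 / g"
text \<open>Will bound the derivative of \<open>qc\<close> on the strip; \<open>A + 2\<close> in
  place of \<open>A\<close> allows for the imaginary part of the logarithm.\<close>

definition C1 :: real where "C1 = 2 * (A + 2) + g * (A + 2)\<^sup>2"
text \<open>One summand for each demand: exceeding \<open>C1\<close>, sending the lower semicircle
  below \<open>\<delta>\<close>, and \<open>R\<^sup>2 \<ge> 32 (C + 5)\<close> for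
  \<open>C = g + 1\<close>, which follows from \<open>R \<le> R\<^sup>2\<close>.\<close>

definition R :: real where "R = C1 + 2 * A\<^sup>2 + 32 * (g + 6) + 1"

text \<open>A smooth positive part of \<open>y\<close>: \<open>q\<close> stays bounded as
  \<open>y\<close> tends to minus infinity and decays like \<open>exp (- g y)\<close> times a square
  at plus infinity.\<close>

definition sp :: "real \<Rightarrow> real" where "sp y = ln (1 + exp y)"
definition sp' :: "real \<Rightarrow> real" where "sp' y = exp y / (1 + exp y)"
definition q :: "real \<Rightarrow> real" where "q y = exp (- g * sp y) * (A + sp y)\<^sup>2"
definition P :: "real \<Rightarrow> real" where
  "P y = exp (- g * sp y) * (A + sp y) * (g * (A + sp y) - 2) * sp' y"
text \<open>The last term comes from the derivative of \<open>sp'\<close>, which is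
  \<open>sp' (1 - sp')\<close>.\<close>

definition P' :: "real \<Rightarrow> real" where
  "P' y = exp (- g * sp y) * (sp' y)\<^sup>2 * (- g * (A + sp y) * (g * (A + sp y) - 2) + 2 * (g * (A + sp y)) - 2)
     + P y * (1 - sp' y)"

section \<open>Estimates for \<open>q\<close> on the real line\<close>

lemma A_pos: "A > 0" and gA: "g * A = 4"
  using g by (auto simp: A_def)

lemma C1_pos: "C1 > 0"
  using A_pos g unfolding C1_def by (intro add_pos_pos mult_pos_pos) auto

lemma one_plus_exp_pos: "1 + exp (y :: real) > 0"
  by (simp add: add_pos_pos)

lemma sp_nonneg: "sp y \<ge> 0"
  by (simp add: sp_def)

lemma sp_ge: "sp y \<ge> y"
  using one_plus_exp_pos[of y] by (simp add: sp_def ln_ge_iff)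

lemma sp'_bounds: "0 < sp' y" "sp' y < 1"
  using one_plus_exp_pos[of y] by (auto simp: sp'_def)

lemma sp_deriv: "(sp has_real_derivative sp' y) (at y)"
  unfolding sp_def sp'_def using one_plus_exp_pos[of y] by (auto intro!: derivative_eq_intros)

lemma sp'_deriv: "(sp' has_real_derivative sp' y * (1 - sp' y)) (at y)"
  unfolding sp'_def using one_plus_exp_pos[of y]
  by (auto intro!: derivative_eq_intros simp: field_simps power2_eq_square)

lemma q_has_derivative: "(q has_real_derivative - P y) (at y)"
  unfolding q_def P_def
  by (auto intro!: derivative_eq_intros sp_deriv simp: algebra_simps power2_eq_square)

lemma P_has_derivative: "(P has_real_derivative P' y) (at y)"
  unfolding P_def P'_def
  by (auto intro!: derivative_eq_intros sp_deriv sp'_deriv simp: algebra_simps power2_eq_square)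

lemma weight_ge: "g * (A + sp y) \<ge> 4"
  using gA sp_nonneg[of y] g by (simp add: distrib_left)

lemma P_pos: "P y \<ge> 0"
  using weight_ge[of y] sp'_bounds[of y] A_pos sp_nonneg[of y]
  unfolding P_def by (intro mult_nonneg_nonneg) auto

text \<open>By the choice of \<open>A\<close>, the factor \<open>(A + s)^2\<close> grows more slowly
  than \<open>exp (g s)\<close>, so the product does not exceed its value at
  \<open>s = 0\<close>.\<close>

lemma exp_weight_le: "exp (- g * sp y) * (A + sp y)\<^sup>2 \<le> A\<^sup>2"
proof -
  have "(A + sp y)\<^sup>2 \<le> A\<^sup>2 * exp (2 * sp y / A)"
    by (rule add_square_le_mult_exp[OF A_pos sp_nonneg])
  also have "\<dots> \<le> A\<^sup>2 * exp (g * sp y)"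
    using g sp_nonneg[of y] by (intro mult_left_mono) (auto simp: A_def)
  finally have "exp (- g * sp y) * (A + sp y)\<^sup>2 \<le> exp (- g * sp y) * (A\<^sup>2 * exp (g * sp y))"
    by (intro mult_left_mono) auto
  also have "\<dots> = A\<^sup>2 * exp (- g * sp y + g * sp y)" unfolding exp_add by (simp only: mult_ac)
  finally show ?thesis by simp
qed

lemma P_le: "P y \<le> g * A\<^sup>2"
proof -
  have "P y \<le> exp (- g * sp y) * (A + sp y) * (g * (A + sp y)) * 1"
    unfolding P_def using weight_ge[of y] sp'_bounds[of y] A_pos sp_nonneg[of y]
    by (intro mult_mono) auto
  also have "\<dots> = g * (exp (- g * sp y) * (A + sp y)\<^sup>2)" by (simp add: power2_eq_square)
  also have "\<dots> \<le> g * A\<^sup>2" using g exp_weight_le by (intro mult_left_mono) auto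
  finally show ?thesis .
qed

text \<open>The first part of \<open>P'\<close> is minus a multiple of
  \<open>w (w - 2) - 2 w + 2\<close>, which lies between 0 and \<open>w (w - 2)\<close> because
  \<open>w \<ge> 4\<close>; as \<open>sp' < 1\<close>, the upper end leads to \<open>g P\<close>.
  The second part lies between 0 and \<open>P\<close>.\<close>

lemma P'_le: "\<bar>P' y\<bar> \<le> (g + 1) * P y"
proof -
  define w where "w = g * (A + sp y)"
  have w: "w \<ge> 4" using weight_ge by (simp add: w_def)
  have "exp (- g * sp y) * (sp' y)\<^sup>2 * (- g * (A + sp y) * (g * (A + sp y) - 2) + 2 * (g * (A + sp y)) - 2)
     = - (exp (- g * sp y) * (sp' y)\<^sup>2 * (w * (w - 2) - 2 * w + 2))"
    by (simp add: w_def algebra_simps)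
  moreover have w': "0 \<le> w * (w - 2) - 2 * w + 2"
  proof -
    have "0 \<le> w * (w - 4)" using w by simp
    then show ?thesis by (simp add: algebra_simps)
  qed
  then have "0 \<le> exp (- g * sp y) * (sp' y)\<^sup>2 * (w * (w - 2) - 2 * w + 2)"
    by (intro mult_nonneg_nonneg) auto
  moreover have "exp (- g * sp y) * (sp' y)\<^sup>2 * (w * (w - 2) - 2 * w + 2) \<le> g * P y"
  proof -
    have "exp (- g * sp y) * (sp' y)\<^sup>2 * (w * (w - 2) - 2 * w + 2) \<le> exp (- g * sp y) * sp' y * (w * (w - 2))"
      using w w' sp'_bounds[of y] by (intro mult_mono mult_left_mono) (auto simp: power2_eq_square mult_left_le)
    also have "\<dots> = g * P y" by (simp add: P_def w_def mult_ac)
    finally show ?thesis .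
  qed
  moreover have "0 \<le> P y * (1 - sp' y)" "P y * (1 - sp' y) \<le> P y"
    using P_pos[of y] sp'_bounds[of y] by (auto simp: mult_left_le)
  ultimately show ?thesis unfolding P'_def using P_pos[of y] by (simp add: distrib_right)
qed

lemma R_ge: "R > 0" "R\<^sup>2 \<ge> 32 * ((g + 1) + 5)" "(R - C1) * (pi / 2) \<ge> 2 * A\<^sup>2 + 1" "R > C1"
proof -
  have big: "R \<ge> 32 * g + 192" "R - C1 \<ge> 2 * A\<^sup>2 + 1"
    using C1_pos g by (auto simp: R_def)
  then have "R \<ge> 1" using g by linarith
  then show "R > 0" by simp
  have "R * 1 \<le> R * R" using \<open>R \<ge> 1\<close> by (intro mult_left_mono) auto
  then show "R\<^sup>2 \<ge> 32 * ((g + 1) + 5)" using big by (simp add: power2_eq_square)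
  have "2 * A\<^sup>2 + 1 > 0" by (simp add: add_nonneg_pos)
  with big show "R > C1" by linarith
  have "(R - C1) * 1 \<le> (R - C1) * (pi / 2)"
    using pi_ge_two \<open>R > C1\<close> by (intro mult_left_mono) auto
  then show "(R - C1) * (pi / 2) \<ge> 2 * A\<^sup>2 + 1" by (rule order_trans[rotated]) (use big in simp)
qed

sublocale phase q P P' "g + 1" R "g * A\<^sup>2"
proof
  show "continuous_on UNIV P'"
  proof -
    have c: "continuous_on UNIV sp" "continuous_on UNIV sp'" "continuous_on UNIV P"
      using DERIV_continuous[OF sp_deriv] DERIV_continuous[OF sp'_deriv] DERIV_continuous[OF P_has_derivative]
      by (auto simp: continuous_on_eq_continuous_at)
    show ?thesis unfolding P'_def by (intro continuous_intros c)
  qed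
  show "q y \<ge> 0" for y by (simp add: q_def)
qed (use q_has_derivative P_has_derivative P_pos P_le P'_le R_ge g in auto)

text \<open>\<open>qc\<close> continues \<open>q\<close> from the real line, and \<open>R\<close> exceeds the bound \<open>C1\<close> of its derivative
  on the strip, so that \<open>exp (- \<i> R w)\<close> outweighs a possibly negative real part of \<open>qc\<close>.\<close>

definition qc :: "complex \<Rightarrow> complex" where
  "qc \<eta> = exp (- of_real g * Ln (1 + exp \<eta>)) * (of_real A + Ln (1 + exp \<eta>))\<^sup>2"

section \<open>The continuation of \<open>q\<close> to the strip\<close>

definition strip :: "complex set" where "strip = {\<eta>. - (pi / 2) \<le> Im \<eta> \<and> Im \<eta> \<le> 0}"

lemma strip_convex: "convex strip"
proof -
  have "strip = {\<eta>. Im \<eta> \<le> 0} \<inter> {\<eta>. Im \<eta> \<ge> - (pi / 2)}" by (auto simp: strip_def)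
  then show ?thesis using convex_Int[OF convex_halfspace_Im_le convex_halfspace_Im_ge] by metis
qed

lemma strip_exp: "\<eta> \<in> strip \<Longrightarrow> Re (exp \<eta>) \<ge> 0"
  unfolding Re_exp strip_def by (intro mult_nonneg_nonneg cos_ge_zero) auto

text \<open>Since \<open>exp \<eta>\<close> lies in the closed right half-plane,
  \<open>1 + exp \<eta>\<close> has real part at least 1: it avoids the cut, has modulus at least 1
  and argument below \<open>pi / 2\<close>, and is at least as far from 0 as
  \<open>exp \<eta>\<close>.\<close>

lemma Ln_one_plus_exp_bounds:
  assumes "Re (exp \<eta>) \<ge> 0"
  shows "1 + exp \<eta> \<notin> \<real>\<^sub>\<le>\<^sub>0" "1 + exp \<eta> \<noteq> 0" "Re (Ln (1 + exp \<eta>)) \<ge> 0" "\<bar>Im (Ln (1 + exp \<eta>))\<bar> \<le> 2"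
    "cmod (exp \<eta> / (1 + exp \<eta>)) \<le> 1"
proof -
  show 1: "1 + exp \<eta> \<notin> \<real>\<^sub>\<le>\<^sub>0" using assms by (auto simp: complex_nonpos_Reals_iff)
  show nz: "1 + exp \<eta> \<noteq> 0" using 1 by auto
  have "1 \<le> Re (1 + exp \<eta>)" using assms by simp
  also have "\<dots> \<le> cmod (1 + exp \<eta>)" by (rule complex_Re_le_cmod)
  finally have "1 \<le> cmod (1 + exp \<eta>)" .
  then show "Re (Ln (1 + exp \<eta>)) \<ge> 0" using nz by simp
  have "\<bar>Im (Ln (1 + exp \<eta>))\<bar> < pi / 2" using Re_Ln_pos_lt[OF nz] assms by simp
  then show "\<bar>Im (Ln (1 + exp \<eta>))\<bar> \<le> 2" using pi_less_4 by linarith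
  have "(cmod (exp \<eta>))\<^sup>2 \<le> (cmod (1 + exp \<eta>))\<^sup>2"
    using assms unfolding cmod_power2 by (simp add: power2_eq_square algebra_simps)
  then have "cmod (exp \<eta>) \<le> cmod (1 + exp \<eta>)" by (rule power2_le_imp_le) simp
  then show "cmod (exp \<eta> / (1 + exp \<eta>)) \<le> 1" using nz by (simp add: norm_divide)
qed

lemma qc_deriv:
  assumes "Re (exp \<eta>) \<ge> 0"
  shows "(qc has_field_derivative exp (- of_real g * Ln (1 + exp \<eta>)) *
     (2 * (of_real A + Ln (1 + exp \<eta>)) - of_real g * (of_real A + Ln (1 + exp \<eta>))\<^sup>2) * (exp \<eta> / (1 + exp \<eta>))) (at \<eta>)"
proof -
  have outer: "((\<lambda>L. exp (- of_real g * L) * (of_real A + L)\<^sup>2) has_field_derivative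
      exp (- of_real g * L) * (2 * (of_real A + L) - of_real g * (of_real A + L)\<^sup>2)) (at L)" for L :: complex
    by (auto intro!: derivative_eq_intros simp: algebra_simps power2_eq_square)
  have inner: "((\<lambda>\<eta>. Ln (1 + exp \<eta>)) has_field_derivative exp \<eta> / (1 + exp \<eta>)) (at \<eta>)"
    using Ln_one_plus_exp_bounds[OF assms] by (auto intro!: derivative_eq_intros simp: divide_inverse mult.commute)
  show ?thesis unfolding qc_def by (rule DERIV_chain2[OF outer inner])
qed

text \<open>The exponential has modulus \<open>exp (- g \<sigma>)\<close> with
  \<open>\<sigma> = Re L\<close>, the polynomial factor is at most
  \<open>C1 exp (g \<sigma>)\<close>, and the last factor has modulus at most 1.\<close>

lemma qc_deriv_bound:
  assumes "Re (exp \<eta>) \<ge> 0"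
  shows "cmod (exp (- of_real g * Ln (1 + exp \<eta>)) *
     (2 * (of_real A + Ln (1 + exp \<eta>)) - of_real g * (of_real A + Ln (1 + exp \<eta>))\<^sup>2) * (exp \<eta> / (1 + exp \<eta>))) \<le> C1"
proof -
  define L where "L = Ln (1 + exp \<eta>)"
  note F = Ln_one_plus_exp_bounds[OF assms, folded L_def]
  define \<sigma> where "\<sigma> = Re L"
  have \<sigma>: "\<sigma> \<ge> 0" using F by (simp add: \<sigma>_def)
  have "cmod (of_real A + L) \<le> A + (\<bar>Re L\<bar> + \<bar>Im L\<bar>)"
    using A_pos cmod_le[of L] by (intro norm_triangle_le) auto
  then have N: "cmod (of_real A + L) \<le> (A + 2) + \<sigma>" using F by (simp add: \<sigma>_def)
  have B1: "2 / (A + 2) \<le> g"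
  proof -
    have "2 \<le> g * A + g * 2" using gA g by simp
    then show ?thesis using A_pos by (simp add: field_simps)
  qed
  have sq: "((A + 2) + \<sigma>)\<^sup>2 \<le> (A + 2)\<^sup>2 * exp (g * \<sigma>)"
  proof -
    have "((A + 2) + \<sigma>)\<^sup>2 \<le> (A + 2)\<^sup>2 * exp (2 * \<sigma> / (A + 2))"
      using A_pos \<sigma> by (intro add_square_le_mult_exp) auto
    also have "\<dots> \<le> (A + 2)\<^sup>2 * exp (g * \<sigma>)"
      using mult_right_mono[OF B1 \<sigma>] by (intro mult_left_mono) auto
    finally show ?thesis .
  qed
  have li: "(A + 2) + \<sigma> \<le> (A + 2) * exp (g * \<sigma>)"
  proof -
    have "(A + 2) + \<sigma> \<le> (A + 2) * exp (\<sigma> / (A + 2))" using A_pos by (intro add_le_mult_exp) auto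
    also have "\<dots> \<le> (A + 2) * exp (g * \<sigma>)"
    proof -
      have "1 / (A + 2) \<le> 2 / (A + 2)" using A_pos by (intro divide_right_mono) auto
      with B1 have "1 / (A + 2) \<le> g" by linarith
      from mult_right_mono[OF this \<sigma>] show ?thesis using A_pos by (intro mult_left_mono) auto
    qed
    finally show ?thesis .
  qed
  have "cmod (2 * (of_real A + L) - of_real g * (of_real A + L)\<^sup>2) \<le> 2 * cmod (of_real A + L) + g * (cmod (of_real A + L))\<^sup>2"
    using norm_triangle_ineq4[of "2 * (of_real A + L)" "of_real g * (of_real A + L)\<^sup>2"] g
    unfolding norm_mult norm_power by simp
  also have "\<dots> \<le> 2 * ((A + 2) + \<sigma>) + g * ((A + 2) + \<sigma>)\<^sup>2"
    using N g by (intro add_mono mult_left_mono power_mono) auto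
  also have "\<dots> \<le> 2 * ((A + 2) * exp (g * \<sigma>)) + g * ((A + 2)\<^sup>2 * exp (g * \<sigma>))"
    using sq li g by (intro add_mono mult_left_mono) auto
  also have "\<dots> = C1 * exp (g * \<sigma>)" by (simp add: C1_def algebra_simps)
  finally have "cmod (exp (- of_real g * L)) * cmod (2 * (of_real A + L) - of_real g * (of_real A + L)\<^sup>2)
     \<le> exp (- g * \<sigma>) * (C1 * exp (g * \<sigma>))"
    by (intro mult_mono) (auto simp: \<sigma>_def)
  also have "\<dots> = C1" by (simp add: exp_minus)
  finally have "cmod (exp (- of_real g * L)) * cmod (2 * (of_real A + L) - of_real g * (of_real A + L)\<^sup>2) * cmod (exp \<eta> / (1 + exp \<eta>)) \<le> C1 * 1"
    using F(5) C1_pos by (intro mult_mono) auto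
  then show ?thesis by (simp only: norm_mult L_def mult_1_right)
qed

lemma qc_of_real: "qc (of_real y) = of_real (q y)"
proof -
  have "Ln (1 + exp (of_real y)) = of_real (sp y)"
    using Ln_of_real[OF one_plus_exp_pos[of y]] by (simp add: sp_def exp_of_real)
  then show ?thesis by (simp add: qc_def q_def exp_of_real flip: of_real_mult of_real_minus of_real_add of_real_power)
qed

text \<open>Mean value inequality in the convex strip, between \<open>\<eta>\<close> and the real
  point above it, where \<open>qc\<close> equals \<open>q\<close>.\<close>

lemma Re_qc_ge:
  assumes "\<eta> \<in> strip"
  shows "Re (qc \<eta>) \<ge> q (Re \<eta>) + C1 * Im \<eta>"
proof -
  have r: "of_real (Re \<eta>) \<in> strip" by (simp add: strip_def)
  have "cmod (qc (of_real (Re \<eta>)) - qc \<eta>) \<le> C1 * cmod (of_real (Re \<eta>) - \<eta>)"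
    by (rule field_differentiable_bound[OF strip_convex DERIV_subset[OF qc_deriv] qc_deriv_bound r assms])
       (use strip_exp in auto)
  also have "of_real (Re \<eta>) - \<eta> = of_real (- Im \<eta>) * \<i>" by (simp add: complex_eq_iff)
  also have "cmod \<dots> = - Im \<eta>" using assms by (simp add: norm_mult strip_def)
  finally have "Re (qc (of_real (Re \<eta>)) - qc \<eta>) \<le> C1 * (- Im \<eta>)"
    using complex_Re_le_cmod order_trans by blast
  then show ?thesis by (simp add: qc_of_real)
qed

text \<open>The Cayley transform sends the disc to the right half-plane, half the logarithm sends
  that to the strip \<open>\<bar>Im\<bar> < pi / 4\<close>, and the shift moves the upper edge to
  the real line.\<close>

definition \<eta> :: "complex \<Rightarrow> complex" where
  "\<eta> z = Ln ((1 + z) / (1 - z)) / 2 - \<i> * of_real (pi / 4)"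

definition \<psi> :: "complex \<Rightarrow> complex" where
  "\<psi> w = exp (- \<i> * of_real R * w - qc w)"

definition \<phi> :: "complex \<Rightarrow> complex" where "\<phi> z = \<psi> (\<eta> z)"

text \<open>The linear term contributes \<open>exp (R Im w)\<close>, which decays downwards; the
  continuation of \<open>q\<close> costs at most \<open>exp (- C1 Im w)\<close>.\<close>

lemma \<psi>_norm:
  assumes "w \<in> strip"
  shows "cmod (\<psi> w) \<le> exp ((R - C1) * Im w - q (Re w))"
  using Re_qc_ge[OF assms] by (simp add: \<psi>_def algebra_simps)

section \<open>The self-map and its boundary values\<close>

lemma Cayley_Re_pos:
  assumes "cmod z < 1"
  shows "Re ((1 + z) / (1 - z)) > 0"
proof -
  have "z \<noteq> 1" using assms by auto
  then have nz: "(1 - Re z)\<^sup>2 + (Im z)\<^sup>2 > 0"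
    by (auto simp: complex_eq_iff sum_power2_gt_zero_iff)
  have "(Re z)\<^sup>2 + (Im z)\<^sup>2 < 1"
    using assms by (simp add: cmod_def)
  then show ?thesis using nz by (simp add: Re_divide power2_eq_square algebra_simps)
qed

lemma Im_\<eta>_eq: "Im (\<eta> z) = Im (Ln ((1 + z) / (1 - z))) / 2 - pi / 4"
  by (simp add: \<eta>_def)

lemma \<eta>_interior:
  assumes "cmod z < 1"
  shows "- (pi / 2) < Im (\<eta> z)" "Im (\<eta> z) < 0" "\<eta> z \<in> strip"
proof -
  have "(1 + z) / (1 - z) \<noteq> 0" using Cayley_Re_pos[OF assms] by auto
  then have "\<bar>Im (Ln ((1 + z) / (1 - z)))\<bar> < pi / 2"
    using Re_Ln_pos_lt Cayley_Re_pos[OF assms] by blast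
  then show "- (pi / 2) < Im (\<eta> z)" "Im (\<eta> z) < 0" unfolding Im_\<eta>_eq by linarith+
  then show "\<eta> z \<in> strip" by (simp add: strip_def)
qed

lemma \<psi>_deriv:
  assumes "w \<in> strip"
  shows "\<psi> field_differentiable at w"
proof -
  obtain D where D: "(qc has_field_derivative D) (at w)"
    using qc_deriv[OF strip_exp[OF assms]] by blast
  have "((\<lambda>w. - \<i> * of_real R * w - qc w) has_field_derivative - \<i> * of_real R * 1 - D) (at w)"
    by (intro DERIV_diff DERIV_cmult DERIV_ident D)
  from DERIV_chain2[OF DERIV_exp this] show ?thesis
    unfolding \<psi>_def field_differentiable_def by blast
qed

lemma \<eta>_field_differentiable:
  assumes "z \<noteq> 1" "(1 + z) / (1 - z) \<notin> \<real>\<^sub>\<le>\<^sub>0"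
  shows "\<eta> field_differentiable at z"
  unfolding \<eta>_def field_differentiable_def using assms
  by (auto intro!: exI derivative_eq_intros)

lemma \<phi>_field_differentiable:
  assumes "z \<noteq> 1" "(1 + z) / (1 - z) \<notin> \<real>\<^sub>\<le>\<^sub>0" "\<eta> z \<in> strip"
  shows "\<phi> field_differentiable at z"
  unfolding \<phi>_def
  using field_differentiable_compose[OF \<eta>_field_differentiable[OF assms(1,2)] \<psi>_deriv[OF assms(3)]]
  by (simp add: o_def)

lemma \<phi>_holomorphic: "\<phi> holomorphic_on ball 0 1"
  unfolding holomorphic_on_def
proof
  fix z :: complex assume "z \<in> ball 0 1"
  then have z: "cmod z < 1" by simp
  then have "z \<noteq> 1" by auto
  then show "\<phi> field_differentiable at z within ball 0 1"
    using \<phi>_field_differentiable[of z] \<eta>_interior[OF z] Cayley_Re_pos[OF z]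
    by (auto simp: complex_nonpos_Reals_iff intro: field_differentiable_at_within)
qed

lemma \<phi>_self_map:
  assumes "cmod z < 1"
  shows "cmod (\<phi> z) < 1"
proof -
  have "cmod (\<phi> z) \<le> exp ((R - C1) * Im (\<eta> z) - q (Re (\<eta> z)))"
    unfolding \<phi>_def by (rule \<psi>_norm) (rule \<eta>_interior[OF assms])
  also have "(R - C1) * Im (\<eta> z) < 0"
    using R_ge \<eta>_interior[OF assms] by (intro mult_pos_neg) auto
  then have "(R - C1) * Im (\<eta> z) - q (Re (\<eta> z)) < 0" using q_nonneg[of "Re (\<eta> z)"] by linarith
  then have "exp ((R - C1) * Im (\<eta> z) - q (Re (\<eta> z))) < 1" by simp
  finally show ?thesis .
qed

lemma Cayley_cis:
  assumes "\<theta> \<in> {0<..<2 * pi}"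
  shows "cis \<theta> \<noteq> 1" "(1 + cis \<theta>) / (1 - cis \<theta>) = \<i> * of_real (cot (\<theta> / 2))"
proof -
  have s: "sin (\<theta> / 2) > 0" using assms by (intro sin_gt_zero) auto
  \<comment> \<open>Factoring out the half angle turns \<open>1 + cis \<theta>\<close> into a cosine
    and \<open>1 - cis \<theta>\<close> into a sine.\<close>
  have d: "cis \<theta> = cis (\<theta> / 2) * cis (\<theta> / 2)" by (simp add: cis_mult)
  have inv: "cis (\<theta> / 2) * cis (- (\<theta> / 2)) = 1" by (simp add: cis_mult)
  have "1 + cis \<theta> = cis (\<theta> / 2) * (cis (- (\<theta> / 2)) + cis (\<theta> / 2))"
    unfolding distrib_left inv d[symmetric] ..
  also have "cis (- (\<theta> / 2)) + cis (\<theta> / 2) = of_real (2 * cos (\<theta> / 2))" by (simp add: complex_eq_iff)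
  finally have plus: "1 + cis \<theta> = cis (\<theta> / 2) * of_real (2 * cos (\<theta> / 2))" .
  have "1 - cis \<theta> = cis (\<theta> / 2) * (cis (- (\<theta> / 2)) - cis (\<theta> / 2))"
    unfolding right_diff_distrib inv d[symmetric] ..
  also have "cis (- (\<theta> / 2)) - cis (\<theta> / 2) = - \<i> * of_real (2 * sin (\<theta> / 2))" by (simp add: complex_eq_iff)
  finally have minus: "1 - cis \<theta> = cis (\<theta> / 2) * (- \<i> * of_real (2 * sin (\<theta> / 2)))" .
  have "1 - cis \<theta> \<noteq> 0" unfolding minus using s by (simp add: cis_neq_zero)
  then show "cis \<theta> \<noteq> 1" by auto
  show "(1 + cis \<theta>) / (1 - cis \<theta>) = \<i> * of_real (cot (\<theta> / 2))"
    unfolding plus minus using s by (simp add: cis_neq_zero cot_def field_simps)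
qed

lemma Ln_ii_times_pos:
  assumes "c > 0"
  shows "Ln (\<i> * of_real c) = of_real (ln c) + \<i> * of_real (pi / 2)"
    "Ln (- \<i> * of_real c) = of_real (ln c) - \<i> * of_real (pi / 2)"
proof -
  have half: "- (pi / 2) \<le> pi" using pi_gt_zero by linarith
  have ii: "exp (\<i> * of_real (pi / 2)) = \<i>"
    by (simp only: cis_conv_exp[symmetric] cis_pi_half)
  have 1: "exp (of_real (ln c) + \<i> * of_real (pi / 2)) = \<i> * of_real c"
    unfolding exp_add ii using assms by (simp add: exp_of_real)
  have 2: "exp (of_real (ln c) - \<i> * of_real (pi / 2)) = - \<i> * of_real c"
    unfolding exp_diff ii using assms by (simp add: exp_of_real)
  show "Ln (\<i> * of_real c) = of_real (ln c) + \<i> * of_real (pi / 2)"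
    by (rule Ln_unique[OF 1]) auto
  show "Ln (- \<i> * of_real c) = of_real (ln c) - \<i> * of_real (pi / 2)"
    by (rule Ln_unique[OF 2]) (auto simp: half)
qed

lemma \<eta>_upper:
  assumes "\<theta> \<in> {0<..<pi}"
  shows "\<eta> (cis \<theta>) = of_real (log_cot \<theta>)"
proof -
  have "\<eta> (cis \<theta>) = Ln (\<i> * of_real (cot (\<theta> / 2))) / 2 - \<i> * of_real (pi / 4)"
    unfolding \<eta>_def using Cayley_cis(2)[of \<theta>] assms by simp
  then show ?thesis
    using Ln_ii_times_pos(1)[OF cot_half_pos[OF assms]] by (simp add: log_cot_def field_simps)
qed

text \<open>On this arc the cotangent is negative, so the logarithm has imaginary part
  \<open>- pi / 2\<close>; half of that and the shift add up to the lower edge of the strip.\<close>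

lemma \<eta>_lower:
  assumes "\<theta> \<in> {pi<..<2 * pi}"
  shows "Im (\<eta> (cis \<theta>)) = - (pi / 2)"
proof -
  have "sin (\<theta> / 2) > 0" "cos (\<theta> / 2) < 0"
    using assms cos_gt_zero_pi[of "\<theta> / 2 - pi"] by (auto intro!: sin_gt_zero)
  then have c: "- cot (\<theta> / 2) > 0" by (simp add: cot_def divide_neg_pos)
  have "\<eta> (cis \<theta>) = Ln (- \<i> * of_real (- cot (\<theta> / 2))) / 2 - \<i> * of_real (pi / 4)"
    unfolding \<eta>_def using Cayley_cis(2)[of \<theta>] assms by simp
  then show ?thesis using Ln_ii_times_pos(2)[OF c] by simp
qed

lemma \<phi>_upper:
  assumes "\<theta> \<in> {0<..<pi}"
  shows "\<phi> (cis \<theta>) ^ n = of_real (E n \<theta>) * e (real n) \<theta>"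
proof -
  have "\<phi> (cis \<theta>) ^ n = exp (of_nat n * (- \<i> * of_real R * of_real (log_cot \<theta>) - of_real (q (log_cot \<theta>))))"
    by (simp add: \<phi>_def \<psi>_def \<eta>_upper[OF assms] qc_of_real exp_of_nat_mult)
  also have "of_nat n * (- \<i> * of_real R * of_real (log_cot \<theta>) - of_real (q (log_cot \<theta>))) =
    of_real (- real n * q (log_cot \<theta>)) + \<i> * of_real (- real n * R * log_cot \<theta>)"
    by (simp add: algebra_simps)
  finally show ?thesis
    by (simp only: exp_add E_def e_def cis_conv_exp exp_of_real)
qed

text \<open>On the upper semicircle \<open>q \<le> A\<^sup>2\<close>, so the squared modulus of the
  power \<open>n\<close> is at least \<open>exp (- 2 n A\<^sup>2)\<close> there.
  \<open>\<delta> ^ n\<close> stays below this, which lets the diagonal absorb the lower semicircle;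
  the extra 1 gives \<open>\<delta> \<le> 1 / 2\<close>.\<close>

definition \<delta> :: real where "\<delta> = exp (- (2 * A\<^sup>2 + 1))"

lemma \<delta>_bounds: "0 < \<delta>" "\<delta> \<le> 1 / 2" "\<delta> \<le> exp (- 2 * A\<^sup>2)"
proof -
  show "0 < \<delta>" "\<delta> \<le> exp (- 2 * A\<^sup>2)" by (auto simp: \<delta>_def)
  have "\<delta> \<le> exp (- 1)" by (simp add: \<delta>_def)
  also have "exp (- 1) \<le> (1 / 2 :: real)"
    using exp_ge_add_one_self[of 1] by (simp add: exp_minus field_simps)
  finally show "\<delta> \<le> 1 / 2" .
qed

lemma \<phi>_lower:
  assumes "\<theta> \<in> {pi<..<2 * pi}"
  shows "cmod (\<phi> (cis \<theta>)) \<le> \<delta>"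
proof -
  have "\<eta> (cis \<theta>) \<in> strip" by (simp add: strip_def \<eta>_lower[OF assms])
  from \<psi>_norm[OF this] have "cmod (\<phi> (cis \<theta>)) \<le> exp (- ((R - C1) * (pi / 2)) - q (Re (\<eta> (cis \<theta>))))"
    by (simp add: \<phi>_def \<eta>_lower[OF assms])
  also have "\<dots> \<le> \<delta>"
    using R_ge(3) q_nonneg[of "Re (\<eta> (cis \<theta>))"] unfolding \<delta>_def by (intro exp_le_cancel_iff[THEN iffD2]) linarith
  finally show ?thesis .
qed

text \<open>Away from 1 and -1 the formula for \<open>\<phi>\<close> is still differentiable at
  boundary points: a nonzero cotangent keeps the Cayley transform off the cut of the
  logarithm.\<close>

lemma \<phi>_radial_limit:
  assumes "\<theta> \<in> {0<..<pi} \<union> {pi<..<2 * pi}"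
  shows "((\<lambda>r. \<phi> (of_real r * cis \<theta>)) \<longlongrightarrow> \<phi> (cis \<theta>)) (at_left 1)"
proof -
  have th: "\<theta> \<in> {0<..<2 * pi}" using assms by auto
  have c: "cot (\<theta> / 2) \<noteq> 0"
  proof (cases "\<theta> < pi")
    case True then show ?thesis using cot_half_pos[of \<theta>] assms by auto
  next
    case False
    then have "sin (\<theta> / 2) > 0" "cos (\<theta> / 2) < 0"
      using assms cos_gt_zero_pi[of "\<theta> / 2 - pi"] by (auto intro!: sin_gt_zero)
    then show ?thesis by (simp add: cot_def)
  qed
  have "\<eta> (cis \<theta>) \<in> strip"
    using assms \<eta>_upper[of \<theta>] \<eta>_lower[of \<theta>] by (auto simp: strip_def)
  moreover have "(1 + cis \<theta>) / (1 - cis \<theta>) \<notin> \<real>\<^sub>\<le>\<^sub>0"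
    using c unfolding Cayley_cis(2)[OF th] by (auto simp: complex_nonpos_Reals_iff)
  ultimately have "isCont \<phi> (cis \<theta>)"
    using Cayley_cis(1)[OF th] by (intro field_differentiable_imp_continuous_at \<phi>_field_differentiable)
  moreover have "((\<lambda>r. of_real r * cis \<theta>) \<longlongrightarrow> of_real 1 * cis \<theta>) (at_left 1)"
    by (intro tendsto_intros)
  ultimately show ?thesis using isCont_tendsto_compose[of "cis \<theta>" \<phi>] by simp
qed

end

section \<open>Decay of the diagonal and the conclusion\<close>

lemma integral_const_Ioo: "a \<le> b \<Longrightarrow> integral {a<..<b} (\<lambda>_. c :: real) = c * (b - a)"
  unfolding integral_open_interval_real[symmetric] by simp

lemma const_integrable_Ioo:
  fixes a b c :: real
  shows "(\<lambda>_. c) integrable_on {a<..<b}"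
  unfolding integrable_on_Icc_iff_Ioo[symmetric] by (intro integrable_continuous_real continuous_on_const)

text \<open>The difference has derivative \<open>u sin u\<close>. This will bound the cotangent by
  the reciprocal.\<close>

lemma mult_cos_le_sin:
  fixes x :: real
  assumes "0 \<le> x" "x \<le> pi"
  shows "x * cos x \<le> sin x"
proof -
  have "sin 0 - 0 * cos 0 \<le> sin x - x * cos x"
  proof (rule DERIV_nonneg_imp_nondecreasing[of 0 x "\<lambda>x. sin x - x * cos x"])
    fix u assume u: "0 \<le> u" "u \<le> x"
    have "((\<lambda>x. sin x - x * cos x) has_real_derivative u * sin u) (at u)"
      by (auto intro!: derivative_eq_intros simp: algebra_simps)
    moreover have "0 \<le> u * sin u" using u assms by (intro mult_nonneg_nonneg sin_ge_zero) auto
    ultimately show "\<exists>y. ((\<lambda>x. sin x - x * cos x) has_real_derivative y) (at u) \<and> 0 \<le> y" by blast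
  qed (rule assms)
  then show ?thesis by simp
qed

text \<open>Cauchy-Schwarz with \<open>\<delta> ^ n\<close> split evenly; the factor 2 bounds the
  geometric series.\<close>

lemma square_sum_geometric_weights_le:
  fixes x :: "nat \<Rightarrow> real"
  assumes \<delta>: "0 < \<delta>" "\<delta> \<le> 1 / 2"
  shows "(\<Sum>n<N. x n * \<delta> ^ n)\<^sup>2 \<le> 2 * (\<Sum>n<N. (x n)\<^sup>2 * \<delta> ^ n)"
proof -
  have sq: "(sqrt \<delta> ^ n)\<^sup>2 = \<delta> ^ n" for n
    using \<delta> by (simp add: power2_eq_square flip: power_mult_distrib)
  have "(\<Sum>n<N. x n * \<delta> ^ n)\<^sup>2 = (\<Sum>n<N. (x n * sqrt \<delta> ^ n) * sqrt \<delta> ^ n)\<^sup>2"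
    by (simp only: mult.assoc power2_eq_square[symmetric] sq)
  also have "\<dots> \<le> (\<Sum>n<N. (x n * sqrt \<delta> ^ n)\<^sup>2) * (\<Sum>n<N. (sqrt \<delta> ^ n)\<^sup>2)"
    by (rule Cauchy_Schwarz_ineq_sum)
  also have "(\<Sum>n<N. (sqrt \<delta> ^ n)\<^sup>2) = (\<Sum>n<N. \<delta> ^ n)" by (simp only: sq)
  also have "(\<Sum>n<N. (x n * sqrt \<delta> ^ n)\<^sup>2) = (\<Sum>n<N. (x n)\<^sup>2 * \<delta> ^ n)"
    by (simp only: power_mult_distrib sq)
  also have "(\<Sum>n<N. \<delta> ^ n) \<le> 2"
  proof -
    have "(\<Sum>n<N. \<delta> ^ n) \<le> (\<Sum>n. \<delta> ^ n)" using \<delta> by (intro sum_le_suminf summable_geometric) auto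
    also have "\<dots> = 1 / (1 - \<delta>)" using \<delta> by (intro suminf_geometric) auto
    also have "\<dots> \<le> 2" using \<delta> by (simp add: field_simps)
    finally show ?thesis .
  qed
  finally show ?thesis using \<delta> by (simp add: mult_left_mono sum_nonneg mult.commute[of _ 2])
qed

text \<open>Comparison with the telescoping differences of \<open>1 / (4 + ln n)\<close>, by
  \<open>ln x \<le> x - 1\<close> at the quotient of consecutive integers.\<close>

lemma summable_inverse_mult_ln_square:
  "summable (\<lambda>n. 1 / (real (Suc n) * (4 + ln (real (Suc n)))\<^sup>2))"
proof -
  define a where "a n = 1 / (4 + ln (real (Suc n)))" for n
  have "a \<longlonglongrightarrow> 0" unfolding a_def by real_asymp
  then have "summable (\<lambda>n. a n - a (Suc n))" by (rule telescope_summable')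
  then have "summable (\<lambda>n. 1 / (real (Suc (Suc n)) * (4 + ln (real (Suc (Suc n))))\<^sup>2))"
  proof (rule summable_comparison_test')
    fix n :: nat
    define x y where "x = 4 + ln (real (Suc n))" and "y = 4 + ln (real (Suc (Suc n)))"
    have xy: "0 < x" "x \<le> y" by (auto simp: x_def y_def add_pos_nonneg)
    have "ln (real (Suc n) / real (Suc (Suc n))) \<le> real (Suc n) / real (Suc (Suc n)) - 1"
      by (intro ln_le_minus_one) auto
    also have "\<dots> = - (1 / real (Suc (Suc n)))" by (simp add: field_simps)
    finally have yx: "1 / real (Suc (Suc n)) \<le> y - x" by (simp add: ln_div x_def y_def)
    have "1 / (real (Suc (Suc n)) * y\<^sup>2) = (1 / real (Suc (Suc n))) / (y * y)" by (simp add: power2_eq_square)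
    also have "\<dots> \<le> (y - x) / (x * y)"
      using xy yx by (intro frac_le mult_right_mono) auto
    also have "\<dots> = 1 / x - 1 / y" using xy by (simp add: field_simps)
    finally show "norm (1 / (real (Suc (Suc n)) * (4 + ln (real (Suc (Suc n))))\<^sup>2)) \<le> a n - a (Suc n)"
      by (simp add: a_def x_def y_def)
  qed
  then show ?thesis by (rule summable_Suc_iff[THEN iffD1])
qed

context symbol
begin

text \<open>Normalized by the length of the whole circle, to match Parseval's identity;
  \<open>D n\<close> is thus half of the mean over the arc. The 2 in \<open>I (2 * n)\<close> comes
  from squaring the modulus of the power \<open>n\<close>.\<close>

definition D :: "nat \<Rightarrow> real" where "D n = I (2 * n) / (2 * pi)"

section \<open>Comparison with the diagonal over the whole circle\<close>

lemma q_le: "q y \<le> A\<^sup>2"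
  unfolding q_def by (rule exp_weight_le)

lemma I_ge: "pi * exp (- real N * A\<^sup>2) \<le> I N"
proof -
  have "integral {0<..<pi} (\<lambda>_. exp (- real N * A\<^sup>2)) \<le> I N"
    unfolding I_def E_def[abs_def, symmetric]
  proof (intro integral_le const_integrable_Ioo E_integrable)
    show "exp (- real N * A\<^sup>2) \<le> E N \<theta>" for \<theta>
      unfolding E_def using q_le[of "log_cot \<theta>"] by (simp add: mult_left_mono)
  qed
  then show ?thesis by (simp add: integral_const_Ioo mult.commute)
qed

lemma D_pos: "D n > 0"
proof -
  have "0 < pi * exp (- real (2 * n) * A\<^sup>2)" by simp
  also have "\<dots> \<le> I (2 * n)" by (rule I_ge)
  finally show ?thesis by (simp add: D_def)
qed

lemma D_decseq: "decseq D"
proof (rule decseq_SucI)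
  fix n
  have "I (2 * Suc n) \<le> I (2 * n)"
    unfolding I_def
  proof (intro integral_le E_integrable)
    show "E (2 * Suc n) \<theta> \<le> E (2 * n) \<theta>" for \<theta>
      unfolding E_def exp_le_cancel_iff mult_minus_left neg_le_iff_le
      by (intro mult_right_mono q_nonneg) simp
  qed
  then show "D (Suc n) \<le> D n" by (simp add: D_def divide_right_mono)
qed

text \<open>Parseval splits the squared norm into the shares \<open>U\<close> and \<open>V\<close>
  of the two semicircles. \<open>U\<close> differs from \<open>X\<close> by at most half of
  \<open>X\<close>, and \<open>V\<close> lies between 0 and \<open>2 X\<close>; hence the constants
  1/2 and 7/2.\<close>

lemma polynomial_coefficients:
  fixes a :: "nat \<Rightarrow> complex"
  shows "summable (\<lambda>k. (cmod (taylor_coeff (\<lambda>z. \<Sum>n<N. a n * \<phi> z ^ n) k))\<^sup>2)" (is "summable ?c")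
    and "1 / 2 * (\<Sum>n<N. (cmod (a n))\<^sup>2 * D n) \<le> (\<Sum>k. (cmod (taylor_coeff (\<lambda>z. \<Sum>n<N. a n * \<phi> z ^ n) k))\<^sup>2)"
    and "(\<Sum>k. (cmod (taylor_coeff (\<lambda>z. \<Sum>n<N. a n * \<phi> z ^ n) k))\<^sup>2) \<le> 7 / 2 * (\<Sum>n<N. (cmod (a n))\<^sup>2 * D n)"
proof -
  define F where "F z = (\<Sum>n<N. a n * \<phi> z ^ n)" for z
  define X where "X = (\<Sum>n<N. (cmod (a n))\<^sup>2 * I (2 * n))"
  have F_holo: "F holomorphic_on ball 0 1"
    unfolding F_def by (intro holomorphic_intros \<phi>_holomorphic)
  have F_bound: "cmod (F z) \<le> (\<Sum>n<N. cmod (a n))" if "cmod z < 1" for z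
    unfolding F_def using \<phi>_self_map[OF that]
    by (intro order_trans[OF norm_sum] sum_mono) (auto simp: norm_mult norm_power intro!: mult_left_le power_le_one)
  have F_lim: "((\<lambda>r. F (of_real r * cis \<theta>)) \<longlongrightarrow> F (cis \<theta>)) (at_left 1)"
    if "\<theta> \<in> {0<..<pi} \<union> {pi<..<2 * pi}" for \<theta>
    unfolding F_def by (intro tendsto_intros \<phi>_radial_limit that)
  show "summable ?c"
    using bounded_holomorphic_coeff_square_summable[OF F_holo F_bound] by (simp add: F_def[abs_def])
  note Par = bounded_holomorphic_Parseval[OF F_holo F_bound F_lim]
  define U where "U = integral {0<..<pi} (\<lambda>\<theta>. (cmod (F (cis \<theta>)))\<^sup>2)"
  define V where "V = integral {pi<..<2 * pi} (\<lambda>\<theta>. (cmod (F (cis \<theta>)))\<^sup>2)"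
  have "U = integral {0<..<pi} (\<lambda>\<theta>. (cmod (\<Sum>n<N. a n * (of_real (E n \<theta>) * e (real n) \<theta>)))\<^sup>2)"
    unfolding U_def F_def by (intro integral_cong) (simp add: \<phi>_upper)
  then have U: "\<bar>U - X\<bar> \<le> 1 / 2 * X"
    using upper_half_integral[where N = N and a = a] by (simp add: X_def)
  have V0: "0 \<le> V" unfolding V_def using Par(2) by (intro integral_nonneg) auto
  have "V \<le> integral {pi<..<2 * pi} (\<lambda>_. (\<Sum>n<N. cmod (a n) * \<delta> ^ n)\<^sup>2)"
    unfolding V_def
  proof (intro integral_le Par(2) const_integrable_Ioo power_mono)
    fix \<theta> assume "\<theta> \<in> {pi<..<2 * pi}"
    from \<phi>_lower[OF this] show "cmod (F (cis \<theta>)) \<le> (\<Sum>n<N. cmod (a n) * \<delta> ^ n)"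
      unfolding F_def
      by (intro order_trans[OF norm_sum] sum_mono) (auto simp: norm_mult norm_power intro!: mult_left_mono power_mono)
  qed auto
  also have "\<dots> = pi * (\<Sum>n<N. cmod (a n) * \<delta> ^ n)\<^sup>2" by (simp add: integral_const_Ioo)
  also have "\<dots> \<le> pi * (2 * (\<Sum>n<N. (cmod (a n))\<^sup>2 * \<delta> ^ n))"
    by (intro mult_left_mono square_sum_geometric_weights_le \<delta>_bounds) auto
  also have "\<dots> = 2 * (\<Sum>n<N. (cmod (a n))\<^sup>2 * (pi * \<delta> ^ n))"
    by (simp add: sum_distrib_left mult_ac)
  also have "\<dots> \<le> 2 * X" unfolding X_def
  proof (intro mult_left_mono sum_mono)
    fix n
    have "\<delta> ^ n \<le> exp (- 2 * A\<^sup>2) ^ n" using \<delta>_bounds by (intro power_mono) auto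
    also have "\<dots> = exp (- real (2 * n) * A\<^sup>2)" by (simp add: exp_of_nat_mult[symmetric] mult_ac)
    finally have "pi * \<delta> ^ n \<le> pi * exp (- real (2 * n) * A\<^sup>2)" by (intro mult_left_mono) auto
    also have "\<dots> \<le> I (2 * n)" by (rule I_ge)
    finally show "pi * \<delta> ^ n \<le> I (2 * n)" .
  qed auto
  finally have V: "V \<le> 2 * X" .
  have S: "2 * pi * (\<Sum>k. (cmod (taylor_coeff F k))\<^sup>2) = U + V" using Par(3) by (simp add: U_def V_def)
  have XD: "(\<Sum>n<N. (cmod (a n))\<^sup>2 * D n) = X / (2 * pi)"
    by (simp add: X_def D_def sum_divide_distrib)
  have FF: "(\<lambda>z. \<Sum>n<N. a n * \<phi> z ^ n) = F" by (simp add: F_def fun_eq_iff)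
  have S': "(\<Sum>k. (cmod (taylor_coeff F k))\<^sup>2) = (U + V) / (2 * pi)"
    using S by (simp add: field_simps)
  show "1 / 2 * (\<Sum>n<N. (cmod (a n))\<^sup>2 * D n) \<le> (\<Sum>k. (cmod (taylor_coeff (\<lambda>z. \<Sum>n<N. a n * \<phi> z ^ n) k))\<^sup>2)"
    unfolding FF XD S' times_divide_eq_right by (intro divide_right_mono) (use U V0 in \<open>auto simp: abs_if split: if_splits\<close>)
  show "(\<Sum>k. (cmod (taylor_coeff (\<lambda>z. \<Sum>n<N. a n * \<phi> z ^ n) k))\<^sup>2) \<le> 7 / 2 * (\<Sum>n<N. (cmod (a n))\<^sup>2 * D n)"
    unfolding FF XD S' times_divide_eq_right by (intro divide_right_mono) (use U V in \<open>auto simp: abs_if split: if_splits\<close>)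
qed

text \<open>Next to the point 1 the weight is at least \<open>exp (- 2)\<close> on an arc of length
  about \<open>n powr (- 2 / p)\<close>, and the power \<open>p / 2\<close> of this length is a
  multiple of \<open>1 / n\<close>. As \<open>p < g\<close>, lowering the rate of decay from
  \<open>g\<close> to \<open>p\<close> absorbs the square in \<open>q\<close>.\<close>

lemma D_lower:
  assumes p: "0 < p" "p < g"
  shows "\<exists>c>0. \<forall>n\<ge>1. c * inverse (real n) \<le> D n powr (p / 2)"
proof -
  \<comment> \<open>Enlarging the shift lowers the growth rate \<open>2 / a\<close> of the square to
    at most \<open>g - p\<close>.\<close>
  define a where "a = A + 2 / (g - p)"
  have a: "a > 0" "A \<le> a" "2 / a \<le> g - p"
  proof -
    show "a > 0" "A \<le> a" using A_pos p by (auto simp: a_def add_pos_pos)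
    have "2 / (g - p) \<le> a" using A_pos by (simp add: a_def)
    then have "2 \<le> a * (g - p)" using p by (simp add: field_simps)
    then show "2 / a \<le> g - p" using \<open>a > 0\<close> by (simp add: field_simps)
  qed
  \<comment> \<open>The 1 ensures \<open>K n \<ge> 1\<close>, hence \<open>t \<le> 1\<close>, the
    range where \<open>log_cot_ge\<close> is available.\<close>
  define K where "K = a\<^sup>2 + 1"
  have K: "K \<ge> 1" "a\<^sup>2 \<le> K" by (auto simp: K_def)
  have q_small: "q y \<le> K * exp (- p * y)" for y
  proof -
    have "(A + sp y)\<^sup>2 \<le> (a + sp y)\<^sup>2" using a A_pos sp_nonneg[of y] by (intro power_mono) auto
    also have "\<dots> \<le> a\<^sup>2 * exp (2 * sp y / a)" using a sp_nonneg by (intro add_square_le_mult_exp) auto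
    also have "\<dots> \<le> a\<^sup>2 * exp ((g - p) * sp y)"
      using mult_right_mono[OF a(3) sp_nonneg[of y]] by (intro mult_left_mono) auto
    finally have "q y \<le> exp (- g * sp y) * (a\<^sup>2 * exp ((g - p) * sp y))"
      unfolding q_def by (intro mult_left_mono) auto
    also have "\<dots> = a\<^sup>2 * exp (- g * sp y + (g - p) * sp y)" unfolding exp_add by (simp only: mult_ac)
    also have "- g * sp y + (g - p) * sp y = - p * sp y" by (simp add: algebra_simps)
    also have "a\<^sup>2 * exp (- p * sp y) \<le> K * exp (- p * y)"
      using K p sp_ge[of y] by (intro mult_mono) auto
    finally show ?thesis .
  qed
  have log_cot_ge: "- ln \<theta> / 2 \<le> log_cot \<theta>" if \<theta>: "0 < \<theta>" "\<theta> \<le> 1" for \<theta>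
  proof -
    have t: "\<theta> \<in> {0<..<pi}" using \<theta> pi_gt3 by auto
    have s: "0 < sin (\<theta> / 2)" "sin (\<theta> / 2) \<le> \<theta> / 2"
      using t \<theta> sin_x_le_x[of "\<theta> / 2"] by (auto intro!: sin_gt_zero)
    have "cos 1 \<le> cos (\<theta> / 2)" using \<theta> pi_gt3 by (intro cos_monotone_0_pi_le) auto
    moreover have "1 / 2 \<le> cos (1 :: real)"
    proof -
      have "cos (pi / 3) \<le> cos (1 :: real)" using pi_gt3 by (intro cos_monotone_0_pi_le) auto
      then show ?thesis by (simp add: cos_60)
    qed
    ultimately have "1 / 2 \<le> cos (\<theta> / 2)" by linarith
    then have "(1 / 2) / (\<theta> / 2) \<le> cos (\<theta> / 2) / sin (\<theta> / 2)"
      using s \<theta> by (intro frac_le) auto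
    then have "inverse \<theta> \<le> cot (\<theta> / 2)" using \<theta> by (simp add: cot_def field_simps)
    then have "ln (inverse \<theta>) \<le> ln (cot (\<theta> / 2))" using \<theta> by (intro ln_mono) auto
    then show ?thesis using \<theta> by (simp add: log_cot_def ln_inverse)
  qed
  define c0 where "c0 = exp (- 2) / (2 * pi)"
  have c0: "c0 > 0" by (simp add: c0_def)
  have "c0 powr (p / 2) / K * inverse (real n) \<le> D n powr (p / 2)" if n: "n \<ge> 1" for n
  proof -
    \<comment> \<open>Solves \<open>K t powr (p / 2) = 1 / n\<close>, so that
      \<open>n q \<le> 1\<close> for angles below \<open>t\<close>.\<close>
    define t where "t = (K * real n) powr (- 2 / p)"
    have Kn: "K * real n \<ge> 1" using K n mult_mono[of 1 K 1 "real n"] by simp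
    have t: "0 < t" "t \<le> 1"
    proof -
      show "0 < t" using K n by (simp add: t_def)
      have "(K * real n) powr (- 2 / p) \<le> (K * real n) powr 0" using Kn p by (intro powr_mono) auto
      then show "t \<le> 1" using K n by (simp add: t_def)
    qed
    have E_ge: "exp (- 2) \<le> E (2 * n) \<theta>" if \<theta>: "\<theta> \<in> {0<..<t}" for \<theta>
    proof -
      have th: "0 < \<theta>" "\<theta> \<le> 1" "\<theta> \<le> t" using \<theta> t by auto
      have "q (log_cot \<theta>) \<le> K * exp (- p * log_cot \<theta>)" by (rule q_small)
      also have "\<dots> \<le> K * exp (- p * (- ln t / 2))"
      proof -
        have "- ln t / 2 \<le> - ln \<theta> / 2" using th ln_mono[of \<theta> t] by simp
        also have "\<dots> \<le> log_cot \<theta>" by (rule log_cot_ge[OF th(1,2)])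
        finally have "- p * log_cot \<theta> \<le> - p * (- ln t / 2)" using p by (intro mult_left_mono_neg) auto
        then show ?thesis using K by (intro mult_left_mono) auto
      qed
      also have "ln t = - 2 / p * ln (K * real n)" using Kn by (simp add: t_def ln_powr)
      also have "- p * (- (- 2 / p * ln (K * real n)) / 2) = - ln (K * real n)" using p by simp
      also have "K * exp (- ln (K * real n)) = 1 / real n" using Kn K n by (simp add: exp_minus field_simps)
      finally have "real n * q (log_cot \<theta>) \<le> 1" using n by (simp add: field_simps)
      then show ?thesis by (simp add: E_def)
    qed
    have "exp (- 2) * t = integral {0<..<t} (\<lambda>_. exp (- 2))" using t by (simp add: integral_const_Ioo)
    also have "\<dots> \<le> integral {0<..<t} (E (2 * n))"
      using E_ge t pi_gt3
      by (intro integral_le const_integrable_Ioo bounded_continuous_integrable_Ioo[where B = 1] continuous_on_subset[OF E_cont])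
         (use E_pos E_le_1 in \<open>auto simp: less_imp_le\<close>)
    also have "\<dots> \<le> I (2 * n)" unfolding I_def
      using t pi_gt3
      by (intro integral_subset_le E_integrable bounded_continuous_integrable_Ioo[where B = 1] continuous_on_subset[OF E_cont])
         (use E_pos E_le_1 in \<open>auto simp: less_imp_le\<close>)
    finally have "c0 * t \<le> D n" by (simp add: D_def c0_def field_simps)
    then have "(c0 * t) powr (p / 2) \<le> D n powr (p / 2)"
      using c0 t p by (intro powr_mono2) auto
    moreover have "(c0 * t) powr (p / 2) = c0 powr (p / 2) / K * inverse (real n)"
    proof -
      have "t powr (p / 2) = (K * real n) powr - 1" using p by (simp add: t_def powr_powr)
      also have "\<dots> = inverse (K * real n)" using Kn by (simp add: powr_minus)
      finally show ?thesis using c0 t by (simp add: powr_mult field_simps)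
    qed
    ultimately show ?thesis by simp
  qed
  then show ?thesis using c0 K by (intro exI[of _ "c0 powr (p / 2) / K"]) auto
qed

text \<open>As a function of \<open>s\<close>, \<open>q\<close> falls at least at the rate
  \<open>g / 2\<close>, since its square factor grows at most at that rate. Beyond a critical angle,
  \<open>n q\<close> thus grows at least like a power of the angle.\<close>

lemma weight_growth:
  assumes "0 \<le> s" "s \<le> m"
  shows "exp (g / 2 * (m - s)) * (exp (- g * m) * (A + m)\<^sup>2) \<le> exp (- g * s) * (A + s)\<^sup>2"
proof -
  have As: "A + s > 0" using A_pos assms by simp
  have "(A + m)\<^sup>2 = ((A + s) + (m - s))\<^sup>2" by simp
  also have "\<dots> \<le> (A + s)\<^sup>2 * exp (2 * (m - s) / (A + s))"
    using As assms by (intro add_square_le_mult_exp) auto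
  also have "\<dots> \<le> (A + s)\<^sup>2 * exp (g / 2 * (m - s))"
  proof -
    have "2 / (A + s) \<le> 2 / A" using A_pos assms by (intro divide_left_mono) auto
    also have "\<dots> = g / 2" using g by (simp add: A_def)
    finally show ?thesis using mult_right_mono[of "2 / (A + s)" "g / 2" "m - s"] assms
      by (intro mult_left_mono) auto
  qed
  finally have "exp (g / 2 * (m - s)) * (exp (- g * m) * (A + m)\<^sup>2) \<le>
     exp (g / 2 * (m - s)) * (exp (- g * m) * ((A + s)\<^sup>2 * exp (g / 2 * (m - s))))"
    by (intro mult_left_mono) auto
  also have "\<dots> = exp (g / 2 * (m - s) + (- g * m) + g / 2 * (m - s)) * (A + s)\<^sup>2"
    unfolding exp_add by (simp only: mult_ac)
  also have "g / 2 * (m - s) + (- g * m) + g / 2 * (m - s) = - g * s" by (simp add: algebra_simps)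
  finally show ?thesis .
qed

lemma sp_log_cot_le:
  assumes "\<theta> \<in> {0<..<pi}"
  shows "sp (log_cot \<theta>) \<le> ln (4 * pi / \<theta>) / 2"
proof -
  have \<theta>: "0 < \<theta>" "\<theta> < pi" using assms by auto
  have c: "cos (\<theta> / 2) > 0" "sin (\<theta> / 2) > 0"
    using \<theta> by (auto intro!: cos_gt_zero_pi sin_gt_zero)
  have "\<theta> / 2 * cos (\<theta> / 2) \<le> sin (\<theta> / 2)" using \<theta> by (intro mult_cos_le_sin) auto
  then have "cot (\<theta> / 2) \<le> 2 / \<theta>" using c \<theta> by (simp add: cot_def field_simps)
  \<comment> \<open>The weaker constant \<open>pi\<close> keeps the bound above 1 on the whole
    interval, so that \<open>u \<ge> 0\<close>.\<close>
  also have "\<dots> \<le> pi / \<theta>" using \<theta> pi_gt3 by (intro divide_right_mono) auto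
  finally have cot: "cot (\<theta> / 2) \<le> pi / \<theta>" .
  define u where "u = ln (pi / \<theta>) / 2"
  have u: "u \<ge> 0" using \<theta> by (simp add: u_def)
  have "log_cot \<theta> \<le> u" unfolding log_cot_def u_def using cot cot_half_pos[OF assms] by (intro divide_right_mono ln_mono) auto
  then have "exp (log_cot \<theta>) \<le> exp u" "1 \<le> exp u" using u by simp_all
  then have "1 + exp (log_cot \<theta>) \<le> 2 * exp u" by linarith
  then have "sp (log_cot \<theta>) \<le> ln (2 * exp u)" unfolding sp_def by (intro ln_mono one_plus_exp_pos) 
  also have "\<dots> = (2 * ln 2 + ln (pi / \<theta>)) / 2" by (simp add: ln_mult u_def)
  also have "2 * ln 2 = ln (4 :: real)" using ln_realpow[of 2 2] by simp
  also have "ln 4 + ln (pi / \<theta>) = ln (4 * pi / \<theta>)" using \<theta> ln_mult[of 4 "pi / \<theta>"] by simp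
  finally show ?thesis .
qed

text \<open>\<open>m\<close> is the level of \<open>sp\<close> at which \<open>n q\<close> is of
  order 1, and \<open>t\<close> is the angle belonging to it. Beyond \<open>t\<close> the integrand
  decays at least like the inverse square of \<open>\<theta> / t\<close>, so the integral is at most
  a multiple of \<open>t\<close>, whose power \<open>g / 2\<close> is a multiple of
  \<open>exp (- g m) = 1 / (n L^2)\<close>.\<close>

lemma D_upper: "\<exists>K>0. \<forall>n\<ge>1. D n powr (g / 2) \<le> K * (1 / (real n * (4 + ln (real n))\<^sup>2))"
proof -
  \<comment> \<open>With \<open>y = \<tau> powr (g / 4)\<close> below, \<open>j \<ge> 8 / g\<close>
    makes \<open>y ^ j\<close> at least \<open>\<tau>\<^sup>2\<close>.\<close>
  obtain j :: nat where j: "8 / g \<le> real j" using real_arch_simple by blast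
  have j0: "j > 0" using j g by (cases j) (auto simp: field_simps)
  have jg: "2 \<le> real j * (g / 4)" using j g by (simp add: field_simps)
  \<comment> \<open>Chosen so that the power \<open>j\<close> of \<open>exp (y / b)\<close> is
    \<open>exp (2 / g\<^sup>2 * y)\<close>, the reciprocal of the decay that \<open>level\<close>
    yields.\<close>
  define b where "b = real j * g\<^sup>2 / 2"
  have b: "b > 0" using j0 g by (simp add: b_def)
  define K1 where "K1 = b ^ j"
  have K1: "K1 > 0" using b by (simp add: K1_def)
  have pow_exp: "y ^ j \<le> K1 * exp (2 / g\<^sup>2 * y)" if "y \<ge> 0" for y
  proof -
    have "y \<le> b + y" using b by simp
    also have "\<dots> \<le> b * exp (y / b)" by (rule add_le_mult_exp[OF b])
    finally have "y ^ j \<le> (b * exp (y / b)) ^ j" using that by (intro power_mono)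
    also have "\<dots> = K1 * exp (y / b) ^ j" by (simp add: K1_def power_mult_distrib)
    also have "exp (y / b) ^ j = exp (real j * (y / b))" by (rule exp_of_nat_mult[symmetric])
    also have "real j * (y / b) = 2 / g\<^sup>2 * y" using j0 g by (simp add: b_def)
    finally show ?thesis .
  qed
  have bound: "D n powr (g / 2) \<le> (8 * (1 + K1)) powr (g / 2) * (1 / (real n * (4 + ln (real n))\<^sup>2))" if n: "n \<ge> 1" for n
  proof -
    define L where "L = 4 + ln (real n)"
    have L: "L \<ge> 4" using n by (simp add: L_def)
    have nL: "real n * L\<^sup>2 \<ge> 1" using n L mult_mono[of 1 "real n" 1 "L\<^sup>2"] one_le_power[of L 2] by simp
    \<comment> \<open>The factor \<open>L\<^sup>2\<close> anticipates the size
      \<open>(L / g)\<^sup>2\<close> of the square in \<open>q\<close> at this level; the 4 in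
      \<open>L\<close> is \<open>g A\<close>.\<close>
    define m where "m = ln (real n * L\<^sup>2) / g"
    have m: "m \<ge> 0" using nL g by (simp add: m_def)
    have gm: "exp (- g * m) = 1 / (real n * L\<^sup>2)"
    proof -
      have "0 < real n * L\<^sup>2" using nL by linarith
      then show ?thesis using g by (simp add: m_def exp_minus inverse_eq_divide)
    qed
    \<comment> \<open>The angle at which the bound for \<open>sp (log_cot \<theta>)\<close> equals
      \<open>m\<close>.\<close>
    define t where "t = 4 * pi * exp (- 2 * m)"
    have t: "t > 0" by (simp add: t_def)
    have level: "1 / g\<^sup>2 \<le> real n * (exp (- g * m) * (A + m)\<^sup>2)"
    proof -
      have "ln (real n * L\<^sup>2) = ln (real n) + 2 * ln L" using n L by (simp add: ln_mult ln_realpow)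
      then have "A + m = (L + 2 * ln L) / g" by (simp add: A_def m_def L_def add_divide_distrib)
      moreover have "L / g \<le> (L + 2 * ln L) / g" using L g by (intro divide_right_mono) auto
      ultimately have "(L / g)\<^sup>2 \<le> (A + m)\<^sup>2" using L g by (intro power_mono) auto
      then have "1 / g\<^sup>2 * L\<^sup>2 \<le> (A + m)\<^sup>2" by (simp add: power_divide)
      then show ?thesis using n L unfolding gm by (simp add: field_simps)
    qed
    \<comment> \<open>One majorant for both sides of \<open>t\<close>, with an elementary
      antiderivative and an integral of order \<open>t\<close>; it covers the case that
      \<open>t\<close> exceeds \<open>pi\<close> as well.\<close>
    have E_le: "E (2 * n) \<theta> \<le> 4 * (1 + K1) * (t\<^sup>2 / (\<theta> + t)\<^sup>2)" if \<theta>: "\<theta> \<in> {0<..<pi}" for \<theta>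
    proof (cases "\<theta> \<le> t")
      case True
      have "(\<theta> + t)\<^sup>2 \<le> (2 * t)\<^sup>2" using True \<theta> t by (intro power_mono) auto
      then have "1 \<le> 4 * (t\<^sup>2 / (\<theta> + t)\<^sup>2)" using \<theta> t by (simp add: field_simps power_mult_distrib)
      also have "\<dots> \<le> (1 + K1) * (4 * (t\<^sup>2 / (\<theta> + t)\<^sup>2))"
        using mult_right_mono[of 1 "1 + K1" "4 * (t\<^sup>2 / (\<theta> + t)\<^sup>2)"] K1 by simp
      finally have "1 \<le> 4 * (1 + K1) * (t\<^sup>2 / (\<theta> + t)\<^sup>2)" by (simp only: mult_ac)
      with E_le_1[of "2 * n" \<theta>] show ?thesis by (rule order_trans)
    next
      case False
      define \<tau> where "\<tau> = \<theta> / t"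
      have \<tau>: "\<tau> > 1" using False t by (simp add: \<tau>_def)
      define M where "M = ln (4 * pi / \<theta>) / 2"
      have mM: "m - M = ln \<tau> / 2"
      proof -
        have "ln t = ln (4 * pi) - 2 * m" using t by (simp add: t_def ln_mult)
        then show ?thesis using \<theta> t by (simp add: M_def \<tau>_def ln_div field_simps)
      qed
      have "sp (log_cot \<theta>) \<le> M" unfolding M_def by (rule sp_log_cot_le[OF \<theta>])
      moreover have "M \<le> m" using mM \<tau> ln_gt_zero[of \<tau>] by linarith
      ultimately have "exp (g / 2 * (m - M)) * (exp (- g * m) * (A + m)\<^sup>2) \<le> q (log_cot \<theta>)"
      proof -
        assume le: "sp (log_cot \<theta>) \<le> M" "M \<le> m"
        have "exp (g / 2 * (m - M)) * (exp (- g * m) * (A + m)\<^sup>2) \<le>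
            exp (g / 2 * (m - sp (log_cot \<theta>))) * (exp (- g * m) * (A + m)\<^sup>2)"
          using le g by (intro mult_right_mono) auto
        also have "\<dots> \<le> q (log_cot \<theta>)" unfolding q_def
          using le sp_nonneg by (intro weight_growth) auto
        finally show ?thesis .
      qed
      then have "real n * (exp (g / 2 * (m - M)) * (exp (- g * m) * (A + m)\<^sup>2)) \<le> real n * q (log_cot \<theta>)"
        by (intro mult_left_mono) auto
      moreover define y where "y = exp (g / 4 * ln \<tau>)"
      have "exp (g / 2 * (m - M)) = y" by (simp add: y_def mM)
      ultimately have "y * (real n * (exp (- g * m) * (A + m)\<^sup>2)) \<le> real n * q (log_cot \<theta>)" by (simp add: mult_ac)
      moreover have "y * (1 / g\<^sup>2) \<le> y * (real n * (exp (- g * m) * (A + m)\<^sup>2))"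
        by (intro mult_left_mono level) (simp add: y_def)
      ultimately have "y * (1 / g\<^sup>2) \<le> real n * q (log_cot \<theta>)" by (rule order_trans[rotated])
      from mult_left_mono[OF this, of 2] have "2 / g\<^sup>2 * y \<le> real (2 * n) * q (log_cot \<theta>)" by simp
      then have "E (2 * n) \<theta> \<le> exp (- (2 / g\<^sup>2 * y))"
        unfolding E_def exp_le_cancel_iff mult_minus_left neg_le_iff_le .
      also have "\<dots> \<le> K1 / y ^ j"
        using pow_exp[of y] by (simp add: y_def exp_minus field_simps)
      also have "\<dots> \<le> K1 / \<tau>\<^sup>2"
      proof -
        have "\<tau>\<^sup>2 = exp (2 * ln \<tau>)" using \<tau> by (simp add: exp_double)
        also have "\<dots> \<le> exp (real j * (g / 4) * ln \<tau>)"
          using jg \<tau> by (simp only: exp_le_cancel_iff) (intro mult_right_mono, auto)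
        also have "\<dots> = y ^ j" by (simp add: y_def exp_of_nat_mult[symmetric] mult_ac)
        finally show ?thesis using K1 \<tau> by (intro divide_left_mono mult_pos_pos) (auto simp: y_def)
      qed
      also have "\<dots> \<le> 4 * (1 + K1) * (t\<^sup>2 / (\<theta> + t)\<^sup>2)"
      proof -
        have "(\<theta> + t)\<^sup>2 \<le> (2 * \<theta>)\<^sup>2" using False \<theta> t by (intro power_mono) auto
        then have "1 / (2 * \<theta>)\<^sup>2 \<le> 1 / (\<theta> + t)\<^sup>2" using \<theta> t by (intro divide_left_mono) auto
        then have "4 * t\<^sup>2 * (1 / (2 * \<theta>)\<^sup>2) \<le> 4 * t\<^sup>2 * (1 / (\<theta> + t)\<^sup>2)" by (intro mult_left_mono) auto
        then have "1 / \<tau>\<^sup>2 \<le> 4 * (t\<^sup>2 / (\<theta> + t)\<^sup>2)"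
          by (simp add: \<tau>_def power_divide power_mult_distrib)
        then have "K1 * (1 / \<tau>\<^sup>2) \<le> (1 + K1) * (4 * (t\<^sup>2 / (\<theta> + t)\<^sup>2))"
          using K1 by (intro mult_mono) auto
        also have "\<dots> = 4 * (1 + K1) * (t\<^sup>2 / (\<theta> + t)\<^sup>2)" by (simp only: mult_ac)
        finally show ?thesis by simp
      qed
      finally show ?thesis .
    qed
    have "((\<lambda>\<theta>. t\<^sup>2 / (\<theta> + t)\<^sup>2) has_integral (- (t\<^sup>2 / (pi + t)) - (- (t\<^sup>2 / (0 + t))))) {0..pi}"
    proof (rule fundamental_theorem_of_calculus)
      fix \<theta> :: real assume \<theta>: "\<theta> \<in> {0..pi}"
      then have "\<theta> + t \<noteq> 0" using t by auto
      then have "((\<lambda>\<theta>. - (t\<^sup>2 / (\<theta> + t))) has_real_derivative t\<^sup>2 / (\<theta> + t)\<^sup>2) (at \<theta> within {0..pi})"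
        by (auto intro!: derivative_eq_intros simp: power2_eq_square)
      then show "((\<lambda>\<theta>. - (t\<^sup>2 / (\<theta> + t))) has_vector_derivative t\<^sup>2 / (\<theta> + t)\<^sup>2) (at \<theta> within {0..pi})"
        by (simp add: has_real_derivative_iff_has_vector_derivative)
    qed simp
    then have hi: "((\<lambda>\<theta>. 4 * (1 + K1) * (t\<^sup>2 / (\<theta> + t)\<^sup>2)) has_integral
        4 * (1 + K1) * (- (t\<^sup>2 / (pi + t)) - (- (t\<^sup>2 / (0 + t))))) {0<..<pi}"
      unfolding has_integral_Icc_iff_Ioo by (rule has_integral_mult_right)
    have "I (2 * n) \<le> 4 * (1 + K1) * (- (t\<^sup>2 / (pi + t)) - (- (t\<^sup>2 / (0 + t))))"
      unfolding I_def using integrable_integral[OF E_integrable] hi by (rule has_integral_le) (rule E_le)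
    also have "\<dots> \<le> 4 * (1 + K1) * t"
      using K1 t by (intro mult_left_mono) (auto simp: power2_eq_square)
    finally have "D n \<le> 4 * (1 + K1) * t / (2 * pi)" by (simp add: D_def divide_right_mono)
    also have "\<dots> = 8 * (1 + K1) * exp (- 2 * m)" by (simp add: t_def)
    finally have "D n powr (g / 2) \<le> (8 * (1 + K1) * exp (- 2 * m)) powr (g / 2)"
      using g D_pos[of n] by (intro powr_mono2) auto
    also have "\<dots> = (8 * (1 + K1)) powr (g / 2) * exp (- g * m)"
      using K1 by (simp add: powr_mult exp_powr_real)
    finally show ?thesis unfolding gm L_def .
  qed
  show ?thesis
    by (intro exI[of _ "(8 * (1 + K1)) powr (g / 2)"] conjI allI impI bound) (use K1 in auto)
qed

section \<open>Convergence at the critical exponent, divergence below it\<close>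

lemma D_summable: "summable (\<lambda>n. D n powr (g / 2))"
proof -
  obtain K where K: "K > 0" "\<And>n. n \<ge> 1 \<Longrightarrow> D n powr (g / 2) \<le> K * (1 / (real n * (4 + ln (real n))\<^sup>2))"
    using D_upper by blast
  have "summable (\<lambda>n. D (Suc n) powr (g / 2))"
  proof (rule summable_comparison_test')
    show "summable (\<lambda>n. K * (1 / (real (Suc n) * (4 + ln (real (Suc n)))\<^sup>2)))"
      by (intro summable_mult summable_inverse_mult_ln_square)
    show "norm (D (Suc n) powr (g / 2)) \<le> K * (1 / (real (Suc n) * (4 + ln (real (Suc n)))\<^sup>2))" for n
      using K(2)[of "Suc n"] by simp
  qed
  then show ?thesis by (rule summable_Suc_iff[THEN iffD1])
qed

lemma D_not_summable:
  assumes "0 < p" "p < g"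
  shows "\<not> summable (\<lambda>n. D n powr (p / 2))"
proof
  assume "summable (\<lambda>n. D n powr (p / 2))"
  obtain c where c: "c > 0" "\<And>n. n \<ge> 1 \<Longrightarrow> c * inverse (real n) \<le> D n powr (p / 2)"
    using D_lower[OF assms] by blast
  have "summable (\<lambda>n. c * inverse (real n))"
    by (rule summable_comparison_test'[OF \<open>summable (\<lambda>n. D n powr (p / 2))\<close>, of 1]) (use c in auto)
  then show False using c not_summable_harmonic[where 'a = real] by simp
qed

text \<open>Read off from summability at the exponent \<open>g\<close>: the terms of that series
  tend to 0, and so do their powers with exponent \<open>2 / g\<close>.\<close>

lemma D_tendsto_0: "D \<longlonglongrightarrow> 0"
proof -
  have "(\<lambda>n. (D n powr (g / 2)) powr (2 / g)) \<longlonglongrightarrow> 0 powr (2 / g)"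
    by (intro tendsto_powr' summable_LIMSEQ_zero D_summable tendsto_const) (use g in auto)
  moreover have "(D n powr (g / 2)) powr (2 / g) = D n" for n
    using g D_pos[of n] by (simp add: powr_powr)
  ultimately show ?thesis by simp
qed

sublocale diagonal_composition \<phi> D "1 / 2" "7 / 2"
  by unfold_locales
     (fact \<phi>_holomorphic \<phi>_self_map D_pos D_decseq D_tendsto_0 polynomial_coefficients | simp)+

end

theorem theorem5p4:
  fixes p\<^sub>0 :: real
  assumes "p\<^sub>0 > 0"
  shows "\<exists>\<phi> :: complex \<Rightarrow> complex.
           \<phi> holomorphic_on ball 0 1 \<and> \<phi> ` ball 0 1 \<subseteq> ball 0 1 \<and>
           comp_op \<phi> \<in> schatten p\<^sub>0 \<and>
           (\<forall>p. 0 < p \<and> p < p\<^sub>0 \<longrightarrow> comp_op \<phi> \<notin> schatten p)"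
proof -
  interpret symbol p\<^sub>0 by unfold_locales fact
  have "comp_op \<phi> \<in> schatten p\<^sub>0"
    using comp_op_schatten_iff[OF assms] D_summable by blast
  moreover have "comp_op \<phi> \<notin> schatten p" if "0 < p" "p < p\<^sub>0" for p
    using comp_op_schatten_iff[OF that(1)] D_not_summable[OF that] by blast
  moreover have "\<phi> ` ball 0 1 \<subseteq> ball 0 1"
    using \<phi>_self_map by auto
  ultimately show ?thesis using \<phi>_holomorphic by blast
qed

end
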